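(* Let $n\ge2$ and let $u:\mathbb{R}^n\times[0,T)\to\mathbb{R}$ be a smooth solution of $$\frac{\partial u}{\partial t}=\frac{1}{\sqrt{-1}}\log\frac{\det(I+\sqrt{-1}\,D^2u)}{\sqrt{\det(I+(D^2u)^2)}},$$ and suppose that $u(\cdot,t)$ is strictly $2$-convex for all $t\in[0,T)$. Then, in the parametric form of the mean curvature flow, $\log\det S^{[2]}$ satisfies $$\Big(\frac{\partial}{\partial t}-\Delta\Big)\log\det S^{[2]}\ \ge\ 2|A|^2+\frac{1}{n(n-1)}\big|\nabla\log\det S^{[2]}\big|^2 .$$
   Context: $D$ denotes the spatial derivative in $x\in\mathbb{R}^n$. If $\lambda_1,\dots,\lambda_n$ are the eigenvalues of $D^2u$, the right-hand side of the evolution equation is $\sum_i\arctan\lambda_i$. A $C^2$ function $u:\mathbb{R}^n\to\mathbb{R}$ is strictly $2$-convex if at every point the eigenvalues $\lambda_1,\dots,\lambda_n$ of $D^2u$ satisfy $\lambda_i+\lambda_j>0$ and $1+\lambda_i\lambda_j>0$ for all $i\ne j$. For a function $u$ on $\mathbb{R}^n$ the graph of the gradient $L_u=\{(x,Du(x)):x\in\mathbb{R}^n\}\subset\mathbb{R}^n\oplus\mathbb{R}^n=\mathbb{R}^{2n}$ is a Lagrangian submanifold, equipped with the metric induced from the Euclidean metric. Let $J$ be the standard complex structure and $\pi_1,\pi_2$ the projections to the two factors. Let $S$ be the restriction to $L_u$ of the tensor $S(X,Y)=\langle J\pi_1(X),\pi_2(Y)\rangle$; it is symmetric on $TL_u$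 and has eigenvalues $\lambda_i/(1+\lambda_i^2)$ with respect to the induced metric. $S^{[2]}$ is the symmetric endomorphism of $\Lambda^2TL_u$ given in an orthonormal frame by $S^{[2]}_{(ij)(k\ell)}=S_{ik}\delta_{j\ell}+S_{j\ell}\delta_{ik}-S_{i\ell}\delta_{jk}-S_{jk}\delta_{i\ell}$, so that at $(x,Du(x))$ $$\det S^{[2]}=\prod_{i<j}\frac{(\lambda_i+\lambda_j)(1+\lambda_i\lambda_j)}{(1+\lambda_i^2)(1+\lambda_j^2)},$$ with $\lambda_i$ the eigenvalues of $D^2u(x)$. $|A|^2$ is the squared norm of the second fundamental form of $L_u$ in $\mathbb{R}^{2n}$. Parametric form: $F(x,t)=(\phi_t(x),Du(\phi_t(x),t))$, where $\phi_t$ is a time-dependent family of diffeomorphisms such that $\frac{\partial}{\partial t}F=H$, with $H$ the mean curvature vector of $L_{u(\cdot,t)}$ in $\mathbb{R}^{2n}$. The functions $\det S^{[2]}$ and $|A|^2$ are regarded as functions of $(x,t)$ via $F$; $\partial/\partial t$ is taken at fixed $x$, and $\Delta$, $\nabla$, $|\cdot|$ are the Laplace–Beltrami operator, gradient and norm of the metric induced by $F(\cdot,t)$. *)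

theory Defs
  imports "HOL-Analysis.Analysis" "HOL-Computational_Algebra.Polynomial"
begin

section \<open>Smooth maps\<close>

text \<open>
  Iterated Frechet derivatives, taken within the domain so that the sets
  \<open>UNIV \<times> [0,T)\<close> are covered; there the derivatives are unique and one-sided in time at
  \<open>t = 0\<close>.
\<close>

primrec Ck_on :: "nat \<Rightarrow> ('a::euclidean_space \<Rightarrow> 'b::real_normed_vector) \<Rightarrow> 'a set \<Rightarrow> bool" where
  "Ck_on 0 f S \<longleftrightarrow> continuous_on S f"
| "Ck_on (Suc k) f S \<longleftrightarrow>
     (\<exists>f'. (\<forall>x\<in>S. (f has_derivative f' x) (at x within S)) \<and> (\<forall>v. Ck_on k (\<lambda>x. f' x v) S))"

definition smooth_on :: "('a::euclidean_space \<Rightarrow> 'b::real_normed_vector) \<Rightarrow> 'a set \<Rightarrow> bool" where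
  "smooth_on f S \<longleftrightarrow> (\<forall>k. Ck_on k f S)"

definition diffeomorphism :: "(real^'n \<Rightarrow> real^'n) \<Rightarrow> bool" where
  "diffeomorphism f \<longleftrightarrow> bij f \<and> smooth_on f UNIV \<and> smooth_on (inv f) UNIV"

text \<open>The interval \<open>[0,T)\<close>, where \<open>T\<close> may be infinite.\<close>

definition time_interval :: "ereal \<Rightarrow> real set" where
  "time_interval T = {t. 0 \<le> t \<and> ereal t < T}"


section \<open>Gradient, Hessian, eigenvalues\<close>

definition partial :: "'n \<Rightarrow> (real^'n \<Rightarrow> 'b::real_normed_vector) \<Rightarrow> real^'n \<Rightarrow> 'b" where
  "partial i f x = frechet_derivative f (at x) (axis i 1)"

definition gradient :: "(real^'n \<Rightarrow> real) \<Rightarrow> real^'n \<Rightarrow> real^'n" where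
  "gradient v x = (\<chi> i. partial i v x)"

definition hessian :: "(real^'n \<Rightarrow> real) \<Rightarrow> real^'n \<Rightarrow> real^'n^'n" where
  "hessian v x = (\<chi> i j. partial i (partial j v) x)"

text \<open>\<open>eigenvalues M l\<close>: the family \<open>l\<close> lists the eigenvalues of \<open>M\<close> with multiplicity.\<close>

definition eigenvalues :: "real^'n^'n \<Rightarrow> ('n \<Rightarrow> real) \<Rightarrow> bool" where
  "eigenvalues M l \<longleftrightarrow> (\<forall>z. det (mat z - M) = (\<Prod>i\<in>UNIV. z - l i))"

definition strictly_2_convex :: "(real^'n \<Rightarrow> real) \<Rightarrow> bool" where
  "strictly_2_convex v \<longleftrightarrow> Ck_on 2 v UNIV \<and>
     (\<forall>x. \<exists>l. eigenvalues (hessian v x) l \<and>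
        (\<forall>i j. i \<noteq> j \<longrightarrow> l i + l j > 0 \<and> 1 + l i * l j > 0))"


section \<open>The right-hand side of the evolution equation\<close>

definition complex_matrix :: "real^'n^'n \<Rightarrow> complex^'n^'n" where
  "complex_matrix M = (\<chi> i j. complex_of_real (M $ i $ j))"

definition unit_det :: "real^'n^'n \<Rightarrow> complex" where
  "unit_det M = det (mat 1 + (\<chi> i j. \<i> * complex_matrix M $ i $ j)) /
     complex_of_real (sqrt (det (mat 1 + M ** M)))"

text \<open>
  \<open>log (unit_det M)\<close>.  The branch is not the principal one: its imaginary part is the sum of the
  arctangents of the eigenvalues, which ranges over \<open>(- n \<pi> / 2, n \<pi> / 2)\<close>.
\<close>

definition log_unit_det :: "real^'n^'n \<Rightarrow> complex" where
  "log_unit_det M = (THE w. exp w = unit_det M \<and>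
     (\<exists>l. eigenvalues M l \<and> Im w = (\<Sum>i\<in>UNIV. arctan (l i))))"


text \<open>Existence and uniqueness of the value described by \<open>log_unit_det\<close>.\<close>

lemma eigenvalues_sum_unique:
  assumes "eigenvalues M l" "eigenvalues M l'"
  shows "(\<Sum>i\<in>UNIV. g (l i)) = (\<Sum>i\<in>UNIV. g (l' i) :: real)"
proof -
  have "poly (\<Prod>i\<in>UNIV. [:- l i, 1:]) = poly (\<Prod>i\<in>UNIV. [:- l' i, 1:])"
    using assms by (auto simp: eigenvalues_def poly_prod)
  then have "(\<Prod>i\<in>UNIV. [:- l i, 1:]) = (\<Prod>i\<in>UNIV. [:- l' i, 1:])"
    by (simp add: poly_eq_poly_eq_iff)
  moreover have "proots (\<Prod>i\<in>UNIV. [:- k i, 1:]) = image_mset k (mset_set UNIV)" for k :: "'a \<Rightarrow> real"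
    by (subst proots_prod) (auto simp: sum_unfold_sum_mset)
  ultimately have "image_mset l (mset_set UNIV) = image_mset l' (mset_set UNIV)"
    by metis
  then have "sum_mset (image_mset g (image_mset l (mset_set UNIV))) = sum_mset (image_mset g (image_mset l' (mset_set UNIV)))"
    by simp
  then show ?thesis
    by (simp add: sum_unfold_sum_mset multiset.map_comp comp_def)
qed

lemma eigenvalues_complex:
  assumes "eigenvalues M l"
  shows "det (mat z - complex_matrix M) = (\<Prod>i\<in>UNIV. z - complex_of_real (l i))"
proof -
  define P where "P = (\<Sum>p | p permutes (UNIV::'a set). of_int (sign p) *
      (\<Prod>i\<in>UNIV. [:- complex_of_real (M $ i $ p i), of_bool (i = p i):]))"
  define Q where "Q = (\<Prod>i\<in>UNIV. [:- complex_of_real (l i), 1:])"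
  have P: "poly P z = det (mat z - complex_matrix M)" for z
    unfolding P_def det_def poly_sum poly_mult poly_prod
    by (auto intro!: sum.cong prod.cong simp: mat_def complex_matrix_def)
  have Q: "poly Q z = (\<Prod>i\<in>UNIV. z - complex_of_real (l i))" for z
    by (auto simp: Q_def poly_prod)
  have "poly P (of_real r) = poly Q (of_real r)" for r
  proof -
    have "det (mat (of_real r) - complex_matrix M) = of_real (det (mat r - M))"
      by (auto simp: det_def mat_def complex_matrix_def intro!: sum.cong prod.cong)
    then show ?thesis
      using assms by (simp add: P Q eigenvalues_def)
  qed
  then have "range of_real \<subseteq> {z. poly (P - Q) z = 0}"
    by auto
  moreover have "infinite (range (of_real :: real \<Rightarrow> complex))"
    by (metis finite_imageD infinite_UNIV_char_0 inj_of_real)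
  ultimately have "P - Q = 0"
    using poly_roots_finite infinite_super by blast
  then show ?thesis
    by (metis P Q right_minus_eq)
qed

lemma det_smult_complex: "det (\<chi> i j. c * (A::complex^'n^'n) $ i $ j) = c ^ CARD('n) * det A"
  by (simp add: det_def sum_distrib_left prod.distrib algebra_simps)

lemma eigenvalues_det:
  fixes M :: "real^'n^'n"
  assumes "eigenvalues M l" "c \<noteq> 0"
  shows "det (mat 1 + (\<chi> i j. c * complex_matrix M $ i $ j)) = (\<Prod>i\<in>UNIV. 1 + c * complex_of_real (l i))"
proof -
  have "mat 1 + (\<chi> i j. c * complex_matrix M $ i $ j) =
      (\<chi> i j. - c * (mat (- 1 / c) - complex_matrix M) $ i $ j)"
    using \<open>c \<noteq> 0\<close> by (auto simp: vec_eq_iff mat_def algebra_simps)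
  then have "det (mat 1 + (\<chi> i j. c * complex_matrix M $ i $ j)) =
     (- c) ^ CARD('n) * det (mat (- 1 / c) - complex_matrix M)"
    by (simp only: det_smult_complex)
  also have "\<dots> = (\<Prod>i\<in>UNIV. - c * (- 1 / c - complex_of_real (l i)))"
    by (simp only: eigenvalues_complex[OF assms(1)] prod.distrib prod_constant)
  also have "\<dots> = (\<Prod>i\<in>UNIV. 1 + c * complex_of_real (l i))"
    using \<open>c \<noteq> 0\<close> by (intro prod.cong) (auto simp: algebra_simps)
  finally show ?thesis .
qed

lemma eigenvalues_det_square:
  fixes M :: "real^'n^'n"
  assumes "eigenvalues M l"
  shows "det (mat 1 + M ** M) = (\<Prod>i\<in>UNIV. 1 + (l i)\<^sup>2)"
proof -
  let ?A = "mat 1 + (\<chi> i j. \<i> * complex_matrix M $ i $ j)"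
  let ?B = "mat 1 + (\<chi> i j. - \<i> * complex_matrix M $ i $ j)"
  have "?A ** ?B = complex_matrix (mat 1 + M ** M)"
  proof -
    have "(?A ** ?B) $ i $ j = complex_matrix (mat 1 + M ** M) $ i $ j" for i j
      by (simp add: matrix_matrix_mult_def mat_def complex_matrix_def distrib_left distrib_right
          sum.distrib sum_negf if_distrib[of "\<lambda>x. x * _"] if_distrib[of "\<lambda>x. _ * x"]
          sum_subtractf sum.delta sum.delta' algebra_simps cong: if_cong)
    then show ?thesis by (simp add: vec_eq_iff)
  qed
  moreover have "det (complex_matrix N) = of_real (det N)" for N :: "real^'n^'n"
    by (simp add: det_def complex_matrix_def)
  ultimately have "complex_of_real (det (mat 1 + M ** M)) = det ?A * det ?B"
    by (metis det_mul)
  also have "\<dots> = (\<Prod>i\<in>UNIV. (1 + \<i> * complex_of_real (l i)) * (1 + - \<i> * complex_of_real (l i)))"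
    using eigenvalues_det[OF assms, of "\<i>"] eigenvalues_det[OF assms, of "- \<i>"]
    by (simp add: prod.distrib)
  also have "\<dots> = complex_of_real (\<Prod>i\<in>UNIV. 1 + (l i)\<^sup>2)"
    unfolding of_real_prod by (intro prod.cong) (auto simp: algebra_simps power2_eq_square)
  finally show ?thesis
    using of_real_eq_iff by blast
qed

lemma log_unit_det_eq:
  assumes "eigenvalues M l"
  shows "log_unit_det M = \<i> * complex_of_real (\<Sum>i\<in>UNIV. arctan (l i))"
proof -
  have *: "(1 + \<i> * complex_of_real x) / complex_of_real (sqrt (1 + x\<^sup>2)) = exp (\<i> * of_real (arctan x))" for x
    by (simp add: complex_eq_iff exp_eq_polar cis.simps cos_arctan sin_arctan Re_divide_of_real Im_divide_of_real)
  have sqrt_prod: "sqrt (\<Prod>i\<in>I. f i) = (\<Prod>i\<in>I. sqrt (f i))" for f :: "'a \<Rightarrow> real" and I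
    by (induction I rule: infinite_finite_induct) (auto simp: real_sqrt_mult)
  have "unit_det M = (\<Prod>i\<in>UNIV. (1 + \<i> * complex_of_real (l i)) / complex_of_real (sqrt (1 + (l i)\<^sup>2)))"
    using eigenvalues_det[OF assms, of "\<i>"] eigenvalues_det_square[OF assms]
    by (simp add: unit_det_def prod_dividef sqrt_prod)
  then have ex: "exp (\<i> * complex_of_real (\<Sum>i\<in>UNIV. arctan (l i))) = unit_det M"
    by (simp add: * exp_sum sum_distrib_left)
  show ?thesis
    unfolding log_unit_det_def
  proof (rule the_equality)
    fix w assume w: "exp w = unit_det M \<and> (\<exists>l. eigenvalues M l \<and> Im w = (\<Sum>i\<in>UNIV. arctan (l i)))"
    then have "Im w = (\<Sum>i\<in>UNIV. arctan (l i))"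
      using eigenvalues_sum_unique[OF assms] by metis
    moreover have "exp (Re w) = 1"
      using w ex by (metis norm_exp_eq_Re norm_exp_i_times)
    ultimately show "w = \<i> * complex_of_real (\<Sum>i\<in>UNIV. arctan (l i))"
      by (simp add: complex_eq_iff)
  qed (use ex assms in auto)
qed


section \<open>Geometry of an immersion\<close>

text \<open>
  \<open>G\<close> is an immersion of \<open>\<real>\<^sup>n\<close> into a Euclidean space; tensors are expressed in the
  coordinate frame \<open>partial i G\<close>.
\<close>

definition metric :: "(real^'n \<Rightarrow> 'b::euclidean_space) \<Rightarrow> real^'n \<Rightarrow> real^'n^'n" where
  "metric G x = (\<chi> i j. partial i G x \<bullet> partial j G x)"

definition inv_metric :: "(real^'n \<Rightarrow> 'b::euclidean_space) \<Rightarrow> real^'n \<Rightarrow> real^'n^'n" where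
  "inv_metric G x = matrix_inv (metric G x)"

definition laplace_beltrami ::
    "(real^'n \<Rightarrow> 'b::euclidean_space) \<Rightarrow> (real^'n \<Rightarrow> real) \<Rightarrow> real^'n \<Rightarrow> real" where
  "laplace_beltrami G f x =
     1 / sqrt (det (metric G x)) *
     (\<Sum>i\<in>UNIV. partial i
        (\<lambda>y. \<Sum>j\<in>UNIV. sqrt (det (metric G y)) * inv_metric G y $ i $ j * partial j f y) x)"

text \<open>Components of the gradient vector field in the coordinate frame.\<close>

definition metric_gradient ::
    "(real^'n \<Rightarrow> 'b::euclidean_space) \<Rightarrow> (real^'n \<Rightarrow> real) \<Rightarrow> real^'n \<Rightarrow> real^'n" where
  "metric_gradient G f x = (\<chi> i. \<Sum>j\<in>UNIV. inv_metric G x $ i $ j * partial j f x)"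

definition metric_norm :: "(real^'n \<Rightarrow> 'b::euclidean_space) \<Rightarrow> real^'n \<Rightarrow> real^'n \<Rightarrow> real" where
  "metric_norm G x X = sqrt (\<Sum>i\<in>UNIV. \<Sum>j\<in>UNIV. metric G x $ i $ j * X $ i * X $ j)"

definition normal_part ::
    "(real^'n \<Rightarrow> 'b::euclidean_space) \<Rightarrow> real^'n \<Rightarrow> 'b \<Rightarrow> 'b" where
  "normal_part G x V =
     V - (\<Sum>i\<in>UNIV. \<Sum>j\<in>UNIV. (inv_metric G x $ i $ j * (V \<bullet> partial i G x)) *\<^sub>R partial j G x)"

definition second_fundamental_form ::
    "(real^'n \<Rightarrow> 'b::euclidean_space) \<Rightarrow> real^'n \<Rightarrow> 'n \<Rightarrow> 'n \<Rightarrow> 'b" where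
  "second_fundamental_form G x i j = normal_part G x (partial i (partial j G) x)"

definition mean_curvature_vector :: "(real^'n \<Rightarrow> 'b::euclidean_space) \<Rightarrow> real^'n \<Rightarrow> 'b" where
  "mean_curvature_vector G x =
     (\<Sum>i\<in>UNIV. \<Sum>j\<in>UNIV. inv_metric G x $ i $ j *\<^sub>R second_fundamental_form G x i j)"

definition sff_norm_squared :: "(real^'n \<Rightarrow> 'b::euclidean_space) \<Rightarrow> real^'n \<Rightarrow> real" where
  "sff_norm_squared G x =
     (\<Sum>i\<in>UNIV. \<Sum>j\<in>UNIV. \<Sum>k\<in>UNIV. \<Sum>l\<in>UNIV.
        inv_metric G x $ i $ k * inv_metric G x $ j $ l *
        (second_fundamental_form G x i j \<bullet> second_fundamental_form G x k l))"

definition orthonormal_frame ::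
    "(real^'n \<Rightarrow> 'b::euclidean_space) \<Rightarrow> real^'n \<Rightarrow> ('n \<Rightarrow> 'b) \<Rightarrow> bool" where
  "orthonormal_frame G x e \<longleftrightarrow>
     (\<forall>i. e i \<in> range (frechet_derivative G (at x))) \<and>
     (\<forall>i j. e i \<bullet> e j = (if i = j then 1 else 0))"


section \<open>The gradient graph and the tensor \<open>S\<close>\<close>

text \<open>\<open>\<real>\<^sup>2\<^sup>n\<close> is the product \<open>real^'n \<times> real^'n\<close>.\<close>

definition gradient_graph :: "(real^'n \<Rightarrow> real) \<Rightarrow> real^'n \<Rightarrow> (real^'n) \<times> (real^'n)" where
  "gradient_graph v y = (y, gradient v y)"

definition complex_structure ::
    "(real^'n) \<times> (real^'n) \<Rightarrow> (real^'n) \<times> (real^'n)" where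
  "complex_structure X = (- snd X, fst X)"

definition proj1 :: "(real^'n) \<times> (real^'n) \<Rightarrow> (real^'n) \<times> (real^'n)" where
  "proj1 X = (fst X, 0)"

definition proj2 :: "(real^'n) \<times> (real^'n) \<Rightarrow> (real^'n) \<times> (real^'n)" where
  "proj2 X = (0, snd X)"

definition S_tensor :: "(real^'n) \<times> (real^'n) \<Rightarrow> (real^'n) \<times> (real^'n) \<Rightarrow> real" where
  "S_tensor X Y = complex_structure (proj1 X) \<bullet> proj2 Y"

text \<open>
  Given the matrix \<open>s\<close> of \<open>S\<close> in an orthonormal frame \<open>e\<close>, the following is the matrix
  of \<open>S\<^sup>[\<^sup>2\<^sup>]\<close> in the basis \<open>e i \<and> e j\<close>, \<open>i < j\<close>, of the second exterior power.
  The linear order on the index type only serves to select one pair from \<open>(i,j)\<close>, \<open>(j,i)\<close>.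
\<close>

definition second_power :: "('n \<Rightarrow> 'n \<Rightarrow> real) \<Rightarrow> 'n \<times> 'n \<Rightarrow> 'n \<times> 'n \<Rightarrow> real" where
  "second_power s = (\<lambda>(i,j) (k,l).
     s i k * of_bool (j = l) + s j l * of_bool (i = k)
     - s i l * of_bool (j = k) - s j k * of_bool (i = l))"

definition increasing_pairs :: "('n::{finite,linorder} \<times> 'n::{finite,linorder}) set" where
  "increasing_pairs = {(i,j). i < j}"

text \<open>The Leibniz formula of a determinant, for a matrix indexed by a finite set.\<close>

definition det_on :: "'a set \<Rightarrow> ('a \<Rightarrow> 'a \<Rightarrow> real) \<Rightarrow> real" where
  "det_on I A = (\<Sum>p | p permutes I. of_int (sign p) * (\<Prod>i\<in>I. A i (p i)))"

text \<open>
  \<open>det S\<^sup>[\<^sup>2\<^sup>]\<close> of the gradient graph of \<open>v\<close> at the point \<open>(y, Dv(y))\<close>.  The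
  value does not depend on the chosen orthonormal frame.
\<close>

definition det_S2 ::
    "(real^'n::{finite,linorder} \<Rightarrow> real) \<Rightarrow> real^'n::{finite,linorder} \<Rightarrow> real" where
  "det_S2 v y =
     (let e = (SOME e. orthonormal_frame (gradient_graph v) y e)
      in det_on increasing_pairs (second_power (\<lambda>i j. S_tensor (e i) (e j))))"

end

theory Submission
  imports Defs
begin

text \<open>
  Write \<open>M = D\<^sup>2u\<close> and let \<open>Q(y,t)\<close> be the value of \<open>log det S\<^sup>[\<^sup>2\<^sup>]\<close> at \<open>(y, Du(y,t))\<close>, so that the
  function of the theorem is \<open>f(x,t) = Q(\<phi>\<^sub>t(x), t)\<close>.  The velocity of \<open>\<phi>\<^sub>t\<close> is the horizontal part of
  the mean curvature vector, and the term \<open>DQ(\<partial>\<^sub>t\<phi>)\<close> is exactly the first-order part of the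
  Laplace-Beltrami operator of the graph (\<open>dd_fst_mean_curvature\<close>, \<open>laplace_beltrami_compose\<close>).
  Hence \<open>(\<partial>\<^sub>t - \<Delta>) f = Q\<^sub>t - g\<^sup>i\<^sup>jQ\<^sub>i\<^sub>j\<close> with \<open>g = 1 + M\<^sup>2\<close>, and no derivative of \<open>\<phi>\<^sub>t\<close> is left.

  In coordinates of the base, \<open>S\<close> is the endomorphism \<open>A = M (1 + M\<^sup>2)\<^sup>-\<^sup>1\<close>, and \<open>det S\<^sup>[\<^sup>2\<^sup>]\<close> is the
  determinant of the second additive compound of any matrix similar to \<open>A\<close>
  (\<open>det_second_power_similar\<close>, \<open>det_S2_eq\<close>).  So
  \<open>Q\<close> is a smooth function of \<open>M\<close> and no eigenvalue has to be differentiated.  The equation says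
  \<open>u\<^sub>t = \<Theta>\<close> with \<open>\<Theta>\<close> the sum of the arctangents of the eigenvalues of \<open>M\<close>, and
  \<open>d\<Theta> = tr (g\<^sup>-\<^sup>1 dM)\<close> (\<open>dd_sum_arctan_eigenvalues\<close>).  Therefore the fourth derivatives of \<open>u\<close>
  cancel in \<open>M\<^sub>t - g\<^sup>i\<^sup>jM\<^sub>i\<^sub>j\<close> (\<open>parabolic_M\<close>), and \<open>Q\<^sub>t - g\<^sup>i\<^sup>jQ\<^sub>i\<^sub>j\<close> is a quadratic form in the third
  derivatives of \<open>u\<close>.

  Let \<open>\<lambda>\<^sub>k = tan \<alpha>\<^sub>k\<close> be the eigenvalues of \<open>M\<close> at the point, \<open>s\<^sub>k = \<lambda>\<^sub>k / (1 + \<lambda>\<^sub>k\<^sup>2)\<close>, and let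
  \<open>h\<^sub>c\<^sub>i\<^sub>j\<close> be the third derivatives of \<open>u\<close> in an eigenbasis divided by
  \<open>((1 + \<lambda>\<^sub>c\<^sup>2)(1 + \<lambda>\<^sub>i\<^sup>2)(1 + \<lambda>\<^sub>j\<^sup>2))\<^sup>1\<^sup>/\<^sup>2\<close>.  Then the squared norm of the second fundamental
  form is the sum of the \<open>h\<^sub>c\<^sub>i\<^sub>j\<^sup>2\<close> (\<open>sff_norm_squared_eigenbasis\<close>), and \<open>\<partial>\<^sub>t - g\<^sup>i\<^sup>j\<partial>\<^sub>i\<partial>\<^sub>j\<close> takes
  the diagonal entry \<open>A\<^sub>k\<^sub>k\<close> to \<open>4 s\<^sub>k \<Sum> h\<^sub>c\<^sub>k\<^sub>j\<^sup>2\<close>, summed over \<open>c\<close> and \<open>j\<close> (\<open>parabolic_A\<close>).  Passing to the logarithm of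
  the determinant adds the squares of all entries of the derivatives of the compound, divided by
  \<open>(s\<^sub>i + s\<^sub>j)(s\<^sub>k + s\<^sub>l)\<close>.  The inequality is then algebraic and holds for each direction \<open>c\<close>
  separately (\<open>compound_inequality\<close>): half of the squares of the diagonal entries dominates the
  gradient term by the Cauchy-Schwarz inequality for the \<open>n (n - 1) / 2\<close> pairs \<open>i < j\<close>; the other
  half and the off-diagonal entries compensate the weights \<open>s\<^sub>k\<close> that may be negative, by the
  identities \<open>(2 s\<^sub>k)\<^sup>2 + cos\<^sup>2 2\<alpha>\<^sub>k = 1\<close> and
  \<open>4 s\<^sub>k s\<^sub>l + cos\<^sup>2 (\<alpha>\<^sub>k + \<alpha>\<^sub>l) = cos\<^sup>2 (\<alpha>\<^sub>k - \<alpha>\<^sub>l)\<close>.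
\<close>

section \<open>Directional derivatives of smooth functions\<close>

text \<open>The derivative is taken within \<open>S\<close>: on \<open>\<real>\<^sup>n \<times> [0,T)\<close> it is one-sided in time at \<open>t = 0\<close>.\<close>

abbreviation dd :: "'a::euclidean_space set \<Rightarrow> 'a \<Rightarrow> ('a \<Rightarrow> 'b::real_normed_vector) \<Rightarrow> 'a \<Rightarrow> 'b" where
  "dd S v f z \<equiv> frechet_derivative f (at z within S) v"

text \<open>The first condition makes derivatives within \<open>S\<close> unique; the second one carries identities
  between continuous functions from the interior of \<open>S\<close> to its boundary points.\<close>

definition thick :: "'a::euclidean_space set \<Rightarrow> bool" where
  "thick S \<longleftrightarrow> (\<forall>x\<in>S. \<forall>i\<in>Basis. \<forall>e>0. \<exists>d. 0 < \<bar>d\<bar> \<and> \<bar>d\<bar> < e \<and> x + d *\<^sub>R i \<in> S) \<and>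
     S \<subseteq> closure (interior S)"

lemma thick_UNIV: "thick (UNIV :: 'a::euclidean_space set)"
proof -
  have "\<exists>d::real. 0 < \<bar>d\<bar> \<and> \<bar>d\<bar> < e" if "e > 0" for e
    using that by (intro exI[of _ "e/2"]) auto
  then show ?thesis by (simp add: thick_def)
qed

lemma dd_eq:
  assumes "thick S" "z \<in> S" "(f has_derivative f') (at z within S)"
  shows "dd S v f z = f' v"
proof -
  have "(f has_derivative frechet_derivative f (at z within S)) (at z within S)"
    using assms(3) differentiableI frechet_derivative_works by blast
  then have "frechet_derivative f (at z within S) = f'"
    by (rule frechet_derivative_unique_within[OF _ assms(3)]) (use assms in \<open>auto simp: thick_def\<close>)
  then show ?thesis by simp
qed

lemma Ck_on_SucE:
  assumes "Ck_on (Suc k) f S"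
  obtains f' where "\<And>x. x \<in> S \<Longrightarrow> (f has_derivative f' x) (at x within S)"
    "\<And>v. Ck_on k (\<lambda>x. f' x v) S"
  using assms by auto

lemma Ck_on_SucI:
  assumes "\<And>x. x \<in> S \<Longrightarrow> (f has_derivative f' x) (at x within S)"
    "\<And>v. Ck_on k (\<lambda>x. f' x v) S"
  shows "Ck_on (Suc k) f S"
  using assms by auto

lemma Ck_on_cong:
  assumes "\<And>x. x \<in> S \<Longrightarrow> f x = g x"
  shows "Ck_on k f S \<longleftrightarrow> Ck_on k g S"
proof (cases k)
  case 0
  then show ?thesis using assms by (auto cong: continuous_on_cong)
next
  case (Suc m)
  have "(f has_derivative D) (at x within S) \<longleftrightarrow> (g has_derivative D) (at x within S)" if "x \<in> S" for D x
    using has_derivative_transform[OF that, of g f D] has_derivative_transform[OF that, of f g D] assms by auto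
  then show ?thesis by (auto simp: Suc)
qed

lemma Ck_on_mono: "Ck_on (Suc k) f S \<Longrightarrow> Ck_on k f S"
proof (induction k arbitrary: f)
  case 0
  then show ?case
    by (auto intro: has_derivative_continuous_on)
next
  case (Suc k)
  then show ?case by (metis Ck_on.simps(2))
qed

lemma Ck_on_linear: 
  assumes L: "bounded_linear L"
  shows "Ck_on k f S \<Longrightarrow> Ck_on k (\<lambda>x. L (f x)) S"
proof (induction k arbitrary: f)
  case 0
  then show ?case using L
    by (simp add: linear_continuous_on_compose linear_conv_bounded_linear bounded_linear.continuous_on)
next
  case (Suc k)
  then obtain f' where f': "\<And>x. x \<in> S \<Longrightarrow> (f has_derivative f' x) (at x within S)" "\<And>v. Ck_on k (\<lambda>x. f' x v) S"
    by auto
  show ?case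
    using Suc.IH[OF f'(2)] bounded_linear.has_derivative[OF L f'(1)]
    by (auto intro!: exI[of _ "\<lambda>x v. L (f' x v)"])
qed

lemma Ck_on_const: "Ck_on k (\<lambda>x. c) S"
proof (induction k arbitrary: c)
  case (Suc k)
  then have "\<forall>v::'a. Ck_on k (\<lambda>x. 0::'b) S" by simp
  then show ?case by (auto intro!: exI[of _ "\<lambda>x v. 0"])
qed auto

lemma Ck_on_id: "Ck_on k (\<lambda>x. x) S"
  by (cases k) (auto intro!: exI[of _ "\<lambda>x v. v"] derivative_eq_intros Ck_on_const)

lemma Ck_on_add:
  "Ck_on k f S \<Longrightarrow> Ck_on k g S \<Longrightarrow> Ck_on k (\<lambda>x. f x + g x) S"
proof (induction k arbitrary: f g)
  case 0
  then show ?case by (simp add: continuous_on_add)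
next
  case (Suc k)
  obtain f' where f': "\<And>x. x \<in> S \<Longrightarrow> (f has_derivative f' x) (at x within S)" "\<And>v. Ck_on k (\<lambda>x. f' x v) S"
    using Suc.prems(1) by (rule Ck_on_SucE) blast
  obtain g' where g': "\<And>x. x \<in> S \<Longrightarrow> (g has_derivative g' x) (at x within S)" "\<And>v. Ck_on k (\<lambda>x. g' x v) S"
    using Suc.prems(2) by (rule Ck_on_SucE) blast
  show ?case
    by (rule Ck_on_SucI[OF has_derivative_add[OF f'(1) g'(1)] Suc.IH[OF f'(2) g'(2)]])
qed

lemma Ck_on_sum: "(\<And>i. i \<in> I \<Longrightarrow> Ck_on k (f i) S) \<Longrightarrow> Ck_on k (\<lambda>x. \<Sum>i\<in>I. f i x) S"
  by (induction I rule: infinite_finite_induct) (auto intro!: Ck_on_add Ck_on_const)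

lemma Ck_on_bilinear:
  assumes B: "bounded_bilinear B"
  shows "Ck_on k f S \<Longrightarrow> Ck_on k g S \<Longrightarrow> Ck_on k (\<lambda>x. B (f x) (g x)) S"
proof (induction k arbitrary: f g)
  case 0
  then show ?case by (auto intro: bounded_bilinear.continuous_on[OF B])
next
  case (Suc k)
  obtain f' where f': "\<And>x. x \<in> S \<Longrightarrow> (f has_derivative f' x) (at x within S)" "\<And>v. Ck_on k (\<lambda>x. f' x v) S"
    using Suc.prems(1) by (rule Ck_on_SucE) blast
  obtain g' where g': "\<And>x. x \<in> S \<Longrightarrow> (g has_derivative g' x) (at x within S)" "\<And>v. Ck_on k (\<lambda>x. g' x v) S"
    using Suc.prems(2) by (rule Ck_on_SucE) blast
  have "Ck_on k (\<lambda>x. B (f x) (g' x v) + B (f' x v) (g x)) S" for v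
    using Suc.IH[OF Ck_on_mono[OF Suc.prems(1)] g'(2)] Suc.IH[OF f'(2) Ck_on_mono[OF Suc.prems(2)]]
    by (rule Ck_on_add)
  from Ck_on_SucI[OF bounded_bilinear.FDERIV[OF B f'(1) g'(1)] this] show ?case .
qed

text \<open>The chain rule gives \<open>f\<close>-derivatives in a direction that varies with the point.  Expanding this
  direction in a basis leaves products of functions to which the induction hypothesis applies.\<close>

lemma Ck_on_compose:
  fixes f :: "'b::euclidean_space \<Rightarrow> 'c::real_normed_vector" and g :: "'a::euclidean_space \<Rightarrow> 'b"
  assumes "g ` S \<subseteq> T"
  shows "Ck_on k f T \<Longrightarrow> Ck_on k g S \<Longrightarrow> Ck_on k (\<lambda>x. f (g x)) S"
proof (induction k arbitrary: f)
  case 0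
  then show ?case using assms by (auto intro: continuous_on_compose2)
next
  case (Suc k)
  obtain f' where f': "\<And>x. x \<in> T \<Longrightarrow> (f has_derivative f' x) (at x within T)" "\<And>v. Ck_on k (\<lambda>x. f' x v) T"
    using Suc.prems(1) by (rule Ck_on_SucE) blast
  obtain g' where g': "\<And>x. x \<in> S \<Longrightarrow> (g has_derivative g' x) (at x within S)" "\<And>v. Ck_on k (\<lambda>x. g' x v) S"
    using Suc.prems(2) by (rule Ck_on_SucE) blast
  have Tg: "g x \<in> T" if "x \<in> S" for x using assms that by auto
  have *: "f' (g x) (g' x v) = (\<Sum>b\<in>Basis. (g' x v \<bullet> b) *\<^sub>R f' (g x) b)" if "x \<in> S" for x v
  proof -
    interpret bounded_linear "f' (g x)" using f'(1)[OF Tg[OF that]] by (rule has_derivative_bounded_linear)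
    have "f' (g x) (\<Sum>b\<in>Basis. (g' x v \<bullet> b) *\<^sub>R b) = (\<Sum>b\<in>Basis. (g' x v \<bullet> b) *\<^sub>R f' (g x) b)"
      by (simp add: sum scaleR)
    then show ?thesis by (simp add: euclidean_representation)
  qed
  have "Ck_on k (\<lambda>x. \<Sum>b\<in>Basis. (g' x v \<bullet> b) *\<^sub>R f' (g x) b) S" for v
    by (intro Ck_on_sum Ck_on_bilinear[OF bounded_bilinear_scaleR] Suc.IH f' Ck_on_mono[OF Suc.prems(2)]
        Ck_on_linear[OF bounded_linear_inner_left] g')
  then have "Ck_on k (\<lambda>x. f' (g x) (g' x v)) S" for v
    using * Ck_on_cong[of S "\<lambda>x. f' (g x) (g' x v)"] by auto
  moreover have "((\<lambda>x. f (g x)) has_derivative (\<lambda>v. f' (g x) (g' x v))) (at x within S)" if "x \<in> S" for x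
    by (rule has_derivative_in_compose[OF g'(1)[OF that], of f "f' (g x)", THEN has_derivative_subset[OF _ subset_refl]])
      (use has_derivative_subset[OF f'(1)[OF Tg[OF that]] assms] in auto)
  ultimately show ?case by (intro Ck_on_SucI[where f'="\<lambda>x v. f' (g x) (g' x v)"])
qed

lemma Ck_on_inverse: "Ck_on k (\<lambda>x::real. inverse x) (- {0})"
proof (induction k)
  case 0
  show ?case by (auto intro: continuous_on_inverse[OF continuous_on_id])
next
  case (Suc k)
  have "Ck_on k (\<lambda>x::real. - (inverse x * v * inverse x)) (- {0})" for v
    by (intro Ck_on_linear[OF bounded_linear_minus[OF bounded_linear_ident]]
        Ck_on_bilinear[OF bounded_bilinear_mult] Suc Ck_on_const)
  then show ?case
    by (intro Ck_on_SucI[where f'="\<lambda>x v. - (inverse x * v * inverse x)"] has_derivative_inverse') auto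
qed

lemma Ck_on_subset: "Ck_on k f S \<Longrightarrow> T \<subseteq> S \<Longrightarrow> Ck_on k f T"
proof (induction k arbitrary: f)
  case (Suc k)
  obtain f' where f': "\<And>x. x \<in> S \<Longrightarrow> (f has_derivative f' x) (at x within S)" "\<And>v. Ck_on k (\<lambda>x. f' x v) S"
    using Suc.prems(1) by (rule Ck_on_SucE) blast
  have "(f has_derivative f' x) (at x within T)" if "x \<in> T" for x
    by (rule has_derivative_subset[OF f'(1) Suc.prems(2)]) (use that Suc.prems in auto)
  from Ck_on_SucI[OF this Suc.IH[OF f'(2) Suc.prems(2)]] show ?case .
next
  case 0
  then show ?case using continuous_on_subset by auto
qed

lemma Ck_on_ln: "Ck_on k (\<lambda>x::real. ln x) {0<..}"
proof (cases k)
  case 0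
  then show ?thesis by (auto intro: continuous_on_ln[OF continuous_on_id])
next
  case (Suc m)
  have "Ck_on m (\<lambda>x::real. v * inverse x) {0<..}" for v
    by (intro Ck_on_bilinear[OF bounded_bilinear_mult] Ck_on_const Ck_on_subset[OF Ck_on_inverse]) auto
  moreover have "(ln has_derivative (\<lambda>v. v * inverse x)) (at x within {0<..})" if "x \<in> {0<..}" for x :: real
    using has_derivative_ln[OF _ has_derivative_ident, of x] that by simp
  ultimately show ?thesis unfolding Suc
    by (intro Ck_on_SucI[where f'="\<lambda>x v. v * inverse x"])
qed

lemma smooth_on_cong:
  "(\<And>x. x \<in> S \<Longrightarrow> f x = g x) \<Longrightarrow> smooth_on f S \<longleftrightarrow> smooth_on g S"
  unfolding smooth_on_def using Ck_on_cong[of S f g] by metis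

lemma smooth_on_linear: "bounded_linear L \<Longrightarrow> smooth_on f S \<Longrightarrow> smooth_on (\<lambda>x. L (f x)) S"
  unfolding smooth_on_def using Ck_on_linear[of L _ f S] by metis

lemma smooth_on_const: "smooth_on (\<lambda>x. c) S"
  unfolding smooth_on_def using Ck_on_const[of _ c S] by metis

lemma smooth_on_id: "smooth_on (\<lambda>x. x) S"
  unfolding smooth_on_def using Ck_on_id[of _ S] by metis

lemma smooth_on_add: "smooth_on f S \<Longrightarrow> smooth_on g S \<Longrightarrow> smooth_on (\<lambda>x. f x + g x) S"
  unfolding smooth_on_def using Ck_on_add[of _ f S g] by metis

lemma smooth_on_bilinear:
  "bounded_bilinear B \<Longrightarrow> smooth_on f S \<Longrightarrow> smooth_on g S \<Longrightarrow> smooth_on (\<lambda>x. B (f x) (g x)) S"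
  unfolding smooth_on_def using Ck_on_bilinear[of B _ f S g] by metis

lemma smooth_on_compose:
  fixes f :: "'b::euclidean_space \<Rightarrow> 'c::real_normed_vector" and g :: "'a::euclidean_space \<Rightarrow> 'b"
  shows "smooth_on f T \<Longrightarrow> smooth_on g S \<Longrightarrow> g ` S \<subseteq> T \<Longrightarrow> smooth_on (\<lambda>x. f (g x)) S"
  unfolding smooth_on_def using Ck_on_compose[of g S T _ f] by metis

lemma smooth_on_mult:
  fixes f g :: "'a::euclidean_space \<Rightarrow> real"
  shows "smooth_on f S \<Longrightarrow> smooth_on g S \<Longrightarrow> smooth_on (\<lambda>x. f x * g x) S"
  by (rule smooth_on_bilinear[OF bounded_bilinear_mult])

lemma smooth_on_sum: "(\<And>i. i \<in> I \<Longrightarrow> smooth_on (f i) S) \<Longrightarrow> smooth_on (\<lambda>x. \<Sum>i\<in>I. f i x) S"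
  unfolding smooth_on_def using Ck_on_sum[of I _ f S] by metis

lemma smooth_on_prod:
  fixes f :: "'i \<Rightarrow> 'a::euclidean_space \<Rightarrow> real"
  shows "(\<And>i. i \<in> I \<Longrightarrow> smooth_on (f i) S) \<Longrightarrow> smooth_on (\<lambda>x. \<Prod>i\<in>I. f i x) S"
  by (induction I rule: infinite_finite_induct) (auto intro!: smooth_on_mult smooth_on_const)

lemma smooth_on_minus: "smooth_on f S \<Longrightarrow> smooth_on (\<lambda>x. - f x) S"
  by (rule smooth_on_linear[OF bounded_linear_minus[OF bounded_linear_ident]])

lemma smooth_on_diff:
  "smooth_on f S \<Longrightarrow> smooth_on g S \<Longrightarrow> smooth_on (\<lambda>x. f x - g x) S"
  using smooth_on_add[OF _ smooth_on_minus, of f S g] by simp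

lemma smooth_on_divide:
  fixes f g :: "'a::euclidean_space \<Rightarrow> real"
  assumes "smooth_on f S" "smooth_on g S" "\<And>x. x \<in> S \<Longrightarrow> g x \<noteq> 0"
  shows "smooth_on (\<lambda>x. f x / g x) S"
  unfolding divide_inverse
proof (intro smooth_on_mult assms(1) smooth_on_compose[of inverse "- {0}", OF _ assms(2)])
  show "smooth_on inverse (- {0::real})" unfolding smooth_on_def by (intro allI Ck_on_inverse)
qed (use assms(3) in auto)

lemma smooth_on_ln:
  fixes g :: "'a::euclidean_space \<Rightarrow> real"
  assumes "smooth_on g S" "\<And>x. x \<in> S \<Longrightarrow> g x > 0"
  shows "smooth_on (\<lambda>x. ln (g x)) S"
proof (intro smooth_on_compose[of ln "{0<..}", OF _ assms(1)])
  show "smooth_on ln {0::real<..}" unfolding smooth_on_def by (intro allI Ck_on_ln)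
qed (use assms(2) in auto)

lemma smooth_on_has_derivative:
  assumes "smooth_on f S" "z \<in> S"
  shows "(f has_derivative (\<lambda>v. dd S v f z)) (at z within S)"
proof -
  have "Ck_on (Suc 0) f S" using assms unfolding smooth_on_def by blast
  then have "f differentiable at z within S"
    using assms(2) unfolding differentiable_def by (rule_tac Ck_on_SucE) blast+
  then show ?thesis using frechet_derivative_works by blast
qed

text \<open>The derivatives witnessing the different orders of smoothness are the same function, because
  derivatives within a thick set are unique.\<close>

lemma smooth_on_dd:
  assumes "thick S" "smooth_on f S"
  shows "smooth_on (dd S v f) S"
  unfolding smooth_on_def
proof
  fix k
  have "Ck_on (Suc k) f S" using assms(2) unfolding smooth_on_def by blast
  then obtain f' where f': "\<And>x. x \<in> S \<Longrightarrow> (f has_derivative f' x) (at x within S)" "\<And>v. Ck_on k (\<lambda>x. f' x v) S"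
    by (rule Ck_on_SucE) blast
  have "dd S v f x = f' x v" if "x \<in> S" for x
    by (rule dd_eq[OF assms(1) that f'(1)[OF that]])
  with Ck_on_cong[of S "dd S v f" "\<lambda>x. f' x v" k] f'(2) show "Ck_on k (dd S v f) S"
    by blast
qed

lemma smooth_on_continuous: "smooth_on f S \<Longrightarrow> continuous_on S f"
  unfolding smooth_on_def using Ck_on.simps(1) by blast

lemma dd_cong:
  assumes "\<And>x. x \<in> S \<Longrightarrow> f x = g x" "z \<in> S"
  shows "dd S v f z = dd S v g z"
proof -
  have "(f has_derivative D) (at z within S) \<longleftrightarrow> (g has_derivative D) (at z within S)" for D
    using has_derivative_transform[OF assms(2), of g f D] has_derivative_transform[OF assms(2), of f g D] assms by auto
  then show ?thesis by (simp add: frechet_derivative_def)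
qed

lemma dd_linear_direction:
  assumes "smooth_on f S" "z \<in> S"
  shows "linear (\<lambda>v. dd S v f z)"
  using has_derivative_linear[OF smooth_on_has_derivative[OF assms]] .

context
  fixes S :: "'a::euclidean_space set" and z :: 'a
  assumes S: "thick S" and z: "z \<in> S"
begin

lemma dd_const: "dd S v (\<lambda>x. c) z = 0"
  by (rule dd_eq[OF S z]) auto

lemma dd_add: "smooth_on f S \<Longrightarrow> smooth_on g S \<Longrightarrow> dd S v (\<lambda>x. f x + g x) z = dd S v f z + dd S v g z"
  by (rule dd_eq[OF S z has_derivative_add]) (rule smooth_on_has_derivative[OF _ z], assumption)+

lemma dd_linear: "bounded_linear L \<Longrightarrow> smooth_on f S \<Longrightarrow> dd S v (\<lambda>x. L (f x)) z = L (dd S v f z)"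
  by (rule dd_eq[OF S z bounded_linear.has_derivative]) (auto intro: smooth_on_has_derivative[OF _ z])

lemma dd_bilinear:
  "bounded_bilinear B \<Longrightarrow> smooth_on f S \<Longrightarrow> smooth_on g S \<Longrightarrow>
    dd S v (\<lambda>x. B (f x) (g x)) z = B (f z) (dd S v g z) + B (dd S v f z) (g z)"
  by (rule dd_eq[OF S z bounded_bilinear.FDERIV]) (auto intro: smooth_on_has_derivative[OF _ z])

lemma dd_mult:
  fixes f g :: "'a \<Rightarrow> real"
  shows "smooth_on f S \<Longrightarrow> smooth_on g S \<Longrightarrow>
    dd S v (\<lambda>x. f x * g x) z = f z * dd S v g z + dd S v f z * g z"
  by (rule dd_bilinear[OF bounded_bilinear_mult])

lemma dd_sum: "(\<And>i. i \<in> I \<Longrightarrow> smooth_on (f i) S) \<Longrightarrow> dd S v (\<lambda>x. \<Sum>i\<in>I. f i x) z = (\<Sum>i\<in>I. dd S v (f i) z)"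
  by (rule dd_eq[OF S z has_derivative_sum]) (rule smooth_on_has_derivative[OF _ z])

lemma dd_compose:
  fixes f :: "'b::euclidean_space \<Rightarrow> 'c::real_normed_vector" and g :: "'a \<Rightarrow> 'b"
  assumes "smooth_on f T" "smooth_on g S" "g ` S \<subseteq> T"
  shows "dd S v (\<lambda>x. f (g x)) z = dd T (dd S v g z) f (g z)"
  by (rule dd_eq[OF S z, OF has_derivative_in_compose[OF smooth_on_has_derivative[OF assms(2) z]]])
    (use has_derivative_subset[OF smooth_on_has_derivative[OF assms(1)] assms(3)] assms(3) z in auto)

end

subsection \<open>Commuting derivatives\<close>

lemma dd_along_line:
  fixes f :: "'a::euclidean_space \<Rightarrow> real"
  assumes "smooth_on f S" "a + s *\<^sub>R v \<in> interior S"
  shows "((\<lambda>s. f (a + s *\<^sub>R v)) has_real_derivative dd S v f (a + s *\<^sub>R v)) (at s)"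
proof -
  have in_S: "a + s *\<^sub>R v \<in> S" using assms(2) interior_subset by blast
  have "(f has_derivative (\<lambda>w. dd S w f (a + s *\<^sub>R v))) (at (a + s *\<^sub>R v))"
    using smooth_on_has_derivative[OF assms(1) in_S] at_within_interior[OF assms(2)] by simp
  moreover have "((\<lambda>s. a + s *\<^sub>R v) has_derivative (\<lambda>h. h *\<^sub>R v)) (at s)"
    by (auto intro!: derivative_eq_intros)
  ultimately have "((\<lambda>s. f (a + s *\<^sub>R v)) has_derivative (\<lambda>h. dd S (h *\<^sub>R v) f (a + s *\<^sub>R v))) (at s)"
    by (rule has_derivative_compose[rotated])
  moreover have "dd S (h *\<^sub>R v) f (a + s *\<^sub>R v) = dd S v f (a + s *\<^sub>R v) * h" for h
    using linear_cmul[OF dd_linear_direction[OF assms(1) in_S]] by simp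
  ultimately show ?thesis unfolding has_field_derivative_def by simp
qed

text \<open>The mean value theorem, first in direction \<open>v\<close> for the difference of \<open>f\<close> along \<open>w\<close>, then in
  direction \<open>w\<close>.\<close>

lemma second_difference:
  fixes f :: "'a::euclidean_space \<Rightarrow> real"
  assumes S: "thick S" and f: "smooth_on f S" and h: "h > 0"
    and box: "\<And>s t. 0 \<le> s \<Longrightarrow> s \<le> h \<Longrightarrow> 0 \<le> t \<Longrightarrow> t \<le> h \<Longrightarrow> z + s *\<^sub>R v + t *\<^sub>R w \<in> interior S"
  obtains s t where "0 < s" "s < h" "0 < t" "t < h"
    "f (z + h *\<^sub>R v + h *\<^sub>R w) - f (z + h *\<^sub>R v) - f (z + h *\<^sub>R w) + f z
       = h * (h * dd S w (dd S v f) (z + s *\<^sub>R v + t *\<^sub>R w))"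
proof -
  define g where "g s = f ((z + h *\<^sub>R w) + s *\<^sub>R v) - f (z + s *\<^sub>R v)" for s
  define g' where "g' s = dd S v f ((z + h *\<^sub>R w) + s *\<^sub>R v) - dd S v f (z + s *\<^sub>R v)" for s
  have box': "(z + h *\<^sub>R w) + s *\<^sub>R v \<in> interior S" "z + s *\<^sub>R v \<in> interior S" if "0 \<le> s" "s \<le> h" for s
    using box[of s h] box[of s 0] that h by (simp_all add: algebra_simps)
  have "(g has_real_derivative g' s) (at s)" if "0 \<le> s" "s \<le> h" for s
    unfolding g_def g'_def by (intro DERIV_diff dd_along_line f box' that)
  then obtain s where s: "0 < s" "s < h" "g h - g 0 = (h - 0) * g' s"
    using MVT2[OF h, of g g'] by auto
  have "((\<lambda>t. dd S v f ((z + s *\<^sub>R v) + t *\<^sub>R w)) has_real_derivative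
      dd S w (dd S v f) ((z + s *\<^sub>R v) + t *\<^sub>R w)) (at t)" if "0 \<le> t" "t \<le> h" for t
    by (intro dd_along_line smooth_on_dd[OF S f]) (use box[of s t] s that in \<open>auto simp: algebra_simps\<close>)
  then obtain t where t: "0 < t" "t < h"
    "dd S v f ((z + s *\<^sub>R v) + h *\<^sub>R w) - dd S v f ((z + s *\<^sub>R v) + 0 *\<^sub>R w)
       = (h - 0) * dd S w (dd S v f) ((z + s *\<^sub>R v) + t *\<^sub>R w)"
    using MVT2[OF h, of "\<lambda>t. dd S v f ((z + s *\<^sub>R v) + t *\<^sub>R w)"
        "\<lambda>t. dd S w (dd S v f) ((z + s *\<^sub>R v) + t *\<^sub>R w)"] by blast
  have "g' s = h * dd S w (dd S v f) (z + s *\<^sub>R v + t *\<^sub>R w)"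
    using t(3) by (simp add: g'_def algebra_simps)
  with s(3) have "f (z + h *\<^sub>R v + h *\<^sub>R w) - f (z + h *\<^sub>R v) - f (z + h *\<^sub>R w) + f z
       = h * (h * dd S w (dd S v f) (z + s *\<^sub>R v + t *\<^sub>R w))"
    by (simp add: g_def add_ac)
  then show ?thesis by (rule that[OF s(1,2) t(1,2)])
qed

text \<open>At interior points both iterated derivatives are limits of the same second differences; at
  boundary points the two sides agree by continuity.\<close>

lemma dd_commute:
  fixes f :: "'a::euclidean_space \<Rightarrow> real"
  assumes S: "thick S" and f: "smooth_on f S" and "z \<in> S"
  shows "dd S v (dd S w f) z = dd S w (dd S v f) z"
proof -
  define g where "g z = dd S v (dd S w f) z - dd S w (dd S v f) z" for z
  have cont: "continuous_on S (dd S a (dd S b f))" for a b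
    by (rule smooth_on_continuous[OF smooth_on_dd[OF S smooth_on_dd[OF S f]]])
  have lim: "(\<lambda>n. dd S a (dd S b f) (p n)) \<longlonglongrightarrow> dd S a (dd S b f) z"
    if "p \<longlonglongrightarrow> z" "z \<in> S" "\<And>n. p n \<in> S" for p z a b
    by (rule continuous_on_tendsto_compose[OF cont that(1,2)]) (simp add: that(3))
  have int: "g z = 0" if z: "z \<in> interior S" for z
  proof -
    have zS: "z \<in> S" using z interior_subset by blast
    obtain e where e: "e > 0" "ball z e \<subseteq> interior S"
      using openE[OF open_interior z] by blast
    \<comment> \<open>chosen so that the parallelograms with sides \<open>h n\<close> times \<open>v\<close> and \<open>w\<close> stay in the ball\<close>
    define h where "h n = e / (norm v + norm w + 1) * inverse (real (Suc n))" for n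
    have pos: "norm v + norm w + 1 > 0" by (simp add: add_nonneg_pos)
    have h: "h n > 0" for n unfolding h_def using e(1) pos by (intro mult_pos_pos divide_pos_pos) auto
    have h0: "h \<longlonglongrightarrow> 0" unfolding h_def
      by (rule tendsto_mult_right_zero[OF LIMSEQ_inverse_real_of_nat])
    have inb: "z + s *\<^sub>R a + t *\<^sub>R b \<in> interior S"
      if "0 \<le> s" "s \<le> h n" "0 \<le> t" "t \<le> h n" "a = v \<and> b = w \<or> a = w \<and> b = v" for s t n a b
    proof -
      have "norm (s *\<^sub>R a + t *\<^sub>R b) \<le> s * norm a + t * norm b"
        using that by (metis abs_of_nonneg norm_scaleR norm_triangle_ineq)
      also have "\<dots> \<le> h n * norm a + h n * norm b"
        using that by (intro add_mono mult_right_mono) auto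
      also have "\<dots> < h n * (norm v + norm w + 1)"
        using that h[of n] by (auto simp: algebra_simps)
      also have "\<dots> = e / real (Suc n)" using pos by (simp add: h_def divide_inverse)
      also have "\<dots> \<le> e" using e by (simp add: field_simps)
      finally show ?thesis using e by (auto simp: dist_norm subset_iff algebra_simps norm_minus_commute)
    qed
    have ex: "\<exists>p. (\<forall>n. p n \<in> S) \<and> p \<longlonglongrightarrow> z \<and> (\<forall>n.
      f (z + h n *\<^sub>R a + h n *\<^sub>R b) - f (z + h n *\<^sub>R a) - f (z + h n *\<^sub>R b) + f z
       = h n * (h n * dd S b (dd S a f) (p n)))" if ab: "a = v \<and> b = w \<or> a = w \<and> b = v" for a b
    proof -
      have "\<exists>p. p \<in> S \<and> norm (p - z) \<le> h n * (norm a + norm b) \<and>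
        f (z + h n *\<^sub>R a + h n *\<^sub>R b) - f (z + h n *\<^sub>R a) - f (z + h n *\<^sub>R b) + f z
         = h n * (h n * dd S b (dd S a f) p)" for n
      proof -
        obtain s t where st: "0 < s" "s < h n" "0 < t" "t < h n"
          "f (z + h n *\<^sub>R a + h n *\<^sub>R b) - f (z + h n *\<^sub>R a) - f (z + h n *\<^sub>R b) + f z
           = h n * (h n * dd S b (dd S a f) (z + s *\<^sub>R a + t *\<^sub>R b))"
          by (rule second_difference[OF S f h[of n] inb[OF _ _ _ _ ab]])
        have "norm (s *\<^sub>R a + t *\<^sub>R b) \<le> s * norm a + t * norm b"
          using st by (metis abs_of_pos norm_scaleR norm_triangle_ineq)
        also have "\<dots> \<le> h n * norm a + h n * norm b"
          using st by (intro add_mono mult_right_mono) auto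
        finally have "norm (z + s *\<^sub>R a + t *\<^sub>R b - z) \<le> h n * (norm a + norm b)"
          by (simp add: distrib_left add.assoc)
        moreover have "z + s *\<^sub>R a + t *\<^sub>R b \<in> S"
          using inb[OF _ _ _ _ ab, of s n t] st interior_subset by auto
        ultimately show ?thesis using st(5) by blast
      qed
      then obtain p where p: "\<And>n. p n \<in> S" "\<And>n. norm (p n - z) \<le> h n * (norm a + norm b)"
        "\<And>n. f (z + h n *\<^sub>R a + h n *\<^sub>R b) - f (z + h n *\<^sub>R a) - f (z + h n *\<^sub>R b) + f z
         = h n * (h n * dd S b (dd S a f) (p n))"
        by metis
      have "(\<lambda>n. h n * (norm a + norm b)) \<longlonglongrightarrow> 0"
        using tendsto_mult_left_zero[OF h0] .
      then have "(\<lambda>n. p n - z) \<longlonglongrightarrow> 0"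
        by (rule Lim_null_comparison[rotated]) (simp add: p(2))
      then have "p \<longlonglongrightarrow> z" by (simp add: LIM_zero_iff)
      then show ?thesis using p by blast
    qed
    obtain p q where p: "\<And>n. p n \<in> S" "p \<longlonglongrightarrow> z" "\<And>n. 
      f (z + h n *\<^sub>R v + h n *\<^sub>R w) - f (z + h n *\<^sub>R v) - f (z + h n *\<^sub>R w) + f z
       = h n * (h n * dd S w (dd S v f) (p n))"
     and q: "\<And>n. q n \<in> S" "q \<longlonglongrightarrow> z" "\<And>n. 
      f (z + h n *\<^sub>R w + h n *\<^sub>R v) - f (z + h n *\<^sub>R w) - f (z + h n *\<^sub>R v) + f z
       = h n * (h n * dd S v (dd S w f) (q n))"
      using ex[of v w] ex[of w v] by auto
    have "h n * (h n * dd S w (dd S v f) (p n)) = h n * (h n * dd S v (dd S w f) (q n))" for n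
      unfolding p(3)[symmetric] q(3)[symmetric] by (simp add: algebra_simps)
    then have "dd S w (dd S v f) (p n) = dd S v (dd S w f) (q n)" for n
      using h[of n] by (metis less_irrefl mult_left_cancel)
    then have "(\<lambda>n. dd S v (dd S w f) (q n)) \<longlonglongrightarrow> dd S w (dd S v f) z"
      by (rule subst[OF ext, of "\<lambda>n. dd S w (dd S v f) (p n)" _ "\<lambda>X. X \<longlonglongrightarrow> dd S w (dd S v f) z"])
        (rule lim[OF p(2) zS p(1)])
    from LIMSEQ_unique[OF this lim[OF q(2) zS q(1), where a=v and b=w]] show ?thesis by (simp add: g_def)
  qed
  have "z \<in> closure (interior S)" using assms(3) S unfolding thick_def by blast
  then obtain p where p: "\<And>n. p n \<in> interior S" "p \<longlonglongrightarrow> z"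
    unfolding closure_sequential by blast
  then have pS: "p n \<in> S" for n using interior_subset by blast
  have "(\<lambda>n. g (p n)) \<longlonglongrightarrow> g z"
    unfolding g_def by (rule tendsto_diff[OF lim[OF p(2) assms(3) pS, where a=v and b=w]
          lim[OF p(2) assms(3) pS, where a=w and b=v]])
  moreover have "(\<lambda>n. g (p n)) \<longlonglongrightarrow> 0" using int[OF p(1)] by simp
  ultimately have "g z = 0" by (rule LIMSEQ_unique)
  then show ?thesis by (simp add: g_def)
qed

lemma thick_space_time:
  assumes "0 < T"
  shows "thick ((UNIV :: 'a::euclidean_space set) \<times> time_interval T)"
proof -
  let ?S = "(UNIV :: 'a set) \<times> time_interval T"
  have later: "\<exists>d>0. d < e \<and> t + d \<in> time_interval T" if te: "t \<in> time_interval T" "e > 0" for t e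
  proof -
    obtain s where s: "ereal t < ereal s" "ereal s < T"
      using te(1) ereal_dense2[of "ereal t" T] unfolding time_interval_def mem_Collect_eq by blast
    let ?d = "min (e/2) (s - t)"
    have "t + ?d \<le> s" by auto
    then have "ereal (t + ?d) < T" using s(2) by (meson ereal_less_eq(3) le_less_trans)
    then show ?thesis using s te by (intro exI[of _ ?d]) (auto simp: time_interval_def)
  qed
  have "open ((UNIV :: 'a set) \<times> {t. 0 < t \<and> ereal t < T})"
    by (intro open_Times open_UNIV open_Collect_conj open_Collect_less continuous_intros)
  then have int: "UNIV \<times> {t. 0 < t \<and> ereal t < T} \<subseteq> interior ?S"
    by (intro interior_maximal) (auto simp: time_interval_def)
  have "z \<in> closure (interior ?S)" if z: "z \<in> ?S" for z
    unfolding closure_approachable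
  proof (intro allI impI)
    fix e :: real assume "e > 0"
    then obtain d where d: "d > 0" "d < e" "snd z + d \<in> time_interval T" using later[of "snd z" e] z by auto
    then have "(fst z, snd z + d) \<in> interior ?S"
      using int z by (auto simp: time_interval_def)
    moreover have "dist (fst z, snd z + d) z < e"
      using d by (cases z) (simp add: dist_Pair_Pair dist_real_def)
    ultimately show "\<exists>y\<in>interior ?S. dist y z < e" by blast
  qed
  moreover have "\<exists>d. 0 < \<bar>d\<bar> \<and> \<bar>d\<bar> < e \<and> z + d *\<^sub>R i \<in> ?S" if z: "z \<in> ?S" and "i \<in> Basis" "e > 0" for z i e
  proof (cases "snd i = 0")
    case True
    then show ?thesis using z \<open>e > 0\<close> by (intro exI[of _ "e/2"]) (auto simp: mem_Times_iff)
  next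
    case False
    then have "snd i = 1" using \<open>i \<in> Basis\<close> by (auto simp: Basis_prod_def)
    moreover obtain d where "d > 0" "d < e" "snd z + d \<in> time_interval T" using later[of "snd z" e] z \<open>e > 0\<close> by auto
    ultimately show ?thesis by (intro exI[of _ d]) (auto simp: mem_Times_iff)
  qed
  ultimately show ?thesis unfolding thick_def by blast
qed

section \<open>Determinants and inverses of matrix-valued functions\<close>

lemma matrix_inv_mult:
  fixes A :: "'k::field^'n^'n"
  assumes "det A \<noteq> 0"
  shows "A ** matrix_inv A = mat 1" "matrix_inv A ** A = mat 1"
proof -
  have "\<exists>B. A ** B = mat 1 \<and> B ** A = mat 1"
    using assms invertible_det_nz[of A] unfolding invertible_def by blast
  then have "A ** matrix_inv A = mat 1 \<and> matrix_inv A ** A = mat 1"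
    unfolding matrix_inv_def by (rule someI_ex)
  then show "A ** matrix_inv A = mat 1" "matrix_inv A ** A = mat 1" by auto
qed

lemma matrix_inv_eqI:
  fixes A B :: "'k::field^'n^'n"
  assumes "A ** B = mat 1"
  shows "matrix_inv A = B"
proof -
  have "det A * det B = 1" using assms by (metis det_I det_mul)
  then have "det A \<noteq> 0" by auto
  then have "matrix_inv A ** (A ** B) = B"
    by (simp add: matrix_mul_assoc matrix_inv_mult)
  then show ?thesis by (simp add: assms)
qed

lemma sum_diagonal_left:
  "(\<Sum>k\<in>UNIV. (if i = k then a k else 0) * g k) = (a i * g i :: real)" for i :: "'n::finite"
proof -
  have "(\<Sum>k\<in>UNIV. (if i = k then a k else 0) * g k) = (\<Sum>k\<in>UNIV. if k = i then a i * g i else 0)"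
    by (intro sum.cong refl) auto
  then show ?thesis by simp
qed

lemma sum_diagonal_right:
  "(\<Sum>k\<in>UNIV. g k * (if k = j then a k else 0)) = (g j * a j :: real)" for j :: "'n::finite"
proof -
  have "(\<Sum>k\<in>UNIV. g k * (if k = j then a k else 0)) = (\<Sum>k\<in>UNIV. if k = j then g j * a j else 0)"
    by (intro sum.cong refl) auto
  then show ?thesis by simp
qed

lemma matrix_inv_diagonal:
  fixes A :: "real^'n^'n"
  assumes diag: "\<And>i j. A $ i $ j = (if i = j then b i else 0)" and b: "\<And>i. b i \<noteq> 0"
  shows "matrix_inv A $ i $ j = (if i = j then 1 / b i else 0)"
proof -
  have "A ** (\<chi> i j. if i = j then 1 / b i else 0) = mat 1"
    using b by (simp add: vec_eq_iff matrix_matrix_mult_def mat_def diag sum_diagonal_left)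
  then have "matrix_inv A = (\<chi> i j. if i = j then 1 / b i else 0)" by (rule matrix_inv_eqI)
  then show ?thesis by simp
qed

text \<open>A permutation other than the identity moves at least two points, so each term of the derivative
  of its product contains an off-diagonal entry of the identity matrix.\<close>

lemma has_derivative_det_at_identity:
  fixes Z :: "'a::real_normed_vector \<Rightarrow> 'k::real_normed_field^'n^'n"
  assumes D: "\<And>i j. ((\<lambda>w. Z w $ i $ j) has_derivative (\<lambda>v. Z' v $ i $ j)) (at z within S)"
    and Z: "Z z = mat 1"
  shows "((\<lambda>w. det (Z w)) has_derivative (\<lambda>v. trace (Z' v))) (at z within S)"
proof -
  let ?P = "{p. p permutes (UNIV :: 'n set)}"
  have "((\<lambda>w. \<Sum>p\<in>?P. of_int (sign p) * (\<Prod>i\<in>UNIV. Z w $ i $ p i)) has_derivative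
      (\<lambda>v. \<Sum>p\<in>?P. of_int (sign p) * (\<Sum>i\<in>UNIV. Z' v $ i $ p i * (\<Prod>j\<in>UNIV - {i}. Z z $ j $ p j)))) (at z within S)"
    by (intro has_derivative_sum has_derivative_mult_right has_derivative_prod D)
  moreover have "(\<Sum>p\<in>?P. of_int (sign p) * (\<Sum>i\<in>UNIV. Z' v $ i $ p i * (\<Prod>j\<in>UNIV - {i}. Z z $ j $ p j))) = trace (Z' v)" for v
  proof -
    have "of_int (sign p) * (\<Sum>i\<in>UNIV. Z' v $ i $ p i * (\<Prod>j\<in>UNIV - {i}. Z z $ j $ p j)) = 
       (if p = id then trace (Z' v) else 0)" if "p \<in> ?P" for p
    proof (cases "p = id")
      case True
      then show ?thesis by (auto simp: Z mat_def trace_def sign_id intro!: sum.cong)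
    next
      case False
      have "(\<Prod>j\<in>UNIV - {i}. Z z $ j $ p j) = 0" for i
      proof -
        have "\<exists>j. j \<noteq> i \<and> p j \<noteq> j"
        proof (rule ccontr)
          assume *: "\<nexists>j. j \<noteq> i \<and> p j \<noteq> j"
          moreover have "inj p" using that permutes_inj by auto
          ultimately have "p i = i" by (metis injD)
          then have "p = id" using * by (metis eq_id_iff)
          then show False using False by simp
        qed
        then obtain j where "j \<noteq> i" "p j \<noteq> j" by blast
        then show ?thesis by (intro prod_zero bexI[of _ j]) (auto simp: Z mat_def)
      qed
      then show ?thesis using False by (simp only: mult_zero_right sum.neutral_const if_False)
    qed
    then have "(\<Sum>p\<in>?P. of_int (sign p) * (\<Sum>i\<in>UNIV. Z' v $ i $ p i * (\<Prod>j\<in>UNIV - {i}. Z z $ j $ p j)))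
       = (\<Sum>p\<in>?P. if p = id then trace (Z' v) else 0)"
      by (intro sum.cong refl)
    also have "\<dots> = trace (Z' v)" by (subst sum.delta) (auto simp: permutes_id finite_permutations)
    finally show ?thesis .
  qed
  ultimately show ?thesis unfolding det_def by simp
qed

text \<open>Jacobi's formula; multiplying by the constant inverse reduces it to the identity matrix.\<close>

lemma has_derivative_det:
  fixes X :: "'a::real_normed_vector \<Rightarrow> 'k::real_normed_field^'n^'n"
  assumes D: "\<And>i j. ((\<lambda>w. X w $ i $ j) has_derivative (\<lambda>v. X' v $ i $ j)) (at z within S)"
    and Y: "Y ** X z = mat 1"
  shows "((\<lambda>w. det (X w)) has_derivative (\<lambda>v. det (X z) * trace (Y ** X' v))) (at z within S)"
proof -
  have "((\<lambda>w. det (Y ** X w)) has_derivative (\<lambda>v. trace (Y ** X' v))) (at z within S)"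
  proof (rule has_derivative_det_at_identity)
    show "((\<lambda>w. (Y ** X w) $ i $ j) has_derivative (\<lambda>v. (Y ** X' v) $ i $ j)) (at z within S)" for i j
      unfolding matrix_matrix_mult_def by (simp, intro has_derivative_sum has_derivative_mult_right D)
  qed (rule Y)
  then have "((\<lambda>w. det (X z) * det (Y ** X w)) has_derivative (\<lambda>v. det (X z) * trace (Y ** X' v))) (at z within S)"
    by (rule has_derivative_mult_right)
  moreover have "det (X z) * det (Y ** X w) = det (X w)" for w
  proof -
    have "det Y * det (X z) = 1" using Y by (metis det_I det_mul)
    then show ?thesis by (simp add: det_mul algebra_simps)
  qed
  ultimately show ?thesis by simp
qed

definition smooth_matrix :: "('a::euclidean_space \<Rightarrow> real^'m^'n) \<Rightarrow> 'a set \<Rightarrow> bool" where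
  "smooth_matrix X S \<longleftrightarrow> (\<forall>i j. smooth_on (\<lambda>z. X z $ i $ j) S)"

definition dd_matrix :: "'a::euclidean_space set \<Rightarrow> 'a \<Rightarrow> ('a \<Rightarrow> real^'m^'n) \<Rightarrow> 'a \<Rightarrow> real^'m^'n" where
  "dd_matrix S v X z = (\<chi> i j. dd S v (\<lambda>z. X z $ i $ j) z)"

lemma dd_matrix_nth [simp]: "dd_matrix S v X z $ i $ j = dd S v (\<lambda>z. X z $ i $ j) z"
  by (simp add: dd_matrix_def)

lemma smooth_matrixD: "smooth_matrix X S \<Longrightarrow> smooth_on (\<lambda>z. X z $ i $ j) S"
  by (simp add: smooth_matrix_def)

lemma smooth_matrix_mult:
  assumes "smooth_matrix X S" "smooth_matrix Y S"
  shows "smooth_matrix (\<lambda>z. X z ** Y z) S"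
  unfolding smooth_matrix_def matrix_matrix_mult_def
  by (simp, intro allI smooth_on_sum smooth_on_mult smooth_matrixD assms)

lemma smooth_on_det:
  assumes "smooth_matrix X S"
  shows "smooth_on (\<lambda>z. det (X z)) S"
  unfolding det_def
  by (intro smooth_on_sum smooth_on_mult smooth_on_prod smooth_on_const smooth_matrixD assms)

text \<open>By Cramer's rule.\<close>

lemma smooth_matrix_inv:
  fixes X :: "'a::euclidean_space \<Rightarrow> real^'n^'n"
  assumes X: "smooth_matrix X S" and d: "\<And>z. z \<in> S \<Longrightarrow> det (X z) \<noteq> 0"
  shows "smooth_matrix (\<lambda>z. matrix_inv (X z)) S"
  unfolding smooth_matrix_def
proof (intro allI)
  fix k l
  let ?N = "\<lambda>z. (\<chi> i j. if j = k then axis l 1 $ i else X z $ i $ j) :: real^'n^'n"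
  have "matrix_inv (X z) $ k $ l = det (?N z) / det (X z)" if "z \<in> S" for z
  proof -
    have "X z *v (matrix_inv (X z) *v axis l 1) = axis l 1"
      by (simp add: matrix_vector_mul_assoc matrix_inv_mult d that)
    then have "matrix_inv (X z) *v axis l 1 = (\<chi> k. det (\<chi> i j. if j = k then axis l 1 $ i else X z $ i $ j) / det (X z))"
      by (subst (asm) cramer[OF d[OF that]])
    then have "(matrix_inv (X z) *v axis l 1) $ k = det (?N z) / det (X z)" by simp
    then show ?thesis by (simp add: matrix_vector_mult_basis column_def)
  qed
  moreover have "smooth_on (\<lambda>z. det (?N z) / det (X z)) S"
  proof (intro smooth_on_divide smooth_on_det X d)
    have "smooth_on (\<lambda>z. ?N z $ i $ j) S" for i j
      by (cases "j = k") (simp_all add: smooth_on_const smooth_matrixD X)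
    then show "smooth_matrix ?N S" unfolding smooth_matrix_def by blast
  qed
  ultimately show "smooth_on (\<lambda>z. matrix_inv (X z) $ k $ l) S"
    using smooth_on_cong[of S "\<lambda>z. matrix_inv (X z) $ k $ l" "\<lambda>z. det (?N z) / det (X z)"] by simp
qed

lemma smooth_matrix_dd:
  assumes "thick S" "smooth_matrix X S"
  shows "smooth_matrix (dd_matrix S v X) S"
  unfolding smooth_matrix_def dd_matrix_nth
  by (intro allI) (rule smooth_on_dd[OF assms(1) smooth_matrixD[OF assms(2)]])

context
  fixes S :: "'a::euclidean_space set" and z :: 'a
  assumes S: "thick S" and z: "z \<in> S"
begin

lemma dd_matrix_mult:
  assumes "smooth_matrix X S" "smooth_matrix Y S"
  shows "dd_matrix S v (\<lambda>z. X z ** Y z) z = X z ** dd_matrix S v Y z + dd_matrix S v X z ** Y z"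
proof -
  have "dd S v (\<lambda>z. \<Sum>k\<in>UNIV. X z $ i $ k * Y z $ k $ j) z =
      (\<Sum>k\<in>UNIV. X z $ i $ k * dd S v (\<lambda>z. Y z $ k $ j) z + dd S v (\<lambda>z. X z $ i $ k) z * Y z $ k $ j)" for i j
    by (subst dd_sum[OF S z]) (intro smooth_on_mult sum.cong refl dd_mult[OF S z] smooth_matrixD assms)+
  then show ?thesis by (simp add: vec_eq_iff matrix_matrix_mult_def sum.distrib)
qed

lemma dd_det:
  assumes "smooth_matrix X S" "det (X z) \<noteq> 0"
  shows "dd S v (\<lambda>z. det (X z)) z = det (X z) * trace (matrix_inv (X z) ** dd_matrix S v X z)"
proof (rule dd_eq[OF S z has_derivative_det])
  show "((\<lambda>w. X w $ i $ j) has_derivative (\<lambda>v. dd_matrix S v X z $ i $ j)) (at z within S)" for i j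
    using smooth_on_has_derivative[OF smooth_matrixD[OF assms(1)] z] by simp
qed (simp add: matrix_inv_mult assms)

text \<open>Differentiate \<open>X X\<^sup>-\<^sup>1 = 1\<close>.\<close>

lemma dd_matrix_inv:
  assumes X: "smooth_matrix X S" and d: "\<And>z. z \<in> S \<Longrightarrow> det (X z) \<noteq> 0"
  shows "dd_matrix S v (\<lambda>z. matrix_inv (X z)) z
    = - (matrix_inv (X z) ** dd_matrix S v X z ** matrix_inv (X z))"
proof -
  let ?Y = "\<lambda>z. matrix_inv (X z)"
  note Y = smooth_matrix_inv[OF X d]
  have "dd S v (\<lambda>z. (X z ** ?Y z) $ i $ j) z = 0" for i j
  proof -
    have "dd S v (\<lambda>z. (X z ** ?Y z) $ i $ j) z = dd S v (\<lambda>z. mat 1 $ i $ j) z"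
      by (rule dd_cong[OF _ z]) (simp add: matrix_inv_mult d)
    then show ?thesis by (simp add: dd_const[OF S z])
  qed
  then have "dd_matrix S v (\<lambda>z. X z ** ?Y z) z = 0" by (simp add: vec_eq_iff)
  then have "X z ** dd_matrix S v ?Y z = - (dd_matrix S v X z ** ?Y z)"
    using dd_matrix_mult[OF X Y] by (simp add: eq_neg_iff_add_eq_0)
  then have "?Y z ** (X z ** dd_matrix S v ?Y z) = ?Y z ** (- (dd_matrix S v X z ** ?Y z))" by simp
  then have "dd_matrix S v ?Y z = ?Y z ** (- (dd_matrix S v X z ** ?Y z))"
    by (simp add: matrix_mul_assoc matrix_inv_mult d z)
  also have "\<dots> = - (?Y z ** (dd_matrix S v X z ** ?Y z))"
    by (simp add: vec_eq_iff matrix_matrix_mult_def sum_negf)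
  finally show ?thesis by (simp add: matrix_mul_assoc)
qed

end

lemma trace_matrix_mult: "trace (A ** B) = (\<Sum>i\<in>UNIV. \<Sum>j\<in>UNIV. A $ i $ j * B $ j $ i)"
  by (simp add: trace_def matrix_matrix_mult_def)

lemma dd_trace:
  assumes "thick S" "z \<in> S" "smooth_matrix X S"
  shows "dd S v (\<lambda>z. trace (X z)) z = trace (dd_matrix S v X z)"
  unfolding trace_def dd_matrix_nth by (rule dd_sum[OF assms(1,2)]) (rule smooth_matrixD[OF assms(3)])

lemma dd_ln:
  fixes f :: "'a::euclidean_space \<Rightarrow> real"
  assumes "thick S" "z \<in> S" "smooth_on f S" "f z > 0"
  shows "dd S v (\<lambda>z. ln (f z)) z = dd S v f z / f z"
  by (rule dd_eq[OF assms(1,2)])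
    (use DERIV_compose_FDERIV[OF DERIV_ln[OF assms(4)] smooth_on_has_derivative[OF assms(3,2)]] in
      \<open>simp add: divide_inverse\<close>)

lemma dd_ln_det:
  assumes "thick S" "z \<in> S" "smooth_matrix X S" "det (X z) > 0"
  shows "dd S v (\<lambda>z. ln (det (X z))) z = trace (matrix_inv (X z) ** dd_matrix S v X z)"
  using assms by (simp add: dd_ln smooth_on_det dd_det)

lemma dd_dd_ln_det:
  assumes S: "thick S" and z: "z \<in> S" and X: "smooth_matrix X S" and d: "\<And>z. z \<in> S \<Longrightarrow> det (X z) > 0"
  shows "dd S w (dd S v (\<lambda>z. ln (det (X z)))) z =
    trace (matrix_inv (X z) ** dd_matrix S w (dd_matrix S v X) z)
    - trace (matrix_inv (X z) ** dd_matrix S w X z ** matrix_inv (X z) ** dd_matrix S v X z)"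
proof -
  have d': "det (X z) \<noteq> 0" if "z \<in> S" for z using d[OF that] by simp
  have "dd S w (dd S v (\<lambda>z. ln (det (X z)))) z = dd S w (\<lambda>z. trace (matrix_inv (X z) ** dd_matrix S v X z)) z"
    by (rule dd_cong[OF _ z]) (simp add: dd_ln_det S X d)
  also have "\<dots> = trace (dd_matrix S w (\<lambda>z. matrix_inv (X z) ** dd_matrix S v X z) z)"
    by (intro dd_trace S z smooth_matrix_mult smooth_matrix_inv smooth_matrix_dd X d')
  also have "dd_matrix S w (\<lambda>z. matrix_inv (X z) ** dd_matrix S v X z) z =
    matrix_inv (X z) ** dd_matrix S w (dd_matrix S v X) z
    + - (matrix_inv (X z) ** dd_matrix S w X z ** matrix_inv (X z)) ** dd_matrix S v X z"
    by (simp add: dd_matrix_mult[OF S z smooth_matrix_inv[OF X d'] smooth_matrix_dd[OF S X]] dd_matrix_inv[OF S z X d'])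
  also have "trace \<dots> = trace (matrix_inv (X z) ** dd_matrix S w (dd_matrix S v X) z)
    - trace (matrix_inv (X z) ** dd_matrix S w X z ** matrix_inv (X z) ** dd_matrix S v X z)"
  proof -
    have "- A ** B = - (A ** B)" for A B :: "real^'b^'b"
      by (simp add: vec_eq_iff matrix_matrix_mult_def sum_negf)
    moreover have "trace (A + - B) = trace A - trace B" for A B :: "real^'b^'b"
      by (simp add: trace_def sum_subtractf)
    ultimately show ?thesis by simp
  qed
  finally show ?thesis .
qed

section \<open>Orthonormal eigenbases\<close>

definition eigenbasis :: "real^'n^'n \<Rightarrow> ('n \<Rightarrow> real^'n) \<Rightarrow> ('n \<Rightarrow> real) \<Rightarrow> bool" where
  "eigenbasis M r l \<longleftrightarrow> (\<forall>a b. r a \<bullet> r b = (if a = b then 1 else 0)) \<and> (\<forall>a. M *v r a = l a *\<^sub>R r a)"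

text \<open>A maximiser of \<open>x \<bullet> f x\<close> on the unit sphere of an invariant subspace is an eigenvector.\<close>

lemma self_adjoint_eigenvector:
  fixes f :: "'a::euclidean_space \<Rightarrow> 'a"
  assumes f: "linear f" and sa: "\<And>x y. x \<bullet> f y = f x \<bullet> y"
    and V: "subspace V" "f ` V \<subseteq> V" "V \<noteq> {0}"
  obtains x c where "x \<in> V" "norm x = 1" "f x = c *\<^sub>R x"
proof -
  let ?K = "sphere 0 1 \<inter> V"
  have "compact ?K" by (simp add: closed_subspace V compact_Int_closed)
  moreover have "?K \<noteq> {}"
  proof -
    obtain y where y: "y \<in> V" "y \<noteq> 0" using V subspace_0 by fastforce
    then have "(1 / norm y) *\<^sub>R y \<in> ?K" using V(1) by (simp add: subspace_scale)
    then show ?thesis by blast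
  qed
  moreover have "continuous_on ?K (\<lambda>x. x \<bullet> f x)"
    by (intro continuous_on_inner continuous_on_id linear_continuous_on linear_conv_bounded_linear[THEN iffD1] f)
  ultimately obtain x where x: "x \<in> ?K" "\<And>y. y \<in> ?K \<Longrightarrow> y \<bullet> f y \<le> x \<bullet> f x"
    using continuous_attains_sup[of ?K "\<lambda>x. x \<bullet> f x"] by metis
  define c where "c = x \<bullet> f x"
  have xx: "x \<bullet> x = 1" using x(1) by (simp add: norm_eq_1)
  have max: "y \<bullet> f y \<le> c * (y \<bullet> y)" if "y \<in> V" for y
  proof (cases "y = 0")
    case True
    then show ?thesis using linear_0[OF f] by simp
  next
    case False
    have "(1 / norm y) *\<^sub>R y \<in> ?K" using that False V(1) by (simp add: subspace_scale)
    from x(2)[OF this] have "((1 / norm y) *\<^sub>R y) \<bullet> f ((1 / norm y) *\<^sub>R y) \<le> c" by (simp only: c_def)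
    then have "(y \<bullet> f y) / (norm y * norm y) \<le> c" by (simp add: linear_cmul[OF f])
    moreover have "norm y * norm y = y \<bullet> y" by (simp add: norm_eq_sqrt_inner)
    ultimately show ?thesis using False by (simp add: field_simps)
  qed
  \<comment> \<open>the first variation of \<open>y \<bullet> f y / (y \<bullet> y)\<close> vanishes at the maximiser\<close>
  have orth: "w \<bullet> f x = 0" if w: "w \<in> V" "w \<bullet> x = 0" for w
  proof -
    define b where "b = w \<bullet> f x"
    define K where "K = c * (w \<bullet> w) - w \<bullet> f w"
    have *: "2 * s * b \<le> s * s * K" for s
    proof -
      have "(x + s *\<^sub>R w) \<bullet> f (x + s *\<^sub>R w) \<le> c * ((x + s *\<^sub>R w) \<bullet> (x + s *\<^sub>R w))"
        by (intro max) (use x w V(1) in \<open>auto intro!: subspace_add subspace_scale\<close>)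
      moreover have "x \<bullet> f w = b" using sa[of x w] by (simp add: b_def inner_commute)
      moreover have "x \<bullet> w = 0" using w(2) by (simp add: inner_commute)
      ultimately show ?thesis using w(2) xx
        by (simp add: linear_add[OF f] linear_cmul[OF f] inner_add_left inner_add_right b_def[symmetric]
            c_def[symmetric] K_def algebra_simps)
    qed
    have "b = 0"
    proof (rule ccontr)
      assume "b \<noteq> 0"
      define s where "s = b / (\<bar>K\<bar> + 1)"
      have "2 * s * b \<le> s * s * \<bar>K\<bar>"
        using *[of s] mult_left_mono[OF abs_ge_self[of K], of "s * s"] by simp
      also have "s * s * \<bar>K\<bar> = s * b * (\<bar>K\<bar> / (\<bar>K\<bar> + 1))" by (simp add: s_def)
      also have "\<dots> \<le> s * b * 1"
        by (intro mult_left_mono) (auto simp: s_def field_simps)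
      finally have "2 * (s * b) \<le> s * b" by (simp only: mult.assoc mult_1_right)
      then have "s * b \<le> 0" by linarith
      moreover have "s * b = b\<^sup>2 / (\<bar>K\<bar> + 1)" by (simp add: s_def power2_eq_square)
      then have "s * b > 0" using \<open>b \<noteq> 0\<close> by (simp add: divide_pos_pos add_nonneg_pos)
      ultimately show False by simp
    qed
    then show ?thesis by (simp add: b_def)
  qed
  have "f x - c *\<^sub>R x \<in> V" using x V by (auto intro!: subspace_diff subspace_scale)
  moreover have "(f x - c *\<^sub>R x) \<bullet> x = 0" using xx by (simp add: inner_diff_left c_def inner_commute[of "f x"])
  ultimately have "(f x - c *\<^sub>R x) \<bullet> f x = 0" "(f x - c *\<^sub>R x) \<bullet> x = 0" using orth by auto
  then have "(f x - c *\<^sub>R x) \<bullet> (f x - c *\<^sub>R x) = 0" by (simp add: inner_diff_right)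
  then have "f x = c *\<^sub>R x" by simp
  then show ?thesis using that x by auto
qed

text \<open>An orthonormal set of eigenvectors of maximal size is a basis: its orthogonal complement is
  invariant, and would otherwise contain one more eigenvector.\<close>

lemma symmetric_eigenbasis:
  fixes M :: "real^'n^'n"
  assumes M: "transpose M = M"
  obtains r l where "eigenbasis M r l"
proof -
  let ?ok = "\<lambda>B. pairwise orthogonal B \<and> (\<forall>b\<in>B. norm b = 1 \<and> (\<exists>c. M *v b = c *\<^sub>R b))"
  have indep: "independent B" if "?ok B" for B
    by (rule pairwise_orthogonal_independent) (use that in auto)
  have bound: "finite B \<and> card B \<le> DIM(real^'n)" if "?ok B" for B
    using independent_bound[OF indep[OF that]] by simp
  have "?ok {}" by simp
  then obtain B where B: "?ok B" "\<And>B'. ?ok B' \<Longrightarrow> card B' \<le> card B"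
    using ex_has_greatest_nat[of ?ok "{}" card "Suc DIM(real^'n)"] less_Suc_eq_le bound by blast
  define V where "V = {x. \<forall>b\<in>B. x \<bullet> b = 0}"
  have sa: "x \<bullet> (M *v y) = (M *v x) \<bullet> y" for x y
    by (metis M dot_lmul_matrix transpose_matrix_vector)
  have sub: "subspace V" by (auto simp: V_def subspace_def inner_add_left)
  have "V = {0}"
  proof (rule ccontr)
    assume "V \<noteq> {0}"
    moreover have "(*v) M ` V \<subseteq> V"
    proof -
      have "(M *v x) \<bullet> b = 0" if xb: "x \<in> V" "b \<in> B" for x b
      proof -
        obtain c where "M *v b = c *\<^sub>R b" using B(1) xb(2) by blast
        then show ?thesis using xb by (simp add: sa[symmetric] V_def)
      qed
      then show ?thesis by (auto simp: V_def)
    qed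
    ultimately obtain x c where x: "x \<in> V" "norm x = 1" "M *v x = c *\<^sub>R x"
      using self_adjoint_eigenvector[of "(*v) M" V] sa sub matrix_vector_mul_linear by metis
    have "x \<notin> B" using x by (auto simp: V_def norm_eq_1)
    have "?ok (insert x B)"
      using B(1) x by (auto simp: pairwise_insert orthogonal_def V_def inner_commute)
    then have "card (insert x B) \<le> card B" by (rule B(2))
    then show False using bound[OF B(1)] \<open>x \<notin> B\<close> by simp
  qed
  have Bdot: "b \<bullet> b' = (if b = b' then 1 else 0)" if "b \<in> B" "b' \<in> B" for b b'
    using B(1) that by (auto simp: pairwise_def orthogonal_def norm_eq_1)
  have "x \<in> span B" for x
  proof -
    have "(x - (\<Sum>b\<in>B. (x \<bullet> b) *\<^sub>R b)) \<bullet> b' = 0" if "b' \<in> B" for b'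
    proof -
      have "(\<Sum>b\<in>B. (x \<bullet> b) *\<^sub>R b) \<bullet> b' = (\<Sum>b\<in>B. if b = b' then x \<bullet> b' else 0)"
        unfolding inner_sum_left by (intro sum.cong) (auto simp: Bdot that)
      then show ?thesis using bound[OF B(1)] that by (simp add: inner_diff_left)
    qed
    then have "x - (\<Sum>b\<in>B. (x \<bullet> b) *\<^sub>R b) \<in> V" by (simp add: V_def)
    then have "x = (\<Sum>b\<in>B. (x \<bullet> b) *\<^sub>R b)" using \<open>V = {0}\<close> by simp
    moreover have "(\<Sum>b\<in>B. (x \<bullet> b) *\<^sub>R b) \<in> span B"
      by (intro span_sum span_scale span_base)
    ultimately show ?thesis by simp
  qed
  then have "span B = UNIV" by blast
  then have "card B = DIM(real^'n)"
    using dim_eq_card_independent[OF indep[OF B(1)]] by (metis dim_UNIV dim_span)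
  then have "card (UNIV :: 'n set) = card B" by simp
  then obtain r where r: "bij_betw r (UNIV :: 'n set) B"
    using finite_same_card_bij[of "UNIV :: 'n set" B] bound[OF B(1)] by auto
  then have rB: "r a \<in> B" for a by (auto simp: bij_betw_def)
  then have "\<forall>a. \<exists>c. M *v r a = c *\<^sub>R r a" using B(1) by blast
  then obtain l where "\<forall>a. M *v r a = l a *\<^sub>R r a" by metis
  moreover have "r a \<bullet> r b = (if a = b then 1 else 0)" for a b
    using Bdot[OF rB rB] r by (auto simp: bij_betw_def inj_on_def)
  ultimately have "eigenbasis M r l" by (simp add: eigenbasis_def)
  then show ?thesis by (rule that)
qed

text \<open>The change of basis: \<open>transpose (column_matrix r) ** M ** column_matrix r\<close> is the matrix of the
  bilinear form \<open>M\<close> in the basis \<open>r\<close>.\<close>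

definition column_matrix :: "('m \<Rightarrow> real^'n) \<Rightarrow> real^'m^'n" where
  "column_matrix r = (\<chi> i a. r a $ i)"

lemma congruence_nth:
  fixes M :: "real^'n^'n"
  shows "(transpose (column_matrix r) ** M ** column_matrix r') $ a $ b = r a \<bullet> (M *v r' b)"
proof -
  have "(transpose (column_matrix r) ** M ** column_matrix r') $ a $ b =
      (\<Sum>j\<in>UNIV. \<Sum>i\<in>UNIV. r a $ i * M $ i $ j * r' b $ j)"
    by (simp add: matrix_matrix_mult_def column_matrix_def transpose_def sum_distrib_right)
  also have "\<dots> = (\<Sum>i\<in>UNIV. \<Sum>j\<in>UNIV. r a $ i * M $ i $ j * r' b $ j)"
    by (rule sum.swap)
  also have "\<dots> = r a \<bullet> (M *v r' b)"
    by (simp add: inner_vec_def matrix_vector_mult_def sum_distrib_left mult.assoc)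
  finally show ?thesis .
qed

lemma transpose_column_matrix_mult:
  "(transpose (column_matrix r) ** column_matrix r') $ a $ b = r a \<bullet> r' b"
  using congruence_nth[of r "mat 1" r' a b] by simp

lemma orthonormal_column_matrix:
  fixes r :: "'n \<Rightarrow> real^'n"
  assumes "\<And>a b. r a \<bullet> r b = (if a = b then 1 else 0)"
  shows "transpose (column_matrix r) ** column_matrix r = mat 1"
    "column_matrix r ** transpose (column_matrix r) = mat 1"
proof -
  show "transpose (column_matrix r) ** column_matrix r = mat 1"
    by (simp add: vec_eq_iff transpose_column_matrix_mult assms mat_def)
  then show "column_matrix r ** transpose (column_matrix r) = mat 1"
    using matrix_left_right_inverse by blast
qed

lemma eigenvalues_similar:
  assumes "A ** B = mat 1" "B ** A = mat 1"
  shows "eigenvalues (A ** M ** B) l \<longleftrightarrow> eigenvalues M l"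
proof -
  have "det (mat z - A ** M ** B) = det (mat z - M)" for z
  proof -
    have "A ** (mat z) = mat z ** A"
      by (auto simp: vec_eq_iff matrix_matrix_mult_def mat_def if_distrib if_distribR sum.delta sum.delta' cong: if_cong)
    then have "A ** mat z ** B = mat z"
      by (simp add: matrix_mul_assoc[symmetric] assms)
    then have "mat z - A ** M ** B = A ** (mat z - M) ** B"
      by (simp add: vec_eq_iff matrix_matrix_mult_def sum_subtractf left_diff_distrib right_diff_distrib)
    moreover have "det A * det B = 1" using assms by (metis det_I det_mul)
    ultimately show ?thesis by (simp add: det_mul)
  qed
  then show ?thesis by (simp add: eigenvalues_def)
qed

lemma eigenvalues_eigenbasis:
  assumes "eigenbasis M r l"
  shows "eigenvalues M l"
proof -
  note o = orthonormal_column_matrix[of r]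
  have "eigenvalues (transpose (column_matrix r) ** M ** column_matrix r) l"
    unfolding eigenvalues_def
  proof
    fix z
    let ?D = "mat z - transpose (column_matrix r) ** M ** column_matrix r"
    have "?D $ i $ j = (if i = j then z - l i else 0)" for i j
      unfolding vector_minus_component congruence_nth
      using assms by (simp add: eigenbasis_def mat_def)
    then show "det ?D = (\<Prod>i\<in>UNIV. z - l i)"
      by (subst det_diagonal) auto
  qed
  then show ?thesis using assms o by (subst (asm) eigenvalues_similar) (auto simp: eigenbasis_def)
qed

text \<open>Two lists of the eigenvalues of a matrix are permutations of each other, because both list the
  roots of the characteristic polynomial with multiplicity.\<close>

lemma eigenvalues_pairwise:
  assumes "eigenvalues M l" "eigenvalues M l'" and P: "\<And>i j. i \<noteq> j \<Longrightarrow> P (l i) (l j)" and "i \<noteq> j"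
  shows "P (l' i) (l' j)"
proof -
  have "poly (\<Prod>i\<in>UNIV. [:- l i, 1:]) = poly (\<Prod>i\<in>UNIV. [:- l' i, 1:])"
    using assms by (auto simp: eigenvalues_def poly_prod)
  then have "(\<Prod>i\<in>UNIV. [:- l i, 1:]) = (\<Prod>i\<in>UNIV. [:- l' i, 1:])"
    by (simp add: poly_eq_poly_eq_iff)
  moreover have "proots (\<Prod>i\<in>UNIV. [:- k i, 1:]) = image_mset k (mset_set UNIV)" for k :: "'a \<Rightarrow> real"
    by (subst proots_prod) (auto simp: sum_unfold_sum_mset)
  ultimately have "image_mset l' (mset_set UNIV) = image_mset l (mset_set UNIV)"
    by metis
  then obtain p where p: "p permutes UNIV" "\<forall>x\<in>UNIV. l' x = l (p x)"
    by (rule image_mset_eq_implies_permutes[OF finite])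
  then have "p i \<noteq> p j" using \<open>i \<noteq> j\<close> permutes_inj by (metis injD)
  then show ?thesis using P p by simp
qed

text \<open>The inverse of a metric transforms with the inverse of the change of frame, so its contraction with
  a bilinear form does not depend on the frame.\<close>

lemma inverse_contraction_congruence:
  fixes g :: "real^'n^'n"
  assumes g: "g = transpose J ** g' ** J" and b: "b = transpose J ** b' ** J"
    and d: "det J \<noteq> 0" "det g' \<noteq> 0"
  shows "(\<Sum>i\<in>UNIV. \<Sum>j\<in>UNIV. matrix_inv g $ i $ j * b $ i $ j) =
    (\<Sum>i\<in>UNIV. \<Sum>j\<in>UNIV. matrix_inv g' $ i $ j * b' $ i $ j)"
proof -
  let ?K = "matrix_inv J"
  note K = matrix_inv_mult[OF d(1)]
  have tK: "transpose J ** transpose ?K = mat 1"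
    by (metis K(2) matrix_transpose_mul transpose_mat)
  have "g ** (?K ** matrix_inv g' ** transpose ?K) = 
    transpose J ** (g' ** (J ** ?K) ** matrix_inv g') ** transpose ?K"
    by (simp only: g matrix_mul_assoc)
  also have "\<dots> = mat 1" by (simp add: K matrix_inv_mult d tK)
  finally have inv: "matrix_inv g = ?K ** matrix_inv g' ** transpose ?K" by (rule matrix_inv_eqI)
  have tr: "(\<Sum>i\<in>UNIV. \<Sum>j\<in>UNIV. A $ i $ j * B $ i $ j) = trace (A ** transpose B)" for A B :: "real^'n^'n"
    by (simp add: trace_matrix_mult transpose_def)
  have "matrix_inv g ** transpose b = 
     ?K ** (matrix_inv g' ** (transpose ?K ** transpose J) ** transpose b' ** J)"
    by (simp add: inv b matrix_transpose_mul matrix_mul_assoc)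
  also have "transpose ?K ** transpose J = mat 1"
    by (metis K(1) matrix_transpose_mul transpose_mat)
  finally have "matrix_inv g ** transpose b = ?K ** (matrix_inv g' ** transpose b' ** J)"
    by (simp only: matrix_mul_rid)
  then have "trace (matrix_inv g ** transpose b) = trace ((matrix_inv g' ** transpose b' ** J) ** ?K)"
    using trace_mul_sym[of ?K "matrix_inv g' ** transpose b' ** J"] by metis
  also have "\<dots> = trace (matrix_inv g' ** transpose b')"
    by (simp only: matrix_mul_assoc[symmetric] K matrix_mul_rid)
  finally show ?thesis by (simp only: tr)
qed

section \<open>The second additive compound of a matrix\<close>

text \<open>Padding by the identity turns a matrix indexed by a set into one indexed by a type with the same
  determinant, so that products, inverses and Jacobi's formula are available.\<close>

definition padded :: "'p::finite set \<Rightarrow> ('p \<Rightarrow> 'p \<Rightarrow> real) \<Rightarrow> real^'p^'p" where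
  "padded I a = (\<chi> p q. if p \<in> I \<and> q \<in> I then a p q else of_bool (p = q))"

text \<open>A permutation that moves a point outside \<open>I\<close> meets an off-diagonal entry of the identity.\<close>

lemma det_padded: "det (padded I a) = det_on I a"
proof -
  let ?P = "{p. p permutes (UNIV :: 'a set)}"
  have "det (padded I a) = (\<Sum>p\<in>{p. p permutes I}. of_int (sign p) * (\<Prod>i\<in>UNIV. padded I a $ i $ p i))"
    unfolding det_def
  proof (rule sum.mono_neutral_right)
    show "\<forall>p\<in>?P - {p. p permutes I}. of_int (sign p) * (\<Prod>i\<in>UNIV. padded I a $ i $ p i) = 0"
    proof
      fix p assume p: "p \<in> ?P - {p. p permutes I}"
      then have "\<exists>i. i \<notin> I \<and> p i \<noteq> i" by (auto simp: permutes_def)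
      then obtain i where "i \<notin> I" "p i \<noteq> i" by blast
      then have "padded I a $ i $ p i = 0" by (auto simp: padded_def)
      then have "(\<Prod>i\<in>UNIV. padded I a $ i $ p i) = 0" by (intro prod_zero) auto
      then show "of_int (sign p) * (\<Prod>i\<in>UNIV. padded I a $ i $ p i) = 0" by simp
    qed
  qed (auto simp: finite_permutations intro: permutes_subset)
  also have "\<dots> = (\<Sum>p\<in>{p. p permutes I}. of_int (sign p) * (\<Prod>i\<in>I. a i (p i)))"
  proof (intro sum.cong refl arg_cong2[where f = "(*)"])
    fix p assume "p \<in> {p. p permutes I}"
    then have p: "p permutes I" by simp
    have "(\<Prod>i\<in>I. a i (p i)) = (\<Prod>i\<in>I. padded I a $ i $ p i)"
      by (intro prod.cong refl) (simp add: padded_def permutes_in_image[OF p])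
    also have "\<dots> = (\<Prod>i\<in>UNIV. padded I a $ i $ p i)"
      by (intro prod.mono_neutral_left) (auto simp: padded_def permutes_not_in[OF p])
    finally show "(\<Prod>i\<in>UNIV. padded I a $ i $ p i) = (\<Prod>i\<in>I. a i (p i))" by simp
  qed
  finally show ?thesis by (simp add: det_on_def)
qed

lemma padded_mult: "padded I a ** padded I b = padded I (\<lambda>p q. \<Sum>r\<in>I. a p r * b r q)"
proof -
  have "(\<Sum>r\<in>UNIV. padded I a $ p $ r * padded I b $ r $ q) =
    (if p \<in> I \<and> q \<in> I then \<Sum>r\<in>I. a p r * b r q else of_bool (p = q))" for p q
  proof -
    consider "p \<notin> I" | "p \<in> I" "q \<notin> I" | "p \<in> I" "q \<in> I" by blast
    then show ?thesis
    proof cases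
      case 1
      then have "padded I a $ p $ r * padded I b $ r $ q = (if r = p then padded I b $ p $ q else 0)" for r
        by (simp add: padded_def)
      then have "(\<Sum>r\<in>UNIV. padded I a $ p $ r * padded I b $ r $ q) = padded I b $ p $ q" by simp
      then show ?thesis using 1 by (simp add: padded_def)
    next
      case 2
      then have "padded I a $ p $ r * padded I b $ r $ q = 0" for r
        by (cases "r \<in> I") (auto simp: padded_def)
      moreover have "p \<noteq> q" using 2 by auto
      ultimately show ?thesis using 2 by (simp only: sum.neutral_const of_bool_def if_False simp_thms)
    next
      case 3
      have "padded I a $ p $ r = 0" if "r \<notin> I" for r
        using 3 that by (auto simp: padded_def)
      then have "(\<Sum>r\<in>UNIV. padded I a $ p $ r * padded I b $ r $ q) = (\<Sum>r\<in>I. padded I a $ p $ r * padded I b $ r $ q)"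
        by (intro sum.mono_neutral_right) simp_all
      also have "\<dots> = (\<Sum>r\<in>I. a p r * b r q)"
        using 3 by (intro sum.cong refl) (simp add: padded_def)
      finally show ?thesis using 3 by simp
    qed
  qed
  then show ?thesis by (simp add: vec_eq_iff matrix_matrix_mult_def) (simp add: padded_def)
qed

lemma padded_identity: "padded I (\<lambda>p q. of_bool (p = q)) = mat 1"
  by (simp add: padded_def mat_def vec_eq_iff)

lemma sum_increasing_pairs:
  fixes f :: "'n::{finite,linorder} \<Rightarrow> 'n \<Rightarrow> real"
  assumes "\<And>k l. f k l = f l k"
  shows "(\<Sum>k\<in>UNIV. \<Sum>l\<in>UNIV. f k l) = 2 * (\<Sum>(k,l)\<in>increasing_pairs. f k l) + (\<Sum>k\<in>UNIV. f k k)"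
proof -
  have swap: "(\<Sum>(k,l)\<in>{(k,l). l < k}. f k l) = (\<Sum>(k,l)\<in>increasing_pairs. f k l)"
    by (rule sum.reindex_bij_witness[of _ prod.swap prod.swap])
      (auto simp: increasing_pairs_def assms)
  have diag: "(\<Sum>(k,l)\<in>{(k,l). k = l}. f k l) = (\<Sum>k\<in>UNIV. f k k)"
    by (rule sum.reindex_bij_witness[of _ "\<lambda>k. (k, k)" fst]) auto
  have U: "(UNIV :: ('n \<times> 'n) set) = (increasing_pairs \<union> {(k,l). l < k}) \<union> {(k,l). k = l}"
    by (auto simp: increasing_pairs_def)
  have "(\<Sum>k\<in>UNIV. \<Sum>l\<in>UNIV. f k l) = (\<Sum>(k,l)\<in>UNIV. f k l)"
    by (simp add: sum.cartesian_product)
  also have "\<dots> = (\<Sum>(k,l)\<in>increasing_pairs \<union> {(k,l). l < k}. f k l) + (\<Sum>(k,l)\<in>{(k,l). k = l}. f k l)"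
    unfolding U by (rule sum.union_disjoint) (auto simp: increasing_pairs_def)
  also have "(\<Sum>(k,l)\<in>increasing_pairs \<union> {(k,l). l < k}. f k l) =
      (\<Sum>(k,l)\<in>increasing_pairs. f k l) + (\<Sum>(k,l)\<in>{(k,l). l < k}. f k l)"
    by (rule sum.union_disjoint) (auto simp: increasing_pairs_def)
  finally show ?thesis by (simp add: swap diag)
qed

text \<open>The symmetrised action of \<open>P \<otimes> Q\<close> on the second exterior power.  It contains both the
  derivation \<open>second_power A\<close> (with \<open>Q\<close> the identity) and the compound matrix (half of the case
  \<open>P = Q\<close>), so that one product formula serves all.\<close>

definition polar_wedge :: "real^'n^'n \<Rightarrow> real^'n^'n \<Rightarrow> 'n \<times> 'n \<Rightarrow> 'n \<times> 'n \<Rightarrow> real" where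
  "polar_wedge P Q = (\<lambda>(i,j) (k,l).
     P $ i $ k * Q $ j $ l + Q $ i $ k * P $ j $ l - P $ i $ l * Q $ j $ k - Q $ i $ l * P $ j $ k)"

text \<open>Both factors are antisymmetric in the summation pair, so the sum over increasing pairs is half of
  the sum over all pairs, which factors into entries of matrix products.\<close>

lemma polar_wedge_mult:
  fixes P Q R S :: "real^'n::{finite,linorder}^'n::{finite,linorder}"
  shows "(\<Sum>r\<in>increasing_pairs. polar_wedge P Q p r * polar_wedge R S r q) =
    polar_wedge (P ** R) (Q ** S) p q + polar_wedge (P ** S) (Q ** R) p q"
proof -
  obtain i j m n where pq: "p = (i,j)" "q = (m,n)" by (cases p; cases q)
  let ?f = "\<lambda>k l. polar_wedge P Q p (k,l) * polar_wedge R S (k,l) q"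
  have "(\<Sum>k\<in>UNIV. \<Sum>l\<in>UNIV. ?f k l) = 2 * (\<Sum>(k,l)\<in>increasing_pairs. ?f k l) + (\<Sum>k\<in>UNIV. ?f k k)"
    by (rule sum_increasing_pairs) (simp add: polar_wedge_def pq algebra_simps)
  also have "(\<Sum>k\<in>UNIV. ?f k k) = 0"
    by (simp add: polar_wedge_def pq)
  finally have "2 * (\<Sum>(k,l)\<in>increasing_pairs. ?f k l) = (\<Sum>k\<in>UNIV. \<Sum>l\<in>UNIV. ?f k l)" by simp
  also have "\<dots> = (\<Sum>k\<in>UNIV. \<Sum>l\<in>UNIV.
        (P $ i $ k * Q $ j $ l * (R $ k $ m * S $ l $ n)
        + P $ i $ k * Q $ j $ l * (S $ k $ m * R $ l $ n)
        + Q $ i $ k * P $ j $ l * (R $ k $ m * S $ l $ n)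
        + Q $ i $ k * P $ j $ l * (S $ k $ m * R $ l $ n)
        + Q $ j $ k * P $ i $ l * (R $ k $ n * S $ l $ m)
        + Q $ j $ k * P $ i $ l * (S $ k $ n * R $ l $ m)
        + P $ j $ k * Q $ i $ l * (R $ k $ n * S $ l $ m)
        + P $ j $ k * Q $ i $ l * (S $ k $ n * R $ l $ m))
        - (P $ i $ k * Q $ j $ l * (R $ k $ n * S $ l $ m)
        + P $ i $ k * Q $ j $ l * (S $ k $ n * R $ l $ m)
        + Q $ i $ k * P $ j $ l * (R $ k $ n * S $ l $ m)
        + Q $ i $ k * P $ j $ l * (S $ k $ n * R $ l $ m)
        + Q $ j $ k * P $ i $ l * (R $ k $ m * S $ l $ n)
        + Q $ j $ k * P $ i $ l * (S $ k $ m * R $ l $ n)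
        + P $ j $ k * Q $ i $ l * (R $ k $ m * S $ l $ n)
        + P $ j $ k * Q $ i $ l * (S $ k $ m * R $ l $ n)))"
    by (intro sum.cong refl) (simp add: polar_wedge_def pq algebra_simps)
  also have "\<dots> = 2 * (polar_wedge (P ** R) (Q ** S) p q + polar_wedge (P ** S) (Q ** R) p q)"
  proof -
    have h: "(\<Sum>k\<in>UNIV. \<Sum>l\<in>UNIV. a k * b l * (c k * d l)) = (\<Sum>k\<in>UNIV. a k * c k) * (\<Sum>l\<in>UNIV. b l * d l)"
      for a b c d :: "'n \<Rightarrow> real"
      by (simp add: sum_product mult_ac)
    show ?thesis
      unfolding sum.distrib sum_subtractf h
      by (simp add: polar_wedge_def pq matrix_matrix_mult_def algebra_simps)
  qed
  finally show ?thesis by (simp add: case_prod_unfold)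
qed

lemma second_power_eq_polar_wedge: "second_power (\<lambda>i j. A $ i $ j) = polar_wedge A (mat 1)"
  by (auto simp: second_power_def polar_wedge_def mat_def fun_eq_iff)

text \<open>The compound matrix of \<open>P\<close>, here \<open>W P\<close>, is multiplicative in \<open>P\<close> and therefore invertible, and it
  intertwines the additive compounds of \<open>A\<close> and \<open>B\<close>.\<close>

lemma det_second_power_similar:
  fixes A B P :: "real^'n::{finite,linorder}^'n::{finite,linorder}"
  assumes "P ** A = B ** P" "det P \<noteq> 0"
  shows "det_on increasing_pairs (second_power (\<lambda>i j. A $ i $ j)) =
    det_on increasing_pairs (second_power (\<lambda>i j. B $ i $ j))"
proof -
  let ?I = "increasing_pairs :: ('n \<times> 'n) set"
  define W where "W P = padded ?I (\<lambda>p q. polar_wedge P P p q / 2)" for P :: "real^'n::{finite,linorder}^'n::{finite,linorder}"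
  have swap: "polar_wedge X Y p q = polar_wedge Y X p q" for X Y :: "real^'n::{finite,linorder}^'n::{finite,linorder}" and p q
    by (simp add: polar_wedge_def case_prod_unfold)
  have WW: "W P ** W Q = W (P ** Q)" for P Q
    unfolding W_def padded_mult by (simp add: polar_wedge_mult sum_divide_distrib[symmetric])
  have "polar_wedge (mat 1) (mat 1) p q / 2 = of_bool (p = q)" if "p \<in> ?I" "q \<in> ?I" for p q
    using that by (auto simp: polar_wedge_def mat_def increasing_pairs_def split: if_splits)
  then have "W (mat 1) = padded ?I (\<lambda>p q. of_bool (p = q))"
    by (simp add: W_def padded_def vec_eq_iff)
  then have W1: "W (mat 1) = mat 1" by (simp add: padded_identity)
  have "det (W P) * det (W (matrix_inv P)) = 1"
    using WW[of P "matrix_inv P"] by (metis W1 assms(2) det_I det_mul matrix_inv_mult(1))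
  then have WP: "det (W P) \<noteq> 0" by auto
  have "W P ** padded ?I (second_power (\<lambda>i j. A $ i $ j)) = padded ?I (polar_wedge (P ** A) P)"
    unfolding W_def padded_mult second_power_eq_polar_wedge
    by (simp add: polar_wedge_mult sum_divide_distrib[symmetric] swap[of P "P ** A"])
  moreover have "padded ?I (second_power (\<lambda>i j. B $ i $ j)) ** W P = padded ?I (polar_wedge (B ** P) P)"
    unfolding W_def padded_mult second_power_eq_polar_wedge
    by (simp add: polar_wedge_mult sum_divide_distrib[symmetric])
  ultimately have "W P ** padded ?I (second_power (\<lambda>i j. A $ i $ j)) =
      padded ?I (second_power (\<lambda>i j. B $ i $ j)) ** W P"
    using assms(1) by simp
  then have "det (W P) * det_on ?I (second_power (\<lambda>i j. A $ i $ j)) =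
      det_on ?I (second_power (\<lambda>i j. B $ i $ j)) * det (W P)"
    by (metis det_mul det_padded)
  then show ?thesis using WP by simp
qed

lemma second_power_diagonal:
  fixes s :: "'n::{finite,linorder} \<Rightarrow> real"
  assumes "\<And>i j. a i j = (if i = j then s i else 0)" "p \<in> increasing_pairs" "q \<in> increasing_pairs"
  shows "second_power a p q = (if p = q then s (fst p) + s (snd p) else 0)"
  using assms(2,3) by (cases p; cases q) (auto simp: second_power_def increasing_pairs_def assms(1))

lemma det_second_power_diagonal:
  fixes s :: "'n::{finite,linorder} \<Rightarrow> real"
  assumes "\<And>i j. a i j = (if i = j then s i else 0)"
  shows "det_on increasing_pairs (second_power a) = (\<Prod>p\<in>increasing_pairs. s (fst p) + s (snd p))"
proof -
  let ?I = "increasing_pairs :: ('n \<times> 'n) set"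
  have nth: "padded ?I (second_power a) $ p $ q = (if p = q then (if p \<in> ?I then s (fst p) + s (snd p) else 1) else 0)" for p q
    by (simp add: padded_def second_power_diagonal[OF assms])
  have "det (padded ?I (second_power a)) = (\<Prod>p\<in>UNIV. padded ?I (second_power a) $ p $ p)"
    by (rule det_diagonal) (simp add: nth)
  also have "\<dots> = (\<Prod>p\<in>?I. s (fst p) + s (snd p))"
    unfolding nth by (simp add: prod.If_cases)
  finally show ?thesis by (simp add: det_padded)
qed

section \<open>The matrix of \<open>S\<close>\<close>

text \<open>With \<open>M\<close> the Hessian, the form \<open>S\<close> has the matrix \<open>M\<close> in the coordinates of the base and the metric
  has the matrix \<open>1 + M\<^sup>2\<close>; their quotient is \<open>S\<close> as an endomorphism of the tangent space.\<close>

definition S_matrix :: "real^'n^'n \<Rightarrow> real^'n^'n" where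
  "S_matrix M = M ** matrix_inv (mat 1 + M ** M)"

lemma det_one_plus_square:
  fixes M :: "real^'n^'n"
  assumes "transpose M = M"
  shows "det (mat 1 + M ** M) > 0"
proof -
  obtain r l where "eigenbasis M r l" using symmetric_eigenbasis[OF assms] .
  from eigenvalues_det_square[OF eigenvalues_eigenbasis[OF this]] show ?thesis
    by (simp add: prod_pos add_pos_nonneg)
qed

lemma S_matrix_mult:
  assumes "det (mat 1 + M ** M) \<noteq> 0"
  shows "S_matrix M ** (mat 1 + M ** M) = M"
  using matrix_inv_mult[OF assms] by (simp add: S_matrix_def matrix_mul_assoc[symmetric])

lemma S_matrix_unique:
  assumes "det (mat 1 + M ** M) \<noteq> 0" "A ** (mat 1 + M ** M) = M"
  shows "A = S_matrix M"
proof -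
  have "A ** (mat 1 + M ** M) ** matrix_inv (mat 1 + M ** M) = S_matrix M"
    by (simp add: assms(2) S_matrix_def)
  then show ?thesis by (simp add: matrix_mul_assoc[symmetric] matrix_inv_mult[OF assms(1)])
qed

lemma matrix_add_rdistrib: "(A + B) ** C = A ** C + B ** (C :: 'k::semiring_1^'n^'m)"
  by (simp add: vec_eq_iff matrix_matrix_mult_def sum.distrib distrib_right)

lemma S_matrix_similar:
  fixes M P Q :: "real^'n^'n"
  assumes "P ** Q = mat 1" "Q ** P = mat 1" and d: "det (mat 1 + M ** M) \<noteq> 0"
  shows "S_matrix (P ** M ** Q) = P ** S_matrix M ** Q"
proof -
  have 1: "mat 1 + (P ** M ** Q) ** (P ** M ** Q) = P ** (mat 1 + M ** M) ** Q"
  proof -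
    have "(P ** M ** Q) ** (P ** M ** Q) = P ** M ** (Q ** P) ** M ** Q" by (simp only: matrix_mul_assoc)
    then show ?thesis
      by (simp add: assms matrix_add_ldistrib matrix_add_rdistrib matrix_mul_assoc)
  qed
  have "det P * det Q = 1" using assms(1) by (metis det_I det_mul)
  then have d': "det (mat 1 + (P ** M ** Q) ** (P ** M ** Q)) \<noteq> 0"
    unfolding 1 by (auto simp: det_mul d)
  have "P ** S_matrix M ** Q ** (P ** (mat 1 + M ** M) ** Q) = P ** (S_matrix M ** (Q ** P) ** (mat 1 + M ** M)) ** Q"
    by (simp only: matrix_mul_assoc)
  also have "\<dots> = P ** M ** Q" by (simp only: assms matrix_mul_rid S_matrix_mult[OF d])
  finally show ?thesis using S_matrix_unique[OF d'] by (simp only: 1)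
qed

lemma S_matrix_diagonal:
  fixes M :: "real^'n^'n"
  assumes "\<And>i j. M $ i $ j = (if i = j then l i else 0)"
  shows "S_matrix M $ i $ j = (if i = j then l i / (1 + (l i)\<^sup>2) else 0)"
proof -
  have sq: "(mat 1 + M ** M) $ i $ j = (if i = j then 1 + (l i)\<^sup>2 else 0)" for i j
    by (simp add: mat_def matrix_matrix_mult_def assms power2_eq_square sum_diagonal_left)
  have nz: "1 + x\<^sup>2 \<noteq> 0" for x :: real
    by (metis add_pos_nonneg less_irrefl zero_le_power2 zero_less_one)
  have "det (mat 1 + M ** M) = (\<Prod>i\<in>UNIV. (mat 1 + M ** M) $ i $ i)"
    by (rule det_diagonal) (simp only: sq if_False)
  also have "\<dots> \<noteq> 0" by (simp add: sq nz del: vector_add_component)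
  finally have d: "det (mat 1 + M ** M) \<noteq> 0" .
  have "((\<chi> i j. if i = j then l i / (1 + (l i)\<^sup>2) else 0) ** (mat 1 + M ** M)) $ i $ j = M $ i $ j" for i j
    unfolding matrix_matrix_mult_def[of "\<chi> i j. if i = j then l i / (1 + (l i)\<^sup>2) else 0"]
    by (simp add: sq assms nz sum_diagonal_left del: vector_add_component)
  then have "S_matrix M = (\<chi> i j. if i = j then l i / (1 + (l i)\<^sup>2) else 0)"
    by (intro S_matrix_unique[OF d, symmetric]) (simp add: vec_eq_iff)
  then show ?thesis by simp
qed

text \<open>A matrix \<open>E\<close> of an orthonormal frame satisfies \<open>E E\<^sup>T = (1 + M\<^sup>2)\<^sup>-\<^sup>1\<close>, so it
  conjugates \<open>S_matrix M\<close> to the matrix of \<open>S\<close> in that frame.\<close>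

lemma det_S2_eq:
  fixes v :: "real^'n::{finite,linorder} \<Rightarrow> real"
  assumes D: "(gradient_graph v has_derivative (\<lambda>w. (w, M *v w))) (at y)" and M: "transpose M = M"
  shows "det_S2 v y = det_on increasing_pairs (second_power (\<lambda>i j. S_matrix M $ i $ j))"
proof -
  have D': "frechet_derivative (gradient_graph v) (at y) = (\<lambda>w. (w, M *v w))"
    using frechet_derivative_at[OF D] by simp
  have sa: "x \<bullet> (M *v y) = (M *v x) \<bullet> y" for x y
    by (metis M dot_lmul_matrix transpose_matrix_vector)
  define e where "e = (SOME e. orthonormal_frame (gradient_graph v) y e)"
  \<comment> \<open>the normalised lifts of an eigenbasis of \<open>M\<close> form an orthonormal frame\<close>
  have "\<exists>e. orthonormal_frame (gradient_graph v) y e"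
  proof -
    obtain r l where r: "eigenbasis M r l" using symmetric_eigenbasis[OF M] .
    have "orthonormal_frame (gradient_graph v) y (\<lambda>a. (1 / sqrt (1 + (l a)\<^sup>2)) *\<^sub>R (r a, M *v r a))"
      unfolding orthonormal_frame_def D'
    proof (intro conjI allI)
      show "(1 / sqrt (1 + (l a)\<^sup>2)) *\<^sub>R (r a, M *v r a) \<in> range (\<lambda>w. (w, M *v w))" for a
        by (rule range_eqI[of _ _ "(1 / sqrt (1 + (l a)\<^sup>2)) *\<^sub>R r a"])
          (simp add: linear_cmul[OF matrix_vector_mul_linear])
      have "(1 + l b * l b) = sqrt (1 + (l b)\<^sup>2) * sqrt (1 + (l b)\<^sup>2)" for b
        by (simp add: power2_eq_square)
      then show "(1 / sqrt (1 + (l a)\<^sup>2)) *\<^sub>R (r a, M *v r a) \<bullet> (1 / sqrt (1 + (l b)\<^sup>2)) *\<^sub>R (r b, M *v r b)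
        = (if a = b then 1 else 0)" for a b
        using r by (auto simp: eigenbasis_def power2_eq_square add_nonneg_eq_0_iff add_divide_distrib[symmetric])
    qed
    then show ?thesis by blast
  qed
  then have e: "orthonormal_frame (gradient_graph v) y e" unfolding e_def by (rule someI_ex)
  then have "\<And>i. \<exists>w. e i = (w, M *v w)" unfolding orthonormal_frame_def D' by blast
  then obtain w where w: "\<And>i. e i = (w i, M *v w i)" by metis
  let ?E = "column_matrix w"
  have SE: "S_tensor (e i) (e j) = (transpose ?E ** M ** ?E) $ i $ j" for i j
    by (simp add: S_tensor_def complex_structure_def proj1_def proj2_def w congruence_nth)
  have "(transpose ?E ** (mat 1 + M ** M) ** ?E) $ i $ j = mat 1 $ i $ j" for i j
  proof -
    have "e i \<bullet> e j = (if i = j then 1 else 0)" using e by (simp add: orthonormal_frame_def)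
    then show ?thesis
      unfolding congruence_nth
      by (simp add: w matrix_vector_mult_add_rdistrib matrix_vector_mul_assoc[symmetric] inner_add_right sa)
        (simp add: mat_def)
  qed
  then have "transpose ?E ** (mat 1 + M ** M) ** ?E = mat 1" by (simp add: vec_eq_iff)
  then have EE: "?E ** transpose ?E ** (mat 1 + M ** M) = mat 1"
    using matrix_left_right_inverse by (metis matrix_mul_assoc)
  have dE: "det ?E \<noteq> 0"
    using arg_cong[OF EE, of det] by (auto simp: det_mul)
  have d: "det (mat 1 + M ** M) \<noteq> 0" using det_one_plus_square[OF M] by simp
  have comm: "M ** (mat 1 + M ** M) = (mat 1 + M ** M) ** M"
    by (simp add: matrix_add_ldistrib matrix_add_rdistrib matrix_mul_assoc)
  have "?E ** transpose ?E ** M = S_matrix M"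
  proof (rule S_matrix_unique[OF d])
    have "?E ** transpose ?E ** M ** (mat 1 + M ** M) = ?E ** transpose ?E ** (M ** (mat 1 + M ** M))"
      by (simp only: matrix_mul_assoc)
    also have "\<dots> = M" unfolding comm by (simp only: matrix_mul_assoc EE matrix_mul_lid)
    finally show "?E ** transpose ?E ** M ** (mat 1 + M ** M) = M" .
  qed
  then have "?E ** (transpose ?E ** M ** ?E) = S_matrix M ** ?E"
    by (simp only: matrix_mul_assoc)
  from det_second_power_similar[OF this dE] show ?thesis
    by (simp add: det_S2_def Let_def e_def[symmetric] SE)
qed

lemma det_second_power_S_matrix_similar:
  fixes M P Q :: "real^'n::{finite,linorder}^'n::{finite,linorder}"
  assumes "P ** Q = mat 1" "Q ** P = mat 1" and d: "det (mat 1 + M ** M) \<noteq> 0"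
  shows "det_on increasing_pairs (second_power (\<lambda>i j. S_matrix (P ** M ** Q) $ i $ j)) =
    det_on increasing_pairs (second_power (\<lambda>i j. S_matrix M $ i $ j))"
proof -
  have "Q ** S_matrix (P ** M ** Q) = (Q ** P) ** S_matrix M ** Q"
    unfolding S_matrix_similar[OF assms] by (simp only: matrix_mul_assoc)
  then have *: "Q ** S_matrix (P ** M ** Q) = S_matrix M ** Q" by (simp add: assms)
  have "det Q \<noteq> 0" using assms(1) by (metis det_I det_mul mult_zero_right zero_neq_one)
  from det_second_power_similar[OF * this] show ?thesis .
qed

lemma S_sum_pos:
  fixes x y :: real
  assumes "x + y > 0" "1 + x * y > 0"
  shows "x / (1 + x\<^sup>2) + y / (1 + y\<^sup>2) > 0"
proof -
  have "x / (1 + x\<^sup>2) + y / (1 + y\<^sup>2) = (x + y) * (1 + x * y) / ((1 + x\<^sup>2) * (1 + y\<^sup>2))"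
  proof -
    have "1 + x\<^sup>2 \<noteq> 0" "1 + y\<^sup>2 \<noteq> 0"
      by (metis add_pos_nonneg less_irrefl zero_le_power2 zero_less_one)+
    then show ?thesis by (simp add: add_frac_eq) (simp add: power2_eq_square algebra_simps)
  qed
  then show ?thesis using assms by (simp add: add_pos_nonneg)
qed

text \<open>In an eigenbasis the determinant is the product of the sums \<open>s\<^sub>i + s\<^sub>j\<close>, and \<open>s\<^sub>i + s\<^sub>j\<close> is
  \<open>(\<lambda>\<^sub>i + \<lambda>\<^sub>j)(1 + \<lambda>\<^sub>i\<lambda>\<^sub>j)\<close> divided by a positive number.\<close>

lemma det_second_power_S_matrix_pos:
  fixes M :: "real^'n::{finite,linorder}^'n::{finite,linorder}"
  assumes M: "transpose M = M" and "eigenvalues M l"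
    and convex: "\<And>i j. i \<noteq> j \<Longrightarrow> l i + l j > 0 \<and> 1 + l i * l j > 0"
  shows "det_on increasing_pairs (second_power (\<lambda>i j. S_matrix M $ i $ j)) > 0"
proof -
  obtain r k where r: "eigenbasis M r k" using symmetric_eigenbasis[OF M] .
  let ?R = "column_matrix r"
  have ort: "r a \<bullet> r b = (if a = b then 1 else 0)" for a b using r by (simp add: eigenbasis_def)
  have d: "det (mat 1 + M ** M) \<noteq> 0" using det_one_plus_square[OF M] by simp
  have diag: "(transpose ?R ** M ** ?R) $ i $ j = (if i = j then k i else 0)" for i j
    unfolding congruence_nth using r by (simp add: eigenbasis_def)
  have "k i + k j > 0 \<and> 1 + k i * k j > 0" if "i \<noteq> j" for i j
    by (rule eigenvalues_pairwise[OF assms(2) eigenvalues_eigenbasis[OF r], of "\<lambda>x y. x + y > 0 \<and> 1 + x * y > 0"])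
      (use convex that in auto)
  then have "(\<Prod>p\<in>increasing_pairs. k (fst p) / (1 + (k (fst p))\<^sup>2) + k (snd p) / (1 + (k (snd p))\<^sup>2)) > 0"
    by (intro prod_pos S_sum_pos ballI) (auto simp: increasing_pairs_def)
  then show ?thesis
    unfolding det_second_power_S_matrix_similar[OF orthonormal_column_matrix[OF ort] d, symmetric]
    by (subst det_second_power_diagonal[OF S_matrix_diagonal[OF diag]])
qed

section \<open>The pointwise inequality\<close>

text \<open>For \<open>x = tan \<alpha>\<close> and \<open>y = tan \<beta>\<close> these are \<open>sin\<^sup>2 2\<alpha> + cos\<^sup>2 2\<alpha> = 1\<close> and
  \<open>sin 2\<alpha> sin 2\<beta> + cos\<^sup>2 (\<alpha> + \<beta>) = cos\<^sup>2 (\<alpha> - \<beta>)\<close>.\<close>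

lemma slope_identities:
  fixes x y :: real
  shows "4 * (x / (1 + x\<^sup>2))\<^sup>2 + ((1 - x\<^sup>2) / (1 + x\<^sup>2))\<^sup>2 = 1"
    and "4 * (x / (1 + x\<^sup>2)) * (y / (1 + y\<^sup>2)) + (1 - x * y)\<^sup>2 / ((1 + x\<^sup>2) * (1 + y\<^sup>2))
      = (1 + x * y)\<^sup>2 / ((1 + x\<^sup>2) * (1 + y\<^sup>2))"
proof -
  have nz: "1 + z\<^sup>2 \<noteq> 0" for z :: real
    by (metis add_pos_nonneg less_irrefl zero_le_power2 zero_less_one)
  show "4 * (x / (1 + x\<^sup>2))\<^sup>2 + ((1 - x\<^sup>2) / (1 + x\<^sup>2))\<^sup>2 = 1"
    using nz[of x] by (simp add: power_divide add_divide_distrib[symmetric]) (simp add: power2_eq_square algebra_simps)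
  show "4 * (x / (1 + x\<^sup>2)) * (y / (1 + y\<^sup>2)) + (1 - x * y)\<^sup>2 / ((1 + x\<^sup>2) * (1 + y\<^sup>2))
      = (1 + x * y)\<^sup>2 / ((1 + x\<^sup>2) * (1 + y\<^sup>2))"
    by (simp add: add_divide_distrib[symmetric]) (simp add: power2_eq_square algebra_simps)
qed

text \<open>The contribution of \<open>h\<^sub>c\<^sub>k\<^sub>l\<^sup>2\<close> with a third index \<open>m\<close>, where \<open>C = cos\<^sup>2 (\<alpha>\<^sub>k + \<alpha>\<^sub>l)\<close> and
  \<open>D = cos\<^sup>2 (\<alpha>\<^sub>k - \<alpha>\<^sub>l)\<close>.  After clearing denominators it is \<open>D + 2 sm (sk + sl)\<close>, which settles
  \<open>sm \<ge> 0\<close>; if \<open>sm < 0\<close> then \<open>sk\<close> and \<open>sl\<close> exceed \<open>- sm > 0\<close> and the products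
  \<open>sk (sl + sm)\<close>, \<open>sl (sk + sm)\<close> of the original sum are positive.\<close>

lemma off_diagonal_term_nonneg:
  fixes sk sl sm C D :: real
  assumes pos: "sk + sl > 0" "sk + sm > 0" "sl + sm > 0"
    and C: "C \<ge> 0" "4 * sk * sl + C = D" "D \<ge> 0"
  shows "2 * (sk / (sk + sm) + sl / (sl + sm)) + C / ((sk + sm) * (sl + sm)) \<ge> 0"
proof -
  have "2 * (sk * (sl + sm) + sl * (sk + sm)) + C \<ge> 0"
  proof (cases "sm \<ge> 0")
    case True
    then have "sm * (sk + sl) \<ge> 0" using pos by simp
    then show ?thesis using C by (simp add: algebra_simps)
  next
    case False
    then have "sk * (sl + sm) \<ge> 0" "sl * (sk + sm) \<ge> 0" using pos by simp_all
    then show ?thesis using C by simp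
  qed
  moreover have "2 * (sk / (sk + sm) + sl / (sl + sm)) + C / ((sk + sm) * (sl + sm)) =
    (2 * (sk * (sl + sm) + sl * (sk + sm)) + C) / ((sk + sm) * (sl + sm))"
  proof -
    have "2 * (sk / A + sl / B) + C / (A * B) = (2 * (sk * B + sl * A) + C) / (A * B)"
      if "A \<noteq> 0" "B \<noteq> 0" for A B
      using that by (simp add: field_simps)
    then show ?thesis using pos by simp
  qed
  ultimately show ?thesis using pos by simp
qed

text \<open>The difference of the two sides is \<open>(cm x + ck y)\<^sup>2 / (2 (sk + sm)\<^sup>2)\<close>.\<close>

lemma diagonal_term_bound:
  fixes sk sm ck cm x y :: real
  assumes pos: "sk + sm > 0" and k: "4 * sk\<^sup>2 + ck\<^sup>2 = 1" and m: "4 * sm\<^sup>2 + cm\<^sup>2 = 1"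
  shows "2 * (x\<^sup>2 + y\<^sup>2) \<le> 4 * (sk * x\<^sup>2 + sm * y\<^sup>2) / (sk + sm) + (ck * x + cm * y)\<^sup>2 / (2 * (sk + sm)\<^sup>2)"
proof -
  have "4 * (sk * x\<^sup>2 + sm * y\<^sup>2) / (sk + sm) + (ck * x + cm * y)\<^sup>2 / (2 * (sk + sm)\<^sup>2) - 2 * (x\<^sup>2 + y\<^sup>2)
    = (4 * (sk\<^sup>2 - sm\<^sup>2) * (x\<^sup>2 - y\<^sup>2) + (ck * x + cm * y)\<^sup>2) / (2 * (sk + sm)\<^sup>2)"
  proof -
    have key: "4 * P / D + R / (2 * D\<^sup>2) - E = (8 * P * D + R - 2 * D\<^sup>2 * E) / (2 * D\<^sup>2)" if "D \<noteq> 0" for P R D E :: real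
      using that by (simp add: field_simps power2_eq_square)
    have "4 * (sk * x\<^sup>2 + sm * y\<^sup>2) / (sk + sm) + (ck * x + cm * y)\<^sup>2 / (2 * (sk + sm)\<^sup>2) - 2 * (x\<^sup>2 + y\<^sup>2)
      = (8 * (sk * x\<^sup>2 + sm * y\<^sup>2) * (sk + sm) + (ck * x + cm * y)\<^sup>2 - 2 * (sk + sm)\<^sup>2 * (2 * (x\<^sup>2 + y\<^sup>2))) / (2 * (sk + sm)\<^sup>2)"
      by (rule key) (use pos in simp)
    also have "8 * (sk * x\<^sup>2 + sm * y\<^sup>2) * (sk + sm) + (ck * x + cm * y)\<^sup>2 - 2 * (sk + sm)\<^sup>2 * (2 * (x\<^sup>2 + y\<^sup>2))
      = 4 * (sk\<^sup>2 - sm\<^sup>2) * (x\<^sup>2 - y\<^sup>2) + (ck * x + cm * y)\<^sup>2"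
      by (simp add: power2_eq_square algebra_simps)
    finally show ?thesis .
  qed
  also have "4 * (sk\<^sup>2 - sm\<^sup>2) = cm\<^sup>2 - ck\<^sup>2" using k m by simp
  also have "(cm\<^sup>2 - ck\<^sup>2) * (x\<^sup>2 - y\<^sup>2) + (ck * x + cm * y)\<^sup>2 = (cm * x + ck * y)\<^sup>2"
    by (simp add: power2_eq_square algebra_simps)
  finally show ?thesis by (smt (verit) divide_nonneg_nonneg zero_le_power2)
qed

lemma second_power_symmetric:
  assumes "\<And>i j. X i j = X j i"
  shows "second_power X p r = second_power X r p"
  by (cases p; cases r) (auto simp: second_power_def assms of_bool_def)

lemma card_increasing_pairs:
  "2 * card (increasing_pairs :: ('n::{finite,linorder} \<times> 'n) set) = CARD('n) * (CARD('n) - 1)"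
proof -
  have "real CARD('n) * real CARD('n) = 2 * real (card (increasing_pairs :: ('n \<times> 'n) set)) + real CARD('n)"
    using sum_increasing_pairs[of "\<lambda>k l::'n. 1"] by (simp add: case_prod_unfold)
  then have "real (CARD('n) * CARD('n)) = real (2 * card (increasing_pairs :: ('n \<times> 'n) set) + CARD('n))"
    by simp
  then have "CARD('n) * CARD('n) = 2 * card (increasing_pairs :: ('n \<times> 'n) set) + CARD('n)"
    by (simp only: of_nat_eq_iff)
  then show ?thesis by (simp add: diff_mult_distrib2)
qed

lemma sum_squares_ge_square_sum:
  fixes a :: "'a \<Rightarrow> real"
  assumes "finite I"
  shows "(\<Sum>p\<in>I. a p)\<^sup>2 \<le> real (card I) * (\<Sum>p\<in>I. (a p)\<^sup>2)"
  using Cauchy_Schwarz_ineq_sum[of "\<lambda>_. 1" a I] by simp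

definition distinct_triples :: "('n \<times> 'n \<times> 'n) set" where
  "distinct_triples = {(k,l,m). k \<noteq> l \<and> k \<noteq> m \<and> l \<noteq> m}"

text \<open>Off the diagonal, the entry of \<open>second_power X\<close> at the pairs \<open>{k,m}\<close> and \<open>{l,m}\<close> is
  \<open>X k l\<close> up to sign.\<close>

lemma sum_second_power_squares:
  fixes X :: "'n::{finite,linorder} \<Rightarrow> 'n \<Rightarrow> real" and s :: "'n \<Rightarrow> real"
  assumes X: "\<And>i j. X i j = X j i" and s: "\<And>i j. i \<noteq> j \<Longrightarrow> s i + s j > 0"
  defines "b \<equiv> \<lambda>p. s (fst p) + s (snd p)"
  shows "(\<Sum>p\<in>increasing_pairs. (second_power X p p / b p)\<^sup>2) +
    (\<Sum>(k,l,m)\<in>distinct_triples. (X k l)\<^sup>2 / ((s k + s m) * (s l + s m)))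
    \<le> (\<Sum>p\<in>increasing_pairs. \<Sum>r\<in>increasing_pairs. second_power X p r * second_power X r p / (b p * b r))"
proof -
  let ?I = "increasing_pairs :: ('n \<times> 'n) set"
  let ?D = "distinct_triples :: ('n \<times> 'n \<times> 'n) set"
  define g where "g = (\<lambda>(p,r). (second_power X p r)\<^sup>2 / (b p * b r))"
  define pr where "pr k m = (if k < m then (k,m) else (m,k))" for k m :: 'n
  define h where "h = (\<lambda>(k,l,m). (pr k m, pr l m))"
  have bpos: "b p > 0" if "p \<in> ?I" for p using that s by (auto simp: b_def increasing_pairs_def)
  have g0: "g z \<ge> 0" if "z \<in> ?I \<times> ?I" for z
    using that bpos[of "fst z"] bpos[of "snd z"]
    by (simp add: g_def case_prod_unfold mem_Times_iff divide_nonneg_pos)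
  have "(\<Sum>p\<in>?I. \<Sum>r\<in>?I. second_power X p r * second_power X r p / (b p * b r)) = (\<Sum>z\<in>?I \<times> ?I. g z)"
    using second_power_symmetric[of X, OF X]
    by (simp add: g_def sum.cartesian_product power2_eq_square case_prod_unfold)
  moreover have "(\<Sum>p\<in>?I. (second_power X p p / b p)\<^sup>2) = (\<Sum>z\<in>(\<lambda>p. (p,p)) ` ?I. g z)"
    by (subst sum.reindex) (auto simp: inj_on_def g_def power_divide power2_eq_square)
  moreover have "(\<Sum>(k,l,m)\<in>?D. (X k l)\<^sup>2 / ((s k + s m) * (s l + s m))) = (\<Sum>z\<in>h ` ?D. g z)"
  proof -
    have "inj_on h ?D"
      by (rule inj_onI) (auto simp: h_def pr_def distinct_triples_def split: if_splits)
    moreover have "g (h z) = (case z of (k,l,m) \<Rightarrow> (X k l)\<^sup>2 / ((s k + s m) * (s l + s m)))" if z: "z \<in> ?D" for z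
    proof -
      obtain k l m where klm: "z = (k,l,m)" "k \<noteq> l" "k \<noteq> m" "l \<noteq> m"
        using z by (auto simp: distinct_triples_def)
      have "(second_power X (pr k m) (pr l m))\<^sup>2 = (X k l)\<^sup>2"
        using klm X by (auto simp: pr_def second_power_def)
      moreover have "b (pr k m) = s k + s m" "b (pr l m) = s l + s m"
        by (auto simp: pr_def b_def)
      ultimately show ?thesis by (simp add: g_def h_def klm(1))
    qed
    ultimately show ?thesis by (simp add: sum.reindex)
  qed
  moreover have "(\<Sum>z\<in>(\<lambda>p. (p,p)) ` ?I. g z) + (\<Sum>z\<in>h ` ?D. g z) \<le> (\<Sum>z\<in>?I \<times> ?I. g z)"
  proof -
    have hD: "h ` ?D \<subseteq> ?I \<times> ?I"
      by (auto simp: h_def pr_def distinct_triples_def increasing_pairs_def split: if_splits)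
    have "(\<lambda>p. (p,p)) ` ?I \<inter> h ` ?D = {}"
      by (auto simp: h_def pr_def distinct_triples_def split: if_splits)
    then have "(\<Sum>z\<in>(\<lambda>p. (p,p)) ` ?I. g z) + (\<Sum>z\<in>h ` ?D. g z) = (\<Sum>z\<in>(\<lambda>p. (p,p)) ` ?I \<union> h ` ?D. g z)"
      by (intro sum.union_disjoint[symmetric]) simp_all
    also have "\<dots> \<le> (\<Sum>z\<in>?I \<times> ?I. g z)"
      using hD by (intro sum_mono2) (auto intro: g0)
    finally show ?thesis .
  qed
  ultimately show ?thesis by simp
qed

text \<open>The terms \<open>t k l\<close> with \<open>k \<noteq> l\<close> enter the pairs \<open>{k,l}\<close>, where the two weights add up to
  one, and the pairs \<open>{k,m}\<close>, \<open>{l,m}\<close> with a third index \<open>m\<close>.\<close>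

lemma sum_weighted_rows:
  fixes t :: "'n::{finite,linorder} \<Rightarrow> 'n \<Rightarrow> real" and s :: "'n \<Rightarrow> real"
  assumes t: "\<And>i j. t i j = t j i" and s: "\<And>i j. i \<noteq> j \<Longrightarrow> s i + s j > 0"
  shows "(\<Sum>(k,m)\<in>increasing_pairs. 4 * (s k * (\<Sum>l\<in>UNIV. t k l) + s m * (\<Sum>l\<in>UNIV. t m l)) / (s k + s m)) =
    (\<Sum>(k,m)\<in>increasing_pairs. 4 * (s k * t k k + s m * t m m) / (s k + s m)) +
    2 * ((\<Sum>k\<in>UNIV. \<Sum>l\<in>UNIV. t k l) - (\<Sum>k\<in>UNIV. t k k)) +
    (\<Sum>(k,l,m)\<in>distinct_triples. 2 * t k l * (s k / (s k + s m) + s l / (s l + s m)))"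
proof -
  let ?I = "increasing_pairs :: ('n \<times> 'n) set"
  define a where "a k = (\<Sum>l\<in>UNIV. if k \<noteq> l then t k l else 0)" for k
  define w where "w k m = (if k \<noteq> m then s k / (s k + s m) else 0)" for k m
  have row: "(\<Sum>l\<in>UNIV. t k l) = t k k + a k" for k
  proof -
    have "(\<Sum>l\<in>UNIV. t k l) = (\<Sum>l\<in>UNIV. (if l = k then t k k else 0) + (if k \<noteq> l then t k l else 0))"
      by (intro sum.cong) auto
    then show ?thesis by (simp add: sum.distrib a_def)
  qed
  have w1: "w k l + w l k = 1" if "k \<noteq> l" for k l
    using s[OF that] that by (auto simp: w_def add.commute[of "s l"] add_divide_distrib[symmetric])
  have "2 * (\<Sum>(k,m)\<in>?I. 4 * (s k * a k + s m * a m) / (s k + s m)) =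
     (\<Sum>k\<in>UNIV. \<Sum>m\<in>UNIV. 4 * (w k m * a k + w m k * a m))"
  proof -
    have "(\<Sum>(k,m)\<in>?I. 4 * (s k * a k + s m * a m) / (s k + s m)) = (\<Sum>(k,m)\<in>?I. 4 * (w k m * a k + w m k * a m))"
      by (intro sum.cong refl) (auto simp: increasing_pairs_def w_def add_divide_distrib add.commute)
    then show ?thesis
      by (subst sum_increasing_pairs) (auto simp: w_def)
  qed
  also have "\<dots> = 4 * (\<Sum>k\<in>UNIV. \<Sum>m\<in>UNIV. w k m * a k) + 4 * (\<Sum>k\<in>UNIV. \<Sum>m\<in>UNIV. w m k * a m)"
    by (simp add: sum.distrib sum_distrib_left distrib_left)
  also have "(\<Sum>k\<in>UNIV. \<Sum>m\<in>UNIV. w m k * a m) = (\<Sum>k\<in>UNIV. \<Sum>m\<in>UNIV. w k m * a k)"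
    by (rule sum.swap)
  finally have 1: "(\<Sum>(k,m)\<in>?I. 4 * (s k * a k + s m * a m) / (s k + s m)) = 4 * (\<Sum>k\<in>UNIV. \<Sum>m\<in>UNIV. w k m * a k)"
    by simp
  let ?d = "\<lambda>k l m. k \<noteq> l \<and> k \<noteq> m \<and> l \<noteq> m"
  have "(\<Sum>k\<in>UNIV. \<Sum>m\<in>UNIV. w k m * a k) =
    (\<Sum>k\<in>UNIV. \<Sum>m\<in>UNIV. \<Sum>l\<in>UNIV. (if l = m then (if k \<noteq> l then w k l * t k l else 0) else 0) +
       (if ?d k l m then w k m * t k l else 0))"
    unfolding a_def sum_distrib_left by (intro sum.cong refl) (auto simp: w_def)
  also have "\<dots> = (\<Sum>k\<in>UNIV. \<Sum>l\<in>UNIV. if k \<noteq> l then w k l * t k l else 0) +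
     (\<Sum>k\<in>UNIV. \<Sum>m\<in>UNIV. \<Sum>l\<in>UNIV. if ?d k l m then w k m * t k l else 0)"
    by (simp add: sum.distrib)
  also have "(\<Sum>k\<in>UNIV. \<Sum>m\<in>UNIV. \<Sum>l\<in>UNIV. if ?d k l m then w k m * t k l else 0) =
     (\<Sum>k\<in>UNIV. \<Sum>l\<in>UNIV. \<Sum>m\<in>UNIV. if ?d k l m then w k m * t k l else 0)"
    by (rule sum.cong[OF refl sum.swap])
  finally have 2: "(\<Sum>k\<in>UNIV. \<Sum>m\<in>UNIV. w k m * a k) =
    (\<Sum>k\<in>UNIV. \<Sum>l\<in>UNIV. if k \<noteq> l then w k l * t k l else 0) +
    (\<Sum>k\<in>UNIV. \<Sum>l\<in>UNIV. \<Sum>m\<in>UNIV. if ?d k l m then w k m * t k l else 0)" .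
  have "2 * (\<Sum>k\<in>UNIV. \<Sum>l\<in>UNIV. if k \<noteq> l then w k l * t k l else 0) =
    (\<Sum>k\<in>UNIV. \<Sum>l\<in>UNIV. if k \<noteq> l then w k l * t k l else 0) +
    (\<Sum>k\<in>UNIV. \<Sum>l\<in>UNIV. if l \<noteq> k then w l k * t l k else 0)"
    by (subst (3) sum.swap) simp
  also have "\<dots> = (\<Sum>k\<in>UNIV. a k)"
    unfolding sum.distrib[symmetric] a_def
  proof (intro sum.cong refl)
    fix k l
    show "(if k \<noteq> l then w k l * t k l else 0) + (if l \<noteq> k then w l k * t l k else 0) = (if k \<noteq> l then t k l else 0)"
      using w1[of k l] t[of l k] by (simp add: distrib_right[symmetric])
  qed
  finally have 3: "2 * (\<Sum>k\<in>UNIV. \<Sum>l\<in>UNIV. if k \<noteq> l then w k l * t k l else 0) = (\<Sum>k\<in>UNIV. a k)" .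
  have "2 * (\<Sum>k\<in>UNIV. \<Sum>l\<in>UNIV. \<Sum>m\<in>UNIV. if ?d k l m then w k m * t k l else 0) =
    (\<Sum>k\<in>UNIV. \<Sum>l\<in>UNIV. \<Sum>m\<in>UNIV. if ?d k l m then w k m * t k l else 0) +
    (\<Sum>k\<in>UNIV. \<Sum>l\<in>UNIV. \<Sum>m\<in>UNIV. if ?d l k m then w l m * t l k else 0)"
    by (subst (3) sum.swap) simp
  also have "\<dots> = (\<Sum>k\<in>UNIV. \<Sum>l\<in>UNIV. \<Sum>m\<in>UNIV. if ?d k l m then t k l * (s k / (s k + s m) + s l / (s l + s m)) else 0)"
    unfolding sum.distrib[symmetric]
    by (intro sum.cong refl) (use t in \<open>auto simp: w_def distrib_left mult.commute\<close>)
  also have "\<dots> = (\<Sum>(k,l,m)\<in>distinct_triples. t k l * (s k / (s k + s m) + s l / (s l + s m)))"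
  proof -
    have "(\<Sum>(k,l,m)\<in>distinct_triples. t k l * (s k / (s k + s m) + s l / (s l + s m))) =
      (\<Sum>(k,l,m)\<in>UNIV. if ?d k l m then t k l * (s k / (s k + s m) + s l / (s l + s m)) else 0)"
      by (rule sum.mono_neutral_cong_left) (auto simp: distinct_triples_def)
    then show ?thesis by (simp add: sum.cartesian_product)
  qed
  finally have 4: "2 * (\<Sum>k\<in>UNIV. \<Sum>l\<in>UNIV. \<Sum>m\<in>UNIV. if ?d k l m then w k m * t k l else 0) =
    (\<Sum>(k,l,m)\<in>distinct_triples. t k l * (s k / (s k + s m) + s l / (s l + s m)))" .
  have "(\<Sum>(k,m)\<in>?I. 4 * (s k * (\<Sum>l\<in>UNIV. t k l) + s m * (\<Sum>l\<in>UNIV. t m l)) / (s k + s m)) =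
    (\<Sum>(k,m)\<in>?I. 4 * (s k * t k k + s m * t m m) / (s k + s m)) +
    (\<Sum>(k,m)\<in>?I. 4 * (s k * a k + s m * a m) / (s k + s m))"
    unfolding sum.distrib[symmetric] row
    by (intro sum.cong refl) (auto simp: distrib_left add_divide_distrib)
  moreover have "(\<Sum>k\<in>UNIV. \<Sum>l\<in>UNIV. t k l) - (\<Sum>k\<in>UNIV. t k k) = (\<Sum>k\<in>UNIV. a k)"
    by (simp add: row sum.distrib)
  moreover have "(\<Sum>(k,l,m)\<in>distinct_triples. 2 * t k l * (s k / (s k + s m) + s l / (s l + s m))) =
     2 * (\<Sum>(k,l,m)\<in>distinct_triples. t k l * (s k / (s k + s m) + s l / (s l + s m)))"
    by (simp add: sum_distrib_left case_prod_unfold mult.assoc)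
  ultimately show ?thesis unfolding 1 2 using 3 4 by simp
qed

text \<open>One half of the squares of the diagonal entries of \<open>second_power X\<close> compensates negative
  weights, the other half dominates the square of their sum by the Cauchy-Schwarz inequality.\<close>

lemma compound_inequality:
  fixes N :: "'n::{finite,linorder} \<Rightarrow> 'n \<Rightarrow> real" and l :: "'n \<Rightarrow> real"
  assumes N: "\<And>i j. N i j = N j i" and n: "CARD('n) \<ge> 2"
    and convex: "\<And>i j. i \<noteq> j \<Longrightarrow> l i + l j > 0 \<and> 1 + l i * l j > 0"
  defines "q \<equiv> \<lambda>i. 1 + (l i)\<^sup>2"
  defines "s \<equiv> \<lambda>i. l i / q i"
  defines "b \<equiv> \<lambda>p. s (fst p) + s (snd p)"
  defines "X \<equiv> \<lambda>i j. N i j * (1 - l i * l j) / (q i * q j)"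
  defines "t \<equiv> \<lambda>i j. (N i j)\<^sup>2 / (q i * q j)"
  shows "2 * (\<Sum>i\<in>UNIV. \<Sum>j\<in>UNIV. t i j) +
      1 / (real CARD('n) * (real CARD('n) - 1)) * (\<Sum>p\<in>increasing_pairs. second_power X p p / b p)\<^sup>2
    \<le> (\<Sum>(k,m)\<in>increasing_pairs. 4 * (s k * (\<Sum>j\<in>UNIV. t k j) + s m * (\<Sum>j\<in>UNIV. t m j)) / (s k + s m)) +
      (\<Sum>p\<in>increasing_pairs. \<Sum>r\<in>increasing_pairs. second_power X p r * second_power X r p / (b p * b r))"
proof -
  let ?I = "increasing_pairs :: ('n \<times> 'n) set"
  have qpos: "q i > 0" for i by (simp add: q_def add_pos_nonneg)
  have spos: "s i + s j > 0" if "i \<noteq> j" for i j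
    using S_sum_pos[of "l i" "l j"] convex[OF that] by (simp add: s_def q_def)
  have tsym: "t i j = t j i" for i j using N by (simp add: t_def mult.commute)
  have Xsym: "X i j = X j i" for i j using N by (simp add: X_def mult.commute)
  have t0: "t i j \<ge> 0" for i j using qpos by (simp add: t_def less_imp_le)
  let ?G = "(\<Sum>p\<in>?I. second_power X p p / b p)"
  let ?Q = "(\<Sum>p\<in>?I. (second_power X p p / b p)\<^sup>2)"
  have grad: "1 / (real CARD('n) * (real CARD('n) - 1)) * ?G\<^sup>2 \<le> ?Q / 2"
  proof -
    have c: "real (card ?I) = real CARD('n) * (real CARD('n) - 1) / 2"
    proof -
      have "real (2 * card ?I) = real (CARD('n) * (CARD('n) - 1))" by (simp only: card_increasing_pairs)
      then show ?thesis using n by (simp add: of_nat_diff)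
    qed
    have "?G\<^sup>2 \<le> real CARD('n) * (real CARD('n) - 1) / 2 * ?Q"
      using sum_squares_ge_square_sum[of ?I "\<lambda>p. second_power X p p / b p"] by (simp add: c)
    moreover have "real CARD('n) * (real CARD('n) - 1) > 0" using n by simp
    ultimately show ?thesis by (simp add: field_simps)
  qed
  have trip: "0 \<le> 2 * t k j * (s k / (s k + s m) + s j / (s j + s m)) + (X k j)\<^sup>2 / ((s k + s m) * (s j + s m))"
    if "(k,j,m) \<in> distinct_triples" for k j m
  proof -
    define C where "C = (1 - l k * l j)\<^sup>2 / (q k * q j)"
    have d: "k \<noteq> j" "k \<noteq> m" "j \<noteq> m" using that by (auto simp: distinct_triples_def)
    have "(X k j)\<^sup>2 = t k j * C"
      by (simp add: X_def t_def C_def power_divide power_mult_distrib power2_eq_square)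
    moreover have "0 \<le> 2 * (s k / (s k + s m) + s j / (s j + s m)) + C / ((s k + s m) * (s j + s m))"
      by (rule off_diagonal_term_nonneg[OF spos spos spos, of _ _ _ _ "(1 + l k * l j)\<^sup>2 / (q k * q j)"])
        (use d qpos slope_identities(2)[of "l k" "l j"] in \<open>simp_all add: C_def s_def q_def less_imp_le\<close>)
    then have "0 \<le> t k j * (2 * (s k / (s k + s m) + s j / (s j + s m)) + C / ((s k + s m) * (s j + s m)))"
      by (rule mult_nonneg_nonneg[OF t0])
    ultimately show ?thesis by (simp add: distrib_left mult.left_commute)
  qed
  have diag: "2 * (t k k + t m m) \<le> 4 * (s k * t k k + s m * t m m) / (s k + s m) + (second_power X (k,m) (k,m) / b (k,m))\<^sup>2 / 2"
    if "(k,m) \<in> ?I" for k m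
  proof -
    have d: "k \<noteq> m" using that by (auto simp: increasing_pairs_def)
    define c where "c i = (1 - (l i)\<^sup>2) / q i" for i
    define x where "x i = N i i / q i" for i
    have cs: "4 * (s i)\<^sup>2 + (c i)\<^sup>2 = 1" for i
      using slope_identities(1)[of "l i"] by (simp add: s_def c_def q_def)
    have tx: "t i i = (x i)\<^sup>2" for i by (simp add: t_def x_def power_divide power2_eq_square)
    have "second_power X (k,m) (k,m) = c k * x k + c m * x m"
      using d by (simp add: second_power_def X_def c_def x_def power2_eq_square mult.commute)
    then show ?thesis
      using diagonal_term_bound[OF spos[OF d] cs cs, of "x k" "x m"]
      by (simp add: tx b_def power_divide)
  qed
  have "2 * (\<Sum>k\<in>UNIV. t k k) \<le> (\<Sum>(k,m)\<in>?I. 2 * (t k k + t m m))"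
  proof -
    have "2 * (\<Sum>(k,m)\<in>?I. 2 * (t k k + t m m)) = (\<Sum>k\<in>UNIV. \<Sum>m\<in>UNIV. 2 * (t k k + t m m)) - (\<Sum>k\<in>UNIV. 4 * t k k)"
      by (subst sum_increasing_pairs) (auto simp: add.commute)
    also have "(\<Sum>k\<in>UNIV. \<Sum>m\<in>UNIV. 2 * (t k k + t m m)) = 4 * real CARD('n) * (\<Sum>k\<in>UNIV. t k k)"
      by (simp add: distrib_left sum.distrib sum_distrib_left mult_ac)
    finally have "2 * (\<Sum>(k,m)\<in>?I. 2 * (t k k + t m m)) = 4 * (real CARD('n) - 1) * (\<Sum>k\<in>UNIV. t k k)"
      by (simp only: sum_distrib_left[symmetric] left_diff_distrib right_diff_distrib mult_1_right)
    moreover have "1 * (\<Sum>k\<in>UNIV. t k k) \<le> (real CARD('n) - 1) * (\<Sum>k\<in>UNIV. t k k)"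
      using n by (intro mult_right_mono sum_nonneg t0) auto
    ultimately show ?thesis by (simp only: mult.assoc mult_1_left)
  qed
  also have "\<dots> \<le> (\<Sum>(k,m)\<in>?I. 4 * (s k * t k k + s m * t m m) / (s k + s m) + (second_power X (k,m) (k,m) / b (k,m))\<^sup>2 / 2)"
    by (intro sum_mono) (use diag in auto)
  also have "\<dots> = (\<Sum>(k,m)\<in>?I. 4 * (s k * t k k + s m * t m m) / (s k + s m)) + ?Q / 2"
    by (simp add: case_prod_unfold sum.distrib sum_divide_distrib)
  finally have D: "2 * (\<Sum>k\<in>UNIV. t k k) \<le> (\<Sum>(k,m)\<in>?I. 4 * (s k * t k k + s m * t m m) / (s k + s m)) + ?Q / 2" .
  have O: "0 \<le> (\<Sum>(k,j,m)\<in>distinct_triples. 2 * t k j * (s k / (s k + s m) + s j / (s j + s m))) +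
     (\<Sum>(k,j,m)\<in>distinct_triples. (X k j)\<^sup>2 / ((s k + s m) * (s j + s m)))"
    unfolding sum.distrib[symmetric] by (intro sum_nonneg) (use trip in auto)
  have P: "(\<Sum>p\<in>?I. (second_power X p p / b p)\<^sup>2) +
    (\<Sum>(k,j,m)\<in>distinct_triples. (X k j)\<^sup>2 / ((s k + s m) * (s j + s m)))
    \<le> (\<Sum>p\<in>?I. \<Sum>r\<in>?I. second_power X p r * second_power X r p / (b p * b r))"
    unfolding b_def by (rule sum_second_power_squares) (use Xsym spos in auto)
  have R: "(\<Sum>(k,m)\<in>?I. 4 * (s k * (\<Sum>j\<in>UNIV. t k j) + s m * (\<Sum>j\<in>UNIV. t m j)) / (s k + s m)) =
    (\<Sum>(k,m)\<in>?I. 4 * (s k * t k k + s m * t m m) / (s k + s m)) +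
    2 * ((\<Sum>k\<in>UNIV. \<Sum>j\<in>UNIV. t k j) - (\<Sum>k\<in>UNIV. t k k)) +
    (\<Sum>(k,j,m)\<in>distinct_triples. 2 * t k j * (s k / (s k + s m) + s j / (s j + s m)))"
    by (rule sum_weighted_rows) (use tsym spos in auto)
  have "2 * t2 + g \<le> r + p"
    if "sq + x2 \<le> p" "r = r0 + 2 * (t2 - t1) + w" "g \<le> sq / 2" "2 * t1 \<le> r0 + sq / 2" "0 \<le> w + x2"
    for sq x2 p r r0 t2 t1 w g :: real
    using that by simp
  from this[OF P R grad D O] show ?thesis .
qed

section \<open>The derivative of the Lagrangian angle\<close>

lemma one_plus_i_polar:
  "1 + \<i> * complex_of_real x = complex_of_real (sqrt (1 + x\<^sup>2)) * exp (\<i> * of_real (arctan x))"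
proof -
  have "sqrt (1 + x\<^sup>2) \<noteq> 0" by (simp add: add_nonneg_eq_0_iff)
  then show ?thesis by (simp add: complex_eq_iff exp_eq_polar cis.simps cos_arctan sin_arctan)
qed

text \<open>The angle is the argument of \<open>det (1 + \<i> M)\<close>, so \<open>exp (- \<i> \<Theta>) det (1 + \<i> M)\<close> is positive and
  Jacobi's formula yields \<open>d\<Theta> = Im tr ((1 + \<i> M)\<^sup>-\<^sup>1 \<i> dM)\<close>.\<close>

lemma dd_sum_arctan_eigenvalues:
  fixes M :: "'a::euclidean_space \<Rightarrow> real^'n^'n"
  assumes S: "thick S" and z: "z \<in> S" and M: "smooth_matrix M S" and sym: "transpose (M z) = M z"
    and \<Theta>: "smooth_on \<Theta> S"
    and angle: "\<And>w. w \<in> S \<Longrightarrow> \<exists>l. eigenvalues (M w) l \<and> \<Theta> w = (\<Sum>i\<in>UNIV. arctan (l i))"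
  shows "dd S v \<Theta> z = trace (matrix_inv (mat 1 + M z ** M z) ** dd_matrix S v M z)"
proof -
  define X where "X w = mat 1 + (\<chi> i j. \<i> * complex_matrix (M w) $ i $ j)" for w
  define X' where "X' v = (\<chi> i j. \<i> * complex_of_real (dd S v (\<lambda>w. M w $ i $ j) z))" for v
  define W where "W = matrix_inv (mat 1 + M z ** M z)"
  define N where "N = W ** M z"
  define Y where "Y = (\<chi> i j. complex_of_real (W $ i $ j) - \<i> * complex_of_real (N $ i $ j))"
  have d: "det (mat 1 + M z ** M z) \<noteq> 0" using det_one_plus_square[OF sym] by simp
  have YX: "Y ** X z = mat 1"
  proof -
    have "(Y ** X z) $ i $ j = complex_of_real ((W ** (mat 1 + M z ** M z)) $ i $ j)" for i j
    proof -
      have "(Y ** X z) $ i $ j = (\<Sum>k\<in>UNIV. (of_real (W $ i $ k) - \<i> * of_real (N $ i $ k)) *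
          (of_real (mat 1 $ k $ j) + \<i> * of_real (M z $ k $ j)))"
        by (auto simp: Y_def X_def matrix_matrix_mult_def complex_matrix_def mat_def intro!: sum.cong)
      also have "\<dots> = (\<Sum>k\<in>UNIV. of_real (W $ i $ k * mat 1 $ k $ j + N $ i $ k * M z $ k $ j)
          + \<i> * of_real (W $ i $ k * M z $ k $ j - N $ i $ k * mat 1 $ k $ j))"
        by (intro sum.cong refl) (simp add: complex_eq_iff)
      also have "\<dots> = of_real ((\<Sum>k\<in>UNIV. W $ i $ k * mat 1 $ k $ j) + (\<Sum>k\<in>UNIV. N $ i $ k * M z $ k $ j))
          + \<i> * of_real ((\<Sum>k\<in>UNIV. W $ i $ k * M z $ k $ j) - (\<Sum>k\<in>UNIV. N $ i $ k * mat 1 $ k $ j))"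
        by (simp only: sum.distrib sum_subtractf[symmetric] sum_distrib_left of_real_sum of_real_add)
      also have "\<dots> = of_real ((W ** mat 1) $ i $ j + (N ** M z) $ i $ j)
          + \<i> * of_real ((W ** M z) $ i $ j - (N ** mat 1) $ i $ j)"
        by (simp add: matrix_matrix_mult_def)
      also have "\<dots> = of_real ((W ** (mat 1 + M z ** M z)) $ i $ j)"
        by (simp add: matrix_add_ldistrib matrix_mul_assoc N_def)
      finally show ?thesis .
    qed
    then show ?thesis by (simp add: W_def matrix_inv_mult d vec_eq_iff) (simp add: mat_def)
  qed
  have DP: "((\<lambda>w. det (X w)) has_derivative (\<lambda>v. det (X z) * trace (Y ** X' v))) (at z within S)"
  proof (rule has_derivative_det[where X = X and X' = X' and z = z and Y = Y])
    fix i j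
    have "((\<lambda>w. mat 1 $ i $ j + \<i> * complex_of_real (M w $ i $ j)) has_derivative
        (\<lambda>v. 0 + \<i> * complex_of_real (dd S v (\<lambda>w. M w $ i $ j) z))) (at z within S)"
      by (intro has_derivative_add has_derivative_const has_derivative_mult_right has_derivative_of_real
          smooth_on_has_derivative[OF smooth_matrixD[OF M] z])
    then show "((\<lambda>w. X w $ i $ j) has_derivative (\<lambda>v. X' v $ i $ j)) (at z within S)"
      by (simp add: X_def X'_def complex_matrix_def)
  qed (rule YX)
  have D\<Theta>: "((\<lambda>w. exp (- \<i> * complex_of_real (\<Theta> w))) has_derivative
      (\<lambda>v. exp (- \<i> * complex_of_real (\<Theta> z)) * (- \<i> * complex_of_real (dd S v \<Theta> z)))) (at z within S)"
    by (rule has_derivative_compose[OF _ DERIV_exp[unfolded has_field_derivative_def]])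
      (intro has_derivative_mult_right has_derivative_of_real smooth_on_has_derivative[OF \<Theta> z])
  have polar: "\<exists>r>0. exp (- \<i> * complex_of_real (\<Theta> w)) * det (X w) = complex_of_real r" if w: "w \<in> S" for w
  proof -
    obtain l where l: "eigenvalues (M w) l" "\<Theta> w = (\<Sum>i\<in>UNIV. arctan (l i))" using angle[OF w] by blast
    have "det (X w) = (\<Prod>i\<in>UNIV. 1 + \<i> * complex_of_real (l i))"
      unfolding X_def by (rule eigenvalues_det[OF l(1)]) simp
    also have "\<dots> = of_real (\<Prod>i\<in>UNIV. sqrt (1 + (l i)\<^sup>2)) * exp (\<i> * complex_of_real (\<Theta> w))"
      by (simp add: one_plus_i_polar prod.distrib exp_sum l(2) sum_distrib_left)
    finally have "exp (- \<i> * complex_of_real (\<Theta> w)) * det (X w) = of_real (\<Prod>i\<in>UNIV. sqrt (1 + (l i)\<^sup>2))"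
      by (simp add: exp_minus)
    moreover have "(\<Prod>i\<in>UNIV. sqrt (1 + (l i)\<^sup>2)) > 0"
      by (intro prod_pos) (simp add: add_pos_nonneg)
    ultimately show ?thesis by blast
  qed
  define g where "g w = Im (exp (- \<i> * complex_of_real (\<Theta> w)) * det (X w))" for w
  obtain r where r: "r > 0" "exp (- \<i> * complex_of_real (\<Theta> z)) * det (X z) = complex_of_real r"
    using polar[OF z] by blast
  have "(g has_derivative (\<lambda>v. Im (exp (- \<i> * complex_of_real (\<Theta> z)) * (det (X z) * trace (Y ** X' v)) +
     exp (- \<i> * complex_of_real (\<Theta> z)) * (- \<i> * complex_of_real (dd S v \<Theta> z)) * det (X z)))) (at z within S)"
    unfolding g_def by (intro has_derivative_Im has_derivative_mult D\<Theta> DP)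
  then have "dd S v g z = Im (exp (- \<i> * complex_of_real (\<Theta> z)) * (det (X z) * trace (Y ** X' v)) +
     exp (- \<i> * complex_of_real (\<Theta> z)) * (- \<i> * complex_of_real (dd S v \<Theta> z)) * det (X z))"
    by (rule dd_eq[OF S z])
  also have "\<dots> = Im ((exp (- \<i> * complex_of_real (\<Theta> z)) * det (X z)) * (trace (Y ** X' v) - \<i> * complex_of_real (dd S v \<Theta> z)))"
    by (simp add: algebra_simps)
  also have "\<dots> = r * (Im (trace (Y ** X' v)) - dd S v \<Theta> z)"
    unfolding r(2) by simp
  also have "dd S v g z = 0"
  proof -
    have "g w = 0" if "w \<in> S" for w using polar[OF that] unfolding g_def by (metis Im_complex_of_real)
    from dd_cong[OF this z] have "dd S v g z = dd S v (\<lambda>w. 0) z" .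
    then show ?thesis by (simp add: dd_const[OF S z])
  qed
  finally have "dd S v \<Theta> z = Im (trace (Y ** X' v))" using r(1) by simp
  also have "\<dots> = trace (W ** dd_matrix S v M z)"
    by (simp add: trace_matrix_mult Y_def X'_def)
  finally show ?thesis by (simp add: W_def)
qed

section \<open>The evolution of \<open>log det S\<^sup>[\<^sup>2\<^sup>]\<close>\<close>

text \<open>With \<open>d\<close> an orthonormal eigenbasis of the Hessian at \<open>z\<close> and \<open>q\<close> the eigenvalues of the metric
  \<open>1 + M\<^sup>2\<close>, this is \<open>\<partial>\<^sub>t - g\<^sup>i\<^sup>j\<partial>\<^sub>i\<partial>\<^sub>j\<close> at \<open>z\<close>.  The coefficients are frozen at \<open>z\<close>.\<close>

definition parabolic ::
    "'a::euclidean_space set \<Rightarrow> 'a \<Rightarrow> ('n::finite \<Rightarrow> 'a) \<Rightarrow> ('n \<Rightarrow> real) \<Rightarrow> 'a \<Rightarrow> ('a \<Rightarrow> real) \<Rightarrow> real" where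
  "parabolic S \<tau> d q z f = dd S \<tau> f z - (\<Sum>c\<in>UNIV. dd S (d c) (dd S (d c) f) z / q c)"

context
  fixes S :: "'a::euclidean_space set" and z :: 'a
  assumes S: "thick S" and z: "z \<in> S"
begin

lemma dd2_cong:
  assumes "\<And>x. x \<in> S \<Longrightarrow> f x = g x"
  shows "dd S v (dd S w f) z = dd S v (dd S w g) z"
  by (rule dd_cong[OF _ z]) (rule dd_cong[OF assms])

lemma parabolic_cong:
  assumes "\<And>x. x \<in> S \<Longrightarrow> f x = g x"
  shows "parabolic S \<tau> d q z f = parabolic S \<tau> d q z g"
proof -
  have "dd S \<tau> f z = dd S \<tau> g z" by (rule dd_cong[OF assms z])
  moreover have "dd S v (dd S v f) z = dd S v (dd S v g) z" for v by (rule dd2_cong[OF assms])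
  ultimately show ?thesis by (simp add: parabolic_def)
qed

lemma dd2_sum:
  assumes "\<And>i. i \<in> I \<Longrightarrow> smooth_on (f i) S"
  shows "dd S v (dd S w (\<lambda>x. \<Sum>i\<in>I. f i x)) z = (\<Sum>i\<in>I. dd S v (dd S w (f i)) z)"
proof -
  have "dd S v (dd S w (\<lambda>x. \<Sum>i\<in>I. f i x)) z = dd S v (\<lambda>x. \<Sum>i\<in>I. dd S w (f i) x) z"
    by (rule dd_cong[OF _ z]) (rule dd_sum[OF S _ assms])
  also have "\<dots> = (\<Sum>i\<in>I. dd S v (dd S w (f i)) z)"
    by (rule dd_sum[OF S z]) (rule smooth_on_dd[OF S assms])
  finally show ?thesis .
qed

lemma dd2_mult:
  fixes f g :: "'a \<Rightarrow> real"
  assumes f: "smooth_on f S" and g: "smooth_on g S"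
  shows "dd S v (dd S w (\<lambda>x. f x * g x)) z = f z * dd S v (dd S w g) z + dd S v f z * dd S w g z +
    (dd S w f z * dd S v g z + dd S v (dd S w f) z * g z)"
proof -
  have "dd S v (dd S w (\<lambda>x. f x * g x)) z = dd S v (\<lambda>x. f x * dd S w g x + dd S w f x * g x) z"
    by (rule dd_cong[OF _ z]) (rule dd_mult[OF S _ f g])
  also have "\<dots> = dd S v (\<lambda>x. f x * dd S w g x) z + dd S v (\<lambda>x. dd S w f x * g x) z"
    by (rule dd_add[OF S z smooth_on_mult[OF f smooth_on_dd[OF S g]] smooth_on_mult[OF smooth_on_dd[OF S f] g]])
  also have "\<dots> = f z * dd S v (dd S w g) z + dd S v f z * dd S w g z +
    (dd S w f z * dd S v g z + dd S v (dd S w f) z * g z)"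
    by (simp only: dd_mult[OF S z f smooth_on_dd[OF S g]] dd_mult[OF S z smooth_on_dd[OF S f] g])
  finally show ?thesis .
qed

lemma parabolic_const: "parabolic S \<tau> d q z (\<lambda>x. c) = 0"
proof -
  have "dd S v (dd S w (\<lambda>x. c)) z = dd S v (\<lambda>x. 0) z" for v w
    by (rule dd_cong[OF _ z]) (rule dd_const[OF S])
  then show ?thesis by (simp add: parabolic_def dd_const[OF S z])
qed

lemma parabolic_sum:
  assumes "\<And>i. i \<in> I \<Longrightarrow> smooth_on (f i) S"
  shows "parabolic S \<tau> d q z (\<lambda>x. \<Sum>i\<in>I. f i x) = (\<Sum>i\<in>I. parabolic S \<tau> d q z (f i))"
proof -
  have "(\<Sum>c\<in>UNIV. dd S (d c) (dd S (d c) (\<lambda>x. \<Sum>i\<in>I. f i x)) z / q c) =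
     (\<Sum>i\<in>I. \<Sum>c\<in>UNIV. dd S (d c) (dd S (d c) (f i)) z / q c)"
    by (subst sum.swap) (simp only: dd2_sum[OF assms] sum_divide_distrib)
  then show ?thesis
    by (simp only: parabolic_def dd_sum[OF S z assms] sum_subtractf)
qed

lemma parabolic_add:
  assumes "smooth_on f S" "smooth_on g S"
  shows "parabolic S \<tau> d q z (\<lambda>x. f x + g x) = parabolic S \<tau> d q z f + parabolic S \<tau> d q z g"
proof -
  have "smooth_on (if b then f else g) S" for b using assms by simp
  then have "parabolic S \<tau> d q z (\<lambda>x. \<Sum>b\<in>UNIV. (if b then f else g) x) =
     (\<Sum>b\<in>UNIV. parabolic S \<tau> d q z (if b then f else g))"
    by (rule parabolic_sum)
  then show ?thesis by (simp add: UNIV_bool add.commute)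
qed

lemma parabolic_mult:
  fixes f g :: "'a \<Rightarrow> real"
  assumes f: "smooth_on f S" and g: "smooth_on g S"
  shows "parabolic S \<tau> d q z (\<lambda>x. f x * g x) = f z * parabolic S \<tau> d q z g + parabolic S \<tau> d q z f * g z
     - 2 * (\<Sum>c\<in>UNIV. dd S (d c) f z * dd S (d c) g z / q c)"
proof -
  have "(\<Sum>c\<in>UNIV. dd S (d c) (dd S (d c) (\<lambda>x. f x * g x)) z / q c) =
    (\<Sum>c\<in>UNIV. f z * (dd S (d c) (dd S (d c) g) z / q c) + (dd S (d c) (dd S (d c) f) z / q c) * g z +
      2 * (dd S (d c) f z * dd S (d c) g z / q c))"
    by (intro sum.cong refl) (simp add: dd2_mult[OF f g] add_divide_distrib)
  also have "\<dots> = f z * (\<Sum>c\<in>UNIV. dd S (d c) (dd S (d c) g) z / q c) +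
     (\<Sum>c\<in>UNIV. dd S (d c) (dd S (d c) f) z / q c) * g z + 2 * (\<Sum>c\<in>UNIV. dd S (d c) f z * dd S (d c) g z / q c)"
    by (simp only: sum.distrib sum_distrib_left sum_distrib_right)
  finally show ?thesis
    by (simp add: parabolic_def dd_mult[OF S z f g] left_diff_distrib right_diff_distrib)
qed

lemma parabolic_matrix_mult:
  assumes X: "smooth_matrix X S" and Y: "smooth_matrix Y S"
  shows "parabolic S \<tau> d q z (\<lambda>x. (X x ** Y x) $ i $ j) =
    (\<Sum>k\<in>UNIV. X z $ i $ k * parabolic S \<tau> d q z (\<lambda>x. Y x $ k $ j)) +
    (\<Sum>k\<in>UNIV. parabolic S \<tau> d q z (\<lambda>x. X x $ i $ k) * Y z $ k $ j)
    - 2 * (\<Sum>k\<in>UNIV. \<Sum>c\<in>UNIV. dd S (d c) (\<lambda>x. X x $ i $ k) z * dd S (d c) (\<lambda>x. Y x $ k $ j) z / q c)"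
proof -
  have "parabolic S \<tau> d q z (\<lambda>x. \<Sum>k\<in>UNIV. X x $ i $ k * Y x $ k $ j) =
     (\<Sum>k\<in>UNIV. parabolic S \<tau> d q z (\<lambda>x. X x $ i $ k * Y x $ k $ j))"
    by (rule parabolic_sum) (rule smooth_on_mult[OF smooth_matrixD[OF X] smooth_matrixD[OF Y]])
  then show ?thesis
    by (simp add: matrix_matrix_mult_def parabolic_mult[OF smooth_matrixD[OF X] smooth_matrixD[OF Y]]
        sum.distrib sum_subtractf sum_distrib_left)
qed

text \<open>From \<open>d log det X = tr (X\<^sup>-\<^sup>1 dX)\<close>, differentiated once more.\<close>

lemma parabolic_ln_det:
  assumes X: "smooth_matrix X S" and d: "\<And>w. w \<in> S \<Longrightarrow> det (X w) > 0"
    and diag: "\<And>i j. X z $ i $ j = (if i = j then b i else 0)"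
  shows "parabolic S \<tau> e q z (\<lambda>w. ln (det (X w))) =
     (\<Sum>i\<in>UNIV. parabolic S \<tau> e q z (\<lambda>w. X w $ i $ i) / b i) +
     (\<Sum>c\<in>UNIV. (\<Sum>i\<in>UNIV. \<Sum>j\<in>UNIV. dd S (e c) (\<lambda>w. X w $ i $ j) z * dd S (e c) (\<lambda>w. X w $ j $ i) z / (b i * b j)) / q c)"
    and "dd S v (\<lambda>w. ln (det (X w))) z = (\<Sum>i\<in>UNIV. dd S v (\<lambda>w. X w $ i $ i) z / b i)"
proof -
  have dz: "det (X z) = (\<Prod>i\<in>UNIV. b i)"
    by (subst det_diagonal) (simp_all add: diag)
  then have b: "b i \<noteq> 0" for i using d[OF z] by (metis less_irrefl prod_zero_iff finite UNIV_I)
  have left: "(matrix_inv (X z) ** N) $ i $ j = N $ i $ j / b i" for N i j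
    by (simp add: matrix_matrix_mult_def matrix_inv_diagonal[OF diag b] sum_diagonal_left)
  have tr1: "trace (matrix_inv (X z) ** N) = (\<Sum>i\<in>UNIV. N $ i $ i / b i)" for N
    by (simp add: trace_def left)
  have tr2: "trace (matrix_inv (X z) ** N ** matrix_inv (X z) ** P) = (\<Sum>i\<in>UNIV. \<Sum>j\<in>UNIV. N $ i $ j * P $ j $ i / (b i * b j))" for N P
  proof -
    have "matrix_inv (X z) ** N ** matrix_inv (X z) ** P = (matrix_inv (X z) ** N) ** (matrix_inv (X z) ** P)"
      by (simp only: matrix_mul_assoc)
    then show ?thesis by (simp add: trace_matrix_mult left)
  qed
  show "dd S v (\<lambda>w. ln (det (X w))) z = (\<Sum>i\<in>UNIV. dd S v (\<lambda>w. X w $ i $ i) z / b i)" for v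
    by (simp add: dd_ln_det[OF S z X d[OF z]] tr1)
  moreover have "dd S (e c) (dd S (e c) (\<lambda>w. ln (det (X w)))) z / q c =
    (\<Sum>i\<in>UNIV. dd S (e c) (dd S (e c) (\<lambda>w. X w $ i $ i)) z / q c / b i) -
    (\<Sum>i\<in>UNIV. \<Sum>j\<in>UNIV. dd S (e c) (\<lambda>w. X w $ i $ j) z * dd S (e c) (\<lambda>w. X w $ j $ i) z / (b i * b j)) / q c" for c
    by (simp add: dd_dd_ln_det[OF S z X d] tr1 tr2 diff_divide_distrib sum_divide_distrib divide_divide_eq_left mult.commute)
  ultimately show "parabolic S \<tau> e q z (\<lambda>w. ln (det (X w))) =
     (\<Sum>i\<in>UNIV. parabolic S \<tau> e q z (\<lambda>w. X w $ i $ i) / b i) +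
     (\<Sum>c\<in>UNIV. (\<Sum>i\<in>UNIV. \<Sum>j\<in>UNIV. dd S (e c) (\<lambda>w. X w $ i $ j) z * dd S (e c) (\<lambda>w. X w $ j $ i) z / (b i * b j)) / q c)"
    unfolding parabolic_def
    by (simp only: sum_subtractf diff_divide_distrib sum_divide_distrib[of _ UNIV "b _"]) (subst sum.swap, simp)
qed

end

lemma eigenvalues_diagonal:
  assumes "\<And>i j. M $ i $ j = (if i = j then l i else 0)"
  shows "eigenvalues M l"
  unfolding eigenvalues_def
  by (intro allI, subst det_diagonal) (simp_all add: assms mat_def)

text \<open>
  The computation at the point \<open>z\<close>.  \<open>U\<close> is the solution as a function of space and time, \<open>\<tau>\<close> the time
  direction, and \<open>d\<close> lists spatial directions, later an orthonormal eigenbasis of the Hessian at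
  \<open>z\<close>; so \<open>M\<close> is the Hessian in that basis, with eigenvalues \<open>l\<close> at \<open>z\<close>, \<open>q\<close> lists the
  eigenvalues of the metric, \<open>A\<close> is \<open>S\<close> as an endomorphism, \<open>f\<close> is \<open>log det S\<^sup>[\<^sup>2\<^sup>]\<close>, and \<open>T\<close> collects
  the third derivatives at \<open>z\<close>.
\<close>

context
  fixes S :: "'a::euclidean_space set" and U :: "'a \<Rightarrow> real" and d :: "'n::{finite,linorder} \<Rightarrow> 'a"
    and \<tau> z :: 'a and l q :: "'n \<Rightarrow> real" and M A :: "'a \<Rightarrow> real^'n::{finite,linorder}^'n::{finite,linorder}"
    and f :: "'a \<Rightarrow> real" and T :: "'n \<Rightarrow> 'n \<Rightarrow> 'n \<Rightarrow> real"
  assumes S: "thick S" and z: "z \<in> S" and U: "smooth_on U S" and n: "CARD('n) \<ge> 2"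
    and M_def: "M = (\<lambda>w. \<chi> a b. dd S (d a) (dd S (d b) U) w)"
    and A_def: "A = (\<lambda>w. S_matrix (M w))"
    and f_def: "f = (\<lambda>w. ln (det_on increasing_pairs (second_power (\<lambda>i j. A w $ i $ j))))"
    and q_def: "q = (\<lambda>i. 1 + (l i)\<^sup>2)"
    and T_def: "T = (\<lambda>c i j. dd S (d c) (dd S (d i) (dd S (d j) U)) z)"
    and angle: "\<And>w. w \<in> S \<Longrightarrow> \<exists>k. eigenvalues (M w) k \<and> (\<forall>i j. i \<noteq> j \<longrightarrow> k i + k j > 0 \<and> 1 + k i * k j > 0) \<and>
      dd S \<tau> U w = (\<Sum>i\<in>UNIV. arctan (k i))"
    and diag: "\<And>i j. M z $ i $ j = (if i = j then l i else 0)"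
begin

lemma qpos: "q i > 0" by (simp add: q_def add_pos_nonneg)

lemma smooth_M: "smooth_matrix M S"
  unfolding smooth_matrix_def M_def by (simp add: smooth_on_dd[OF S] U)

lemma smooth_dU: "smooth_on (dd S v U) S" by (rule smooth_on_dd[OF S U])

lemma smooth_ddU: "smooth_on (dd S v (dd S w U)) S" by (rule smooth_on_dd[OF S smooth_dU])

lemma symmetric_M: "w \<in> S \<Longrightarrow> transpose (M w) = M w"
  by (simp add: M_def transpose_def vec_eq_iff dd_commute[OF S U])

lemma angle_sum: "w \<in> S \<Longrightarrow> \<exists>k. eigenvalues (M w) k \<and> dd S \<tau> U w = (\<Sum>i\<in>UNIV. arctan (k i))"
  using angle[of w] by blast

lemma dd_M: "dd S (d c) (\<lambda>w. M w $ i $ j) z = T c i j"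
  by (simp add: M_def T_def)

lemma T_swap: "T c i j = T c j i" "T c i j = T i c j"
proof -
  show "T c i j = T c j i"
    unfolding T_def by (rule dd_cong[OF _ z]) (rule dd_commute[OF S U])
  show "T c i j = T i c j"
    unfolding T_def by (rule dd_commute[OF S smooth_dU z])
qed

lemma l_convex: "i \<noteq> j \<Longrightarrow> l i + l j > 0 \<and> 1 + l i * l j > 0"
proof -
  assume "i \<noteq> j"
  obtain k where k: "eigenvalues (M z) k" "\<And>i j. i \<noteq> j \<Longrightarrow> k i + k j > 0 \<and> 1 + k i * k j > 0"
    using angle[OF z] by blast
  show ?thesis
    by (rule eigenvalues_pairwise[OF k(1) eigenvalues_diagonal[OF diag], of "\<lambda>x y. x + y > 0 \<and> 1 + x * y > 0"])
      (use k(2) \<open>i \<noteq> j\<close> in auto)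
qed

text \<open>The metric of the gradient graph in an orthonormal basis \<open>d\<close>.\<close>

definition "induced_metric w = mat 1 + M w ** M w"

lemma induced_metric_nth: "induced_metric w $ i $ j = mat 1 $ i $ j + (M w ** M w) $ i $ j"
  by (simp add: induced_metric_def)

lemma smooth_induced_metric: "smooth_matrix induced_metric S"
  unfolding smooth_matrix_def induced_metric_nth
  by (intro allI smooth_on_add smooth_on_const smooth_matrixD[OF smooth_matrix_mult[OF smooth_M smooth_M]])

lemma det_induced_metric: "w \<in> S \<Longrightarrow> det (induced_metric w) > 0"
  unfolding induced_metric_def by (rule det_one_plus_square[OF symmetric_M])

lemma induced_metric_diag: "induced_metric z $ i $ j = (if i = j then q i else 0)"
  unfolding induced_metric_nth matrix_matrix_mult_def
  by (simp add: diag sum_diagonal_left mat_def q_def power2_eq_square)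

lemma dd_induced_metric: "dd S (d c) (\<lambda>w. induced_metric w $ i $ j) z = (l i + l j) * T c i j"
proof -
  have "dd S (d c) (\<lambda>w. induced_metric w $ i $ j) z = dd S (d c) (\<lambda>w. (M w ** M w) $ i $ j) z"
    unfolding induced_metric_nth
    by (subst dd_add[OF S z smooth_on_const smooth_matrixD[OF smooth_matrix_mult[OF smooth_M smooth_M]]])
      (simp add: dd_const[OF S z])
  also have "\<dots> = dd_matrix S (d c) (\<lambda>w. M w ** M w) z $ i $ j" by simp
  also have "\<dots> = (l i + l j) * T c i j"
    unfolding dd_matrix_mult[OF S z smooth_M smooth_M]
    by (simp add: matrix_matrix_mult_def dd_M diag sum_diagonal_left sum_diagonal_right distrib_right mult.commute del: dd_matrix_nth)
      (simp add: matrix_matrix_mult_def dd_M diag sum_diagonal_left sum_diagonal_right algebra_simps)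
  finally show ?thesis .
qed

lemma parabolic_induced_metric:
  "parabolic S \<tau> d q z (\<lambda>w. induced_metric w $ i $ j) = (l i + l j) * parabolic S \<tau> d q z (\<lambda>w. M w $ i $ j)
    - 2 * (\<Sum>k\<in>UNIV. \<Sum>c\<in>UNIV. T c i k * T c k j / q c)"
proof -
  have "parabolic S \<tau> d q z (\<lambda>w. induced_metric w $ i $ j) = parabolic S \<tau> d q z (\<lambda>w. (M w ** M w) $ i $ j)"
    unfolding induced_metric_nth
    by (subst parabolic_add[OF S z smooth_on_const smooth_matrixD[OF smooth_matrix_mult[OF smooth_M smooth_M]]])
      (simp add: parabolic_const[OF S z])
  then show ?thesis
    unfolding parabolic_matrix_mult[OF S z smooth_M smooth_M]
    by (simp add: dd_M diag sum_diagonal_left sum_diagonal_right) (simp add: algebra_simps)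
qed

text \<open>\<open>M\<^sub>\<tau> = D\<^sup>2\<Theta>\<close>, and \<open>d\<Theta> = tr (g\<^sup>-\<^sup>1 dM)\<close>.  When \<open>dM\<close> is differentiated once more, commuting
  derivatives gives \<open>g\<^sup>a\<^sup>b\<partial>\<^sub>a\<partial>\<^sub>bM\<close>, which the operator subtracts; the derivative of \<open>g\<^sup>-\<^sup>1\<close> remains.\<close>

lemma parabolic_M:
  "parabolic S \<tau> d q z (\<lambda>w. M w $ i $ j) = - (\<Sum>a\<in>UNIV. \<Sum>b\<in>UNIV. (l a + l b) * T i a b * T j a b / (q a * q b))"
proof -
  define W where "W w = matrix_inv (induced_metric w)" for w
  have N0: "w \<in> S \<Longrightarrow> det (induced_metric w) \<noteq> 0" for w using det_induced_metric by force
  have smooth_W: "smooth_matrix W S"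
    unfolding W_def by (rule smooth_matrix_inv[OF smooth_induced_metric N0])
  have Wz: "W z $ a $ b = (if a = b then 1 / q a else 0)" for a b
    unfolding W_def by (rule matrix_inv_diagonal[OF induced_metric_diag]) (use qpos[of _] in \<open>simp add: less_imp_neq[symmetric]\<close>)
  have dW: "dd S (d c) (\<lambda>w. W w $ a $ b) z = - ((l a + l b) * T c a b / (q a * q b))" for a b c
  proof -
    have "dd_matrix S (d c) W z = - (W z ** dd_matrix S (d c) induced_metric z ** W z)"
      unfolding W_def by (rule dd_matrix_inv[OF S z smooth_induced_metric N0])
    then have "dd S (d c) (\<lambda>w. W w $ a $ b) z = (- (W z ** dd_matrix S (d c) induced_metric z ** W z)) $ a $ b"
      unfolding dd_matrix_nth[symmetric] by simp
    also have "\<dots> = - ((l a + l b) * T c a b / (q a * q b))"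
      by (simp add: matrix_matrix_mult_def Wz dd_induced_metric sum_diagonal_left)
        (simp add: sum_divide_distrib[symmetric] sum_diagonal_right)
    finally show ?thesis .
  qed
  have first: "dd S v (dd S \<tau> U) w = trace (W w ** dd_matrix S v M w)" if "w \<in> S" for v w
    unfolding W_def induced_metric_def
    by (rule dd_sum_arctan_eigenvalues[OF S that smooth_M symmetric_M[OF that] smooth_dU angle_sum])
  have "dd S \<tau> (\<lambda>w. M w $ i $ j) z = dd S \<tau> (dd S (d i) (dd S (d j) U)) z"
    by (simp add: M_def)
  also have "\<dots> = dd S (d i) (dd S \<tau> (dd S (d j) U)) z"
    by (rule dd_commute[OF S smooth_dU z])
  also have "\<dots> = dd S (d i) (dd S (d j) (dd S \<tau> U)) z"
    by (rule dd_cong[OF _ z]) (rule dd_commute[OF S U])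
  also have "\<dots> = dd S (d i) (\<lambda>w. trace (W w ** dd_matrix S (d j) M w)) z"
    by (rule dd_cong[OF _ z]) (rule first)
  also have "\<dots> = trace (dd_matrix S (d i) (\<lambda>w. W w ** dd_matrix S (d j) M w) z)"
    by (rule dd_trace[OF S z smooth_matrix_mult[OF smooth_W smooth_matrix_dd[OF S smooth_M]]])
  also have "\<dots> = trace (W z ** dd_matrix S (d i) (dd_matrix S (d j) M) z) + trace (dd_matrix S (d i) W z ** dd_matrix S (d j) M z)"
    unfolding dd_matrix_mult[OF S z smooth_W smooth_matrix_dd[OF S smooth_M]] by (rule trace_add)
  also have "trace (W z ** dd_matrix S (d i) (dd_matrix S (d j) M) z) = 
     (\<Sum>c\<in>UNIV. dd S (d c) (dd S (d c) (\<lambda>w. M w $ i $ j)) z / q c)"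
  proof -
    have "dd S (d i) (dd S (d j) (\<lambda>w. M w $ c $ c)) z = dd S (d c) (dd S (d c) (\<lambda>w. M w $ i $ j)) z" for c
    proof -
      have "dd S (d i) (dd S (d j) (\<lambda>w. M w $ c $ c)) z = dd S (d i) (dd S (d j) (dd S (d c) (dd S (d c) U))) z"
        by (simp add: M_def)
      also have "\<dots> = dd S (d i) (dd S (d c) (dd S (d j) (dd S (d c) U))) z"
        by (rule dd_cong[OF _ z]) (rule dd_commute[OF S smooth_dU])
      also have "\<dots> = dd S (d c) (dd S (d i) (dd S (d j) (dd S (d c) U))) z"
        by (rule dd_commute[OF S smooth_ddU z])
      also have "\<dots> = dd S (d c) (dd S (d i) (dd S (d c) (dd S (d j) U))) z"
        by (rule dd2_cong[OF S z]) (rule dd_commute[OF S U])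
      also have "\<dots> = dd S (d c) (dd S (d c) (dd S (d i) (dd S (d j) U))) z"
        by (rule dd_cong[OF _ z]) (rule dd_commute[OF S smooth_dU])
      also have "\<dots> = dd S (d c) (dd S (d c) (\<lambda>w. M w $ i $ j)) z"
        by (simp add: M_def)
      finally show ?thesis .
    qed
    then show ?thesis
      by (simp add: trace_matrix_mult Wz sum_diagonal_left)
  qed
  also have "trace (dd_matrix S (d i) W z ** dd_matrix S (d j) M z) =
      - (\<Sum>a\<in>UNIV. \<Sum>b\<in>UNIV. (l a + l b) * T i a b * T j a b / (q a * q b))"
    by (simp add: trace_matrix_mult dW dd_M sum_negf T_swap(1)[of j])
  finally show ?thesis by (simp add: parabolic_def)
qed

lemma smooth_A: "smooth_matrix A S"
proof -
  have "smooth_matrix (\<lambda>w. matrix_inv (induced_metric w)) S"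
    by (rule smooth_matrix_inv[OF smooth_induced_metric]) (use det_induced_metric in force)
  then show ?thesis
    unfolding A_def S_matrix_def induced_metric_def[symmetric] by (rule smooth_matrix_mult[OF smooth_M])
qed

lemma A_mult_induced_metric: "w \<in> S \<Longrightarrow> A w ** induced_metric w = M w"
  unfolding A_def induced_metric_def by (rule S_matrix_mult) (use det_induced_metric induced_metric_def in force)

lemma A_diag: "A z $ i $ j = (if i = j then l i / q i else 0)"
  unfolding A_def by (simp add: S_matrix_diagonal[OF diag] q_def)

text \<open>The derivatives of \<open>A\<close> at \<open>z\<close> follow by differentiating \<open>A (1 + M\<^sup>2) = M\<close>, entry by entry, because all
  matrices are diagonal at \<open>z\<close>.\<close>

lemma dd_A: "dd S (d c) (\<lambda>w. A w $ i $ j) z = T c i j * (1 - l i * l j) / (q i * q j)"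
proof -
  have "dd_matrix S (d c) (\<lambda>w. A w ** induced_metric w) z $ i $ j = T c i j"
    unfolding dd_matrix_nth dd_M[symmetric] by (rule dd_cong[OF _ z]) (simp add: A_mult_induced_metric)
  then have "l i / q i * ((l i + l j) * T c i j) + dd S (d c) (\<lambda>w. A w $ i $ j) z * q j = T c i j"
    unfolding dd_matrix_mult[OF S z smooth_A smooth_induced_metric]
    by (simp add: matrix_matrix_mult_def A_diag induced_metric_diag dd_induced_metric sum_diagonal_left sum_diagonal_right)
  then have "dd S (d c) (\<lambda>w. A w $ i $ j) z * q j = T c i j * (q i - l i * (l i + l j)) / q i"
    using qpos[of i] by (simp add: field_simps)
  also have "q i - l i * (l i + l j) = 1 - l i * l j" by (simp add: q_def power2_eq_square algebra_simps)
  finally show ?thesis using qpos[of i] qpos[of j] by (simp add: field_simps)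
qed

text \<open>Apply the operator to \<open>A (1 + M\<^sup>2) = M\<close>.  The three kinds of terms carry the coefficients
  \<open>- 2 \<lambda>\<^sub>j (1 - \<lambda>\<^sub>k\<^sup>2)\<close>, \<open>2 \<lambda>\<^sub>k (1 + \<lambda>\<^sub>j\<^sup>2)\<close> and \<open>2 (1 - \<lambda>\<^sub>k\<lambda>\<^sub>j)(\<lambda>\<^sub>k + \<lambda>\<^sub>j)\<close>, whose sum is \<open>4 \<lambda>\<^sub>k\<close>.\<close>

lemma parabolic_A:
  "parabolic S \<tau> d q z (\<lambda>w. A w $ k $ k) =
    (\<Sum>c\<in>UNIV. 4 * (l k / q k) * (\<Sum>j\<in>UNIV. (T c k j)\<^sup>2 / (q k * q j)) / q c)"
proof -
  let ?L = "parabolic S \<tau> d q z"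
  define t where "t c j = (T c k j)\<^sup>2 / (q c * q j)" for c j
  have LM: "?L (\<lambda>w. M w $ k $ k) = - 2 * (\<Sum>c\<in>UNIV. \<Sum>j\<in>UNIV. l j * t c j)"
  proof -
    have "(\<Sum>a\<in>UNIV. \<Sum>b\<in>UNIV. (l a + l b) * T k a b * T k a b / (q a * q b)) =
      (\<Sum>a\<in>UNIV. \<Sum>b\<in>UNIV. l b * t a b + l a * t b a)"
    proof (intro sum.cong refl)
      fix a b
      have "T a k b = T k a b" "T b k a = T k a b" using T_swap by metis+
      then show "(l a + l b) * T k a b * T k a b / (q a * q b) = l b * t a b + l a * t b a"
        by (simp add: t_def power2_eq_square mult.commute[of "q b"] add_divide_distrib[symmetric] algebra_simps)
    qed
    also have "\<dots> = (\<Sum>a\<in>UNIV. \<Sum>b\<in>UNIV. l b * t a b) + (\<Sum>a\<in>UNIV. \<Sum>b\<in>UNIV. l a * t b a)"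
      by (simp add: sum.distrib)
    also have "(\<Sum>a\<in>UNIV. \<Sum>b\<in>UNIV. l a * t b a) = (\<Sum>a\<in>UNIV. \<Sum>b\<in>UNIV. l b * t a b)"
      by (rule sum.swap)
    finally show ?thesis by (simp add: parabolic_M)
  qed
  have TT: "(\<Sum>j\<in>UNIV. \<Sum>c\<in>UNIV. T c k j * T c j k / q c) = (\<Sum>c\<in>UNIV. \<Sum>j\<in>UNIV. q j * t c j)"
  proof -
    have "(\<Sum>j\<in>UNIV. \<Sum>c\<in>UNIV. T c k j * T c j k / q c) = (\<Sum>j\<in>UNIV. \<Sum>c\<in>UNIV. q j * t c j)"
    proof (intro sum.cong refl)
      fix j c
      show "T c k j * T c j k / q c = q j * t c j"
        using qpos[of j] by (simp add: t_def T_swap(1)[of c j k] power2_eq_square)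
    qed
    then show ?thesis by (simp only: sum.swap[of "\<lambda>j c. q j * t c j"])
  qed
  have AN: "(\<Sum>j\<in>UNIV. \<Sum>c\<in>UNIV. dd S (d c) (\<lambda>w. A w $ k $ j) z * dd S (d c) (\<lambda>w. induced_metric w $ j $ k) z / q c) =
     (\<Sum>c\<in>UNIV. \<Sum>j\<in>UNIV. (1 - l k * l j) * (l k + l j) / q k * t c j)"
  proof -
    have "(\<Sum>j\<in>UNIV. \<Sum>c\<in>UNIV. dd S (d c) (\<lambda>w. A w $ k $ j) z * dd S (d c) (\<lambda>w. induced_metric w $ j $ k) z / q c) =
      (\<Sum>j\<in>UNIV. \<Sum>c\<in>UNIV. (1 - l k * l j) * (l k + l j) / q k * t c j)"
      by (intro sum.cong refl) (simp add: dd_A dd_induced_metric t_def T_swap(1)[of _ _ k] power2_eq_square mult_ac add.commute)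
    then show ?thesis by (simp only: sum.swap[of "\<lambda>j c. (1 - l k * l j) * (l k + l j) / q k * t c j"])
  qed
  have "?L (\<lambda>w. (A w ** induced_metric w) $ k $ k) = ?L (\<lambda>w. M w $ k $ k)"
    by (rule parabolic_cong[OF S z]) (simp add: A_mult_induced_metric)
  then have "l k / q k * ?L (\<lambda>w. induced_metric w $ k $ k) + ?L (\<lambda>w. A w $ k $ k) * q k -
      2 * (\<Sum>c\<in>UNIV. \<Sum>j\<in>UNIV. (1 - l k * l j) * (l k + l j) / q k * t c j) = ?L (\<lambda>w. M w $ k $ k)"
    unfolding parabolic_matrix_mult[OF S z smooth_A smooth_induced_metric] AN
    by (simp add: A_diag induced_metric_diag sum_diagonal_left sum_diagonal_right)
  then have "?L (\<lambda>w. A w $ k $ k) * q k = (1 - 2 * (l k)\<^sup>2 / q k) * ?L (\<lambda>w. M w $ k $ k) +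
      2 * (l k / q k) * (\<Sum>c\<in>UNIV. \<Sum>j\<in>UNIV. q j * t c j) +
      2 * (\<Sum>c\<in>UNIV. \<Sum>j\<in>UNIV. (1 - l k * l j) * (l k + l j) / q k * t c j)"
    unfolding parabolic_induced_metric TT by (simp add: power2_eq_square algebra_simps)
  also have "\<dots> = (\<Sum>c\<in>UNIV. \<Sum>j\<in>UNIV. 4 * (l k / q k) * t c j)"
    unfolding LM sum_distrib_left sum.distrib[symmetric]
  proof (intro sum.cong refl)
    fix c j
    let ?lhs = "(1 - 2 * (l k)\<^sup>2 / q k) * (- 2 * (l j * t c j)) + 2 * (l k / q k) * (q j * t c j) +
        2 * ((1 - l k * l j) * (l k + l j) / q k * t c j)"
    have "(1 - 2 * (l k)\<^sup>2 / q k) = (1 - (l k)\<^sup>2) / q k"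
      using qpos[of k] by (simp add: q_def field_simps)
    then have "?lhs = ((1 - (l k)\<^sup>2) * (- 2 * l j) + 2 * l k * q j + 2 * (1 - l k * l j) * (l k + l j)) * t c j / q k"
      by (simp add: add_divide_distrib diff_divide_distrib distrib_right left_diff_distrib)
    also have "(1 - (l k)\<^sup>2) * (- 2 * l j) + 2 * l k * q j + 2 * (1 - l k * l j) * (l k + l j) = 4 * l k"
      by (simp add: q_def power2_eq_square algebra_simps)
    finally show "?lhs = 4 * (l k / q k) * t c j" by simp
  qed
  finally have "?L (\<lambda>w. A w $ k $ k) = (\<Sum>c\<in>UNIV. \<Sum>j\<in>UNIV. 4 * (l k / q k) * t c j) / q k"
    using qpos[of k] by (simp add: field_simps)
  also have "\<dots> = (\<Sum>c\<in>UNIV. 4 * (l k / q k) * (\<Sum>j\<in>UNIV. (T c k j)\<^sup>2 / (q k * q j)) / q c)"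
    unfolding sum_divide_distrib sum_distrib_left by (intro sum.cong refl) (simp add: t_def mult_ac)
  finally show ?thesis .
qed

lemma smooth_second_power_A: "smooth_on (\<lambda>w. second_power (\<lambda>i j. A w $ i $ j) p r) S"
proof -
  obtain i j k m where "p = (i,j)" "r = (k,m)" by (cases p; cases r)
  then show ?thesis
    unfolding second_power_def
    by (simp only: case_prod_conv)
      (intro smooth_on_diff smooth_on_add smooth_on_mult smooth_on_const smooth_matrixD[OF smooth_A])
qed

lemma dd_second_power:
  fixes X :: "'a \<Rightarrow> real^'n::{finite,linorder}^'n::{finite,linorder}"
  assumes X: "smooth_matrix X S" and w: "w \<in> S"
  shows "dd S v (\<lambda>w. second_power (\<lambda>i j. X w $ i $ j) p r) w = second_power (\<lambda>i j. dd S v (\<lambda>w. X w $ i $ j) w) p r"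
proof -
  obtain i j k m where pr: "p = (i,j)" "r = (k,m)" by (cases p; cases r)
  note D = smooth_on_has_derivative[OF smooth_matrixD[OF X] w]
  have "((\<lambda>w. X w $ i $ k * of_bool (j = m) + X w $ j $ m * of_bool (i = k)
     - X w $ i $ m * of_bool (j = k) - X w $ j $ k * of_bool (i = m)) has_derivative
     (\<lambda>v. dd S v (\<lambda>w. X w $ i $ k) w * of_bool (j = m) + dd S v (\<lambda>w. X w $ j $ m) w * of_bool (i = k)
     - dd S v (\<lambda>w. X w $ i $ m) w * of_bool (j = k) - dd S v (\<lambda>w. X w $ j $ k) w * of_bool (i = m))) (at w within S)"
    by (intro has_derivative_diff has_derivative_add has_derivative_mult_left D)
  from dd_eq[OF S w this] show ?thesis by (simp add: second_power_def pr)
qed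

lemma second_power_self: "k < m \<Longrightarrow> second_power X (k,m) (k,m) = X k k + X m m" for k m :: 'n
  by (auto simp: second_power_def)

lemma det_second_power_A_pos:
  "w \<in> S \<Longrightarrow> det_on increasing_pairs (second_power (\<lambda>i j. A w $ i $ j)) > 0"
  unfolding A_def
  using angle det_second_power_S_matrix_pos[OF symmetric_M] by blast

text \<open>The matrix whose determinant is \<open>det S\<^sup>[\<^sup>2\<^sup>]\<close>, diagonal at \<open>z\<close>.\<close>

definition "compound_S w = padded increasing_pairs (second_power (\<lambda>i j. A w $ i $ j))"

lemma smooth_compound_S: "smooth_matrix compound_S S"
  unfolding smooth_matrix_def
proof (intro allI)
  fix p r
  show "smooth_on (\<lambda>w. compound_S w $ p $ r) S"
    by (cases "p \<in> increasing_pairs \<and> r \<in> increasing_pairs")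
      (auto simp: compound_S_def padded_def smooth_second_power_A smooth_on_const)
qed

lemma f_eq_ln_det: "f = (\<lambda>w. ln (det (compound_S w)))"
  by (simp add: f_def compound_S_def det_padded)

lemma det_compound_S_pos: "w \<in> S \<Longrightarrow> det (compound_S w) > 0"
  by (simp add: compound_S_def det_padded det_second_power_A_pos)

lemma smooth_f: "smooth_on f S"
  unfolding f_eq_ln_det by (rule smooth_on_ln[OF smooth_on_det[OF smooth_compound_S] det_compound_S_pos])

text \<open>Both sides are sums over the direction \<open>c\<close>, weighted by \<open>1 / q c\<close>, of the two sides of
  \<open>compound_inequality\<close> for the symmetric matrix \<open>T c\<close>.\<close>

lemma parabolic_log_det_ge:
  "parabolic S \<tau> d q z f \<ge> 2 * (\<Sum>c\<in>UNIV. \<Sum>i\<in>UNIV. \<Sum>j\<in>UNIV. (T c i j)\<^sup>2 / (q c * q i * q j)) +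
     1 / (real CARD('n) * (real CARD('n) - 1)) * (\<Sum>c\<in>UNIV. (dd S (d c) f z)\<^sup>2 / q c)"
proof -
  let ?I = "increasing_pairs :: ('n \<times> 'n) set"
  let ?L = "parabolic S \<tau> d q z"
  define s where "s i = l i / q i" for i
  define b where "b p = s (fst p) + s (snd p)" for p
  define \<beta> where "\<beta> p = (if p \<in> ?I then b p else 1)" for p
  define X where "X c i j = T c i j * (1 - l i * l j) / (q i * q j)" for c i j
  define t where "t c i j = (T c i j)\<^sup>2 / (q i * q j)" for c i j
  have B_nth: "compound_S w $ p $ r = (if p \<in> ?I \<and> r \<in> ?I then second_power (\<lambda>i j. A w $ i $ j) p r else of_bool (p = r))" for w p r
    by (simp add: compound_S_def padded_def)
  have Bdiag: "compound_S z $ p $ r = (if p = r then \<beta> p else 0)" for p r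
  proof (cases "p \<in> ?I \<and> r \<in> ?I")
    case True
    have "second_power (\<lambda>i j. A z $ i $ j) p r = (if p = r then s (fst p) + s (snd p) else 0)"
      by (rule second_power_diagonal) (use True in \<open>simp_all add: A_diag s_def\<close>)
    then show ?thesis using True by (simp add: B_nth b_def \<beta>_def)
  next
    case False
    then show ?thesis unfolding B_nth \<beta>_def by (cases "p = r") auto
  qed
  have dB: "dd S (d c) (\<lambda>w. compound_S w $ p $ r) z = (if p \<in> ?I \<and> r \<in> ?I then second_power (X c) p r else 0)" for c p r
  proof (cases "p \<in> ?I \<and> r \<in> ?I")
    case True
    then show ?thesis by (simp add: B_nth dd_second_power[OF smooth_A z] dd_A X_def[abs_def])
  next
    case False
    then have "(\<lambda>w. compound_S w $ p $ r) = (\<lambda>w. of_bool (p = r))" by (simp only: B_nth if_False)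
    then show ?thesis using False by (auto simp: dd_const[OF S z])
  qed
  have LB: "?L (\<lambda>w. compound_S w $ p $ p) = (if p \<in> ?I then
      (\<Sum>c\<in>UNIV. 4 * (s (fst p) * (\<Sum>j\<in>UNIV. t c (fst p) j) + s (snd p) * (\<Sum>j\<in>UNIV. t c (snd p) j)) / q c) else 0)" for p
  proof (cases "p \<in> ?I")
    case True
    obtain k m where p: "p = (k,m)" "k < m" using True by (auto simp: increasing_pairs_def)
    have "?L (\<lambda>w. compound_S w $ p $ p) = ?L (\<lambda>w. A w $ k $ k + A w $ m $ m)"
      using True by (simp add: B_nth) (simp add: p second_power_self)
    also have "\<dots> = ?L (\<lambda>w. A w $ k $ k) + ?L (\<lambda>w. A w $ m $ m)"
      by (rule parabolic_add[OF S z smooth_matrixD[OF smooth_A] smooth_matrixD[OF smooth_A]])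
    also have "\<dots> = (\<Sum>c\<in>UNIV. 4 * (s k * (\<Sum>j\<in>UNIV. t c k j) + s m * (\<Sum>j\<in>UNIV. t c m j)) / q c)"
      unfolding parabolic_A sum.distrib[symmetric]
      by (intro sum.cong refl) (simp add: s_def t_def add_divide_distrib distrib_left)
    finally show ?thesis using True by (simp add: p)
  next
    case False
    then have "(\<lambda>w. compound_S w $ p $ p) = (\<lambda>w. 1)" by (simp add: B_nth fun_eq_iff)
    then show ?thesis using False by (simp add: parabolic_const[OF S z])
  qed
  have restrict: "(\<Sum>p\<in>UNIV. if p \<in> ?I then h p else 0) = (\<Sum>p\<in>?I. h p)" for h :: "'n \<times> 'n \<Rightarrow> real"
    by (simp add: sum.If_cases)
  have Lf: "?L f = (\<Sum>c\<in>UNIV. ((\<Sum>(k,m)\<in>?I. 4 * (s k * (\<Sum>j\<in>UNIV. t c k j) + s m * (\<Sum>j\<in>UNIV. t c m j)) / (s k + s m)) +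
     (\<Sum>p\<in>?I. \<Sum>r\<in>?I. second_power (X c) p r * second_power (X c) r p / (b p * b r))) / q c)"
  proof -
    have 1: "(\<Sum>p\<in>UNIV. ?L (\<lambda>w. compound_S w $ p $ p) / \<beta> p) =
      (\<Sum>c\<in>UNIV. (\<Sum>(k,m)\<in>?I. 4 * (s k * (\<Sum>j\<in>UNIV. t c k j) + s m * (\<Sum>j\<in>UNIV. t c m j)) / (s k + s m)) / q c)"
    proof -
      have "(\<Sum>p\<in>UNIV. ?L (\<lambda>w. compound_S w $ p $ p) / \<beta> p) = (\<Sum>p\<in>UNIV. if p \<in> ?I then
         (\<Sum>c\<in>UNIV. 4 * (s (fst p) * (\<Sum>j\<in>UNIV. t c (fst p) j) + s (snd p) * (\<Sum>j\<in>UNIV. t c (snd p) j)) / b p / q c) else 0)"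
        by (intro sum.cong refl) (simp add: LB \<beta>_def sum_divide_distrib mult.commute)
      also have "\<dots> = (\<Sum>c\<in>UNIV. \<Sum>p\<in>?I. 4 * (s (fst p) * (\<Sum>j\<in>UNIV. t c (fst p) j) + s (snd p) * (\<Sum>j\<in>UNIV. t c (snd p) j)) / b p / q c)"
        unfolding restrict by (rule sum.swap)
      finally show ?thesis by (simp add: case_prod_unfold b_def sum_divide_distrib)
    qed
    have 2: "(\<Sum>p\<in>UNIV. \<Sum>r\<in>UNIV. dd S (d c) (\<lambda>w. compound_S w $ p $ r) z * dd S (d c) (\<lambda>w. compound_S w $ r $ p) z / (\<beta> p * \<beta> r)) =
      (\<Sum>p\<in>?I. \<Sum>r\<in>?I. second_power (X c) p r * second_power (X c) r p / (b p * b r))" for c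
    proof -
      have "(\<Sum>p\<in>UNIV. \<Sum>r\<in>UNIV. dd S (d c) (\<lambda>w. compound_S w $ p $ r) z * dd S (d c) (\<lambda>w. compound_S w $ r $ p) z / (\<beta> p * \<beta> r)) =
        (\<Sum>p\<in>UNIV. if p \<in> ?I then (\<Sum>r\<in>UNIV. if r \<in> ?I then
           second_power (X c) p r * second_power (X c) r p / (b p * b r) else 0) else 0)"
        by (intro sum.cong refl) (simp add: dB \<beta>_def if_distrib cong: if_cong)
      then show ?thesis by (simp only: restrict)
    qed
    have "?L f = (\<Sum>p\<in>UNIV. ?L (\<lambda>w. compound_S w $ p $ p) / \<beta> p) + (\<Sum>c\<in>UNIV. (\<Sum>p\<in>UNIV. \<Sum>r\<in>UNIV.
       dd S (d c) (\<lambda>w. compound_S w $ p $ r) z * dd S (d c) (\<lambda>w. compound_S w $ r $ p) z / (\<beta> p * \<beta> r)) / q c)"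
      unfolding f_eq_ln_det by (rule parabolic_ln_det(1)[OF S z smooth_compound_S det_compound_S_pos Bdiag])
    then show ?thesis unfolding 1 2 by (simp only: sum.distrib add_divide_distrib)
  qed
  have df: "dd S (d c) f z = (\<Sum>p\<in>?I. second_power (X c) p p / b p)" for c
  proof -
    have "dd S (d c) f z = (\<Sum>p\<in>UNIV. dd S (d c) (\<lambda>w. compound_S w $ p $ p) z / \<beta> p)"
      unfolding f_eq_ln_det by (rule parabolic_ln_det(2)[OF S z smooth_compound_S det_compound_S_pos Bdiag])
    also have "\<dots> = (\<Sum>p\<in>UNIV. if p \<in> ?I then second_power (X c) p p / b p else 0)"
      by (intro sum.cong refl) (simp add: dB \<beta>_def)
    finally show ?thesis by (simp only: restrict)
  qed
  have "2 * (\<Sum>i\<in>UNIV. \<Sum>j\<in>UNIV. t c i j) + 1 / (real CARD('n) * (real CARD('n) - 1)) * (dd S (d c) f z)\<^sup>2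
    \<le> (\<Sum>(k,m)\<in>?I. 4 * (s k * (\<Sum>j\<in>UNIV. t c k j) + s m * (\<Sum>j\<in>UNIV. t c m j)) / (s k + s m)) +
     (\<Sum>p\<in>?I. \<Sum>r\<in>?I. second_power (X c) p r * second_power (X c) r p / (b p * b r))" for c
    unfolding df b_def s_def t_def X_def[abs_def] q_def
    by (rule compound_inequality[of "T c" l, OF T_swap(1) n l_convex])
  then have "(\<Sum>c\<in>UNIV. (2 * (\<Sum>i\<in>UNIV. \<Sum>j\<in>UNIV. t c i j) + 1 / (real CARD('n) * (real CARD('n) - 1)) * (dd S (d c) f z)\<^sup>2) / q c) \<le> ?L f"
    unfolding Lf by (intro sum_mono divide_right_mono less_imp_le[OF qpos])
  moreover have "(\<Sum>c\<in>UNIV. (2 * (\<Sum>i\<in>UNIV. \<Sum>j\<in>UNIV. t c i j) + 1 / (real CARD('n) * (real CARD('n) - 1)) * (dd S (d c) f z)\<^sup>2) / q c) =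
     2 * (\<Sum>c\<in>UNIV. \<Sum>i\<in>UNIV. \<Sum>j\<in>UNIV. (T c i j)\<^sup>2 / (q c * q i * q j)) +
     1 / (real CARD('n) * (real CARD('n) - 1)) * (\<Sum>c\<in>UNIV. (dd S (d c) f z)\<^sup>2 / q c)"
  proof -
    have "(\<Sum>i\<in>UNIV. \<Sum>j\<in>UNIV. t c i j) / q c = (\<Sum>i\<in>UNIV. \<Sum>j\<in>UNIV. (T c i j)\<^sup>2 / (q c * q i * q j))" for c
      by (simp add: t_def sum_divide_distrib mult_ac)
    then have "(\<Sum>c\<in>UNIV. 2 * ((\<Sum>i\<in>UNIV. \<Sum>j\<in>UNIV. t c i j) / q c)) =
      2 * (\<Sum>c\<in>UNIV. \<Sum>i\<in>UNIV. \<Sum>j\<in>UNIV. (T c i j)\<^sup>2 / (q c * q i * q j))"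
      by (simp only: sum_distrib_left)
    then show ?thesis
      by (simp add: add_divide_distrib sum.distrib sum_distrib_left)
  qed
  ultimately show ?thesis by simp
qed

end

section \<open>Intrinsic form of the geometric operators\<close>

lemma Ck_on_sqrt: "Ck_on k (\<lambda>x::real. sqrt x) {0<..}"
proof (induction k)
  case 0
  show ?case by (auto intro: continuous_on_real_sqrt[OF continuous_on_id])
next
  case (Suc k)
  have "Ck_on k (\<lambda>x::real. v * (inverse (sqrt x) / 2)) {0<..}" for v
    unfolding divide_inverse
    by (intro Ck_on_bilinear[OF bounded_bilinear_mult] Ck_on_const Ck_on_compose[OF _ Ck_on_inverse Suc]) auto
  moreover have "(sqrt has_derivative (\<lambda>v. v * (inverse (sqrt x) / 2))) (at x within {0<..})" if "x \<in> {0<..}" for x :: real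
    using DERIV_compose_FDERIV[OF DERIV_real_sqrt has_derivative_ident, of x] that by simp
  ultimately show ?case
    by (intro Ck_on_SucI[where f'="\<lambda>x v. v * (inverse (sqrt x) / 2)"])
qed

lemma smooth_on_sqrt:
  fixes g :: "'a::euclidean_space \<Rightarrow> real"
  assumes "smooth_on g S" "\<And>x. x \<in> S \<Longrightarrow> g x > 0"
  shows "smooth_on (\<lambda>x. sqrt (g x)) S"
proof (intro smooth_on_compose[of sqrt "{0<..}", OF _ assms(1)])
  show "smooth_on sqrt {0::real<..}" unfolding smooth_on_def by (intro allI Ck_on_sqrt)
qed (use assms(2) in auto)

lemma smooth_on_inner:
  "smooth_on f S \<Longrightarrow> smooth_on g S \<Longrightarrow> smooth_on (\<lambda>x. f x \<bullet> g x) S"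
  by (rule smooth_on_bilinear[OF bounded_bilinear_inner])

lemma smooth_on_scaleR:
  "smooth_on f S \<Longrightarrow> smooth_on g S \<Longrightarrow> smooth_on (\<lambda>x. f x *\<^sub>R g x) S"
  by (rule smooth_on_bilinear[OF bounded_bilinear_scaleR])

lemma dd_commute_vector:
  fixes f :: "'a::euclidean_space \<Rightarrow> 'b::euclidean_space"
  assumes S: "thick S" and f: "smooth_on f S" and z: "z \<in> S"
  shows "dd S v (dd S w f) z = dd S w (dd S v f) z"
proof (rule euclidean_eqI)
  fix b :: 'b
  have sb: "smooth_on (\<lambda>x. f x \<bullet> b) S" by (rule smooth_on_linear[OF bounded_linear_inner_left f])
  have *: "dd S v (dd S w f) z \<bullet> b = dd S v (dd S w (\<lambda>x. f x \<bullet> b)) z" for v w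
  proof -
    have "dd S v (dd S w (\<lambda>x. f x \<bullet> b)) z = dd S v (\<lambda>x. dd S w f x \<bullet> b) z"
      by (rule dd_cong[OF _ z]) (rule dd_linear[OF S _ bounded_linear_inner_left f])
    also have "\<dots> = dd S v (dd S w f) z \<bullet> b"
      by (rule dd_linear[OF S z bounded_linear_inner_left smooth_on_dd[OF S f]])
    finally show ?thesis by simp
  qed
  show "dd S v (dd S w f) z \<bullet> b = dd S w (dd S v f) z \<bullet> b"
    unfolding * by (rule dd_commute[OF S sb z])
qed

lemma partial_eq_dd: "partial i f = dd UNIV (axis i 1) f"
  by (simp add: partial_def fun_eq_iff)

lemma smooth_on_partial: "smooth_on f UNIV \<Longrightarrow> smooth_on (partial i f) UNIV"
  unfolding partial_eq_dd by (rule smooth_on_dd[OF thick_UNIV])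

lemma dd_eq_sum_partial:
  fixes f :: "real^'n \<Rightarrow> 'b::real_normed_vector"
  assumes "smooth_on f UNIV"
  shows "dd UNIV w f x = (\<Sum>i\<in>UNIV. w $ i *\<^sub>R partial i f x)"
proof -
  have lin: "linear (\<lambda>v. dd UNIV v f x)" by (rule dd_linear_direction[OF assms UNIV_I])
  have "dd UNIV (\<Sum>i\<in>UNIV. w $ i *\<^sub>R axis i 1) f x = (\<Sum>i\<in>UNIV. w $ i *\<^sub>R partial i f x)"
    unfolding linear_sum[OF lin] linear_cmul[OF lin] partial_eq_dd ..
  moreover have "(\<Sum>i\<in>UNIV. w $ i *\<^sub>R axis i 1) = w"
    by (simp add: vec_eq_iff axis_def if_distrib sum.delta cong: if_cong)
  ultimately show ?thesis by simp
qed

lemma dd2_eq_sum_partial: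
  fixes f :: "real^'n \<Rightarrow> 'b::real_normed_vector"
  assumes "smooth_on f UNIV"
  shows "dd UNIV v (dd UNIV w f) x = (\<Sum>i\<in>UNIV. \<Sum>j\<in>UNIV. (v $ i * w $ j) *\<^sub>R partial i (partial j f) x)"
proof -
  have "dd UNIV w f = (\<lambda>y. \<Sum>j\<in>UNIV. w $ j *\<^sub>R partial j f y)"
    by (rule ext) (rule dd_eq_sum_partial[OF assms])
  then have "dd UNIV v (dd UNIV w f) x = dd UNIV v (\<lambda>y. \<Sum>j\<in>UNIV. w $ j *\<^sub>R partial j f y) x"
    by (simp only:)
  also have "\<dots> = (\<Sum>j\<in>UNIV. dd UNIV v (\<lambda>y. w $ j *\<^sub>R partial j f y) x)"
    by (rule dd_sum[OF thick_UNIV UNIV_I]) (rule smooth_on_linear[OF bounded_linear_scaleR_right smooth_on_partial[OF assms]])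
  also have "\<dots> = (\<Sum>j\<in>UNIV. w $ j *\<^sub>R dd UNIV v (partial j f) x)"
    by (simp only: dd_linear[OF thick_UNIV UNIV_I bounded_linear_scaleR_right smooth_on_partial[OF assms]])
  also have "\<dots> = (\<Sum>j\<in>UNIV. \<Sum>i\<in>UNIV. (v $ i * w $ j) *\<^sub>R partial i (partial j f) x)"
    by (simp add: dd_eq_sum_partial[OF smooth_on_partial[OF assms]] scaleR_sum_right mult.commute)
  also have "\<dots> = (\<Sum>i\<in>UNIV. \<Sum>j\<in>UNIV. (v $ i * w $ j) *\<^sub>R partial i (partial j f) x)"
    by (rule sum.swap)
  finally show ?thesis .
qed

lemma metric_nth: "metric G x $ i $ j = partial i G x \<bullet> partial j G x"
  by (simp add: metric_def)

lemma transpose_metric: "transpose (metric G x) = metric G x"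
  by (simp add: transpose_def vec_eq_iff metric_nth inner_commute)

lemma transpose_matrix_inv:
  fixes A :: "real^'n^'n"
  assumes "transpose A = A" "det A \<noteq> 0"
  shows "transpose (matrix_inv A) = matrix_inv A"
proof -
  have "A ** transpose (matrix_inv A) = transpose (matrix_inv A ** A)"
    by (simp add: matrix_transpose_mul assms(1))
  also have "\<dots> = mat 1" by (simp add: matrix_inv_mult assms(2))
  finally show ?thesis using matrix_inv_eqI by metis
qed

lemma inv_metric_sym:
  assumes "det (metric G x) \<noteq> 0"
  shows "inv_metric G x $ i $ j = inv_metric G x $ j $ i"
  using transpose_matrix_inv[OF transpose_metric assms] unfolding inv_metric_def
  by (metis (no_types, lifting) transpose_def vec_lambda_beta)

lemma inv_metric_contract:
  assumes "det (metric G x) \<noteq> 0"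
  shows "(\<Sum>k\<in>UNIV. inv_metric G x $ i $ k * (partial k G x \<bullet> partial j G x)) = (if i = j then 1 else 0)"
  using matrix_inv_mult(2)[OF assms] unfolding inv_metric_def vec_eq_iff
  by (simp add: matrix_matrix_mult_def metric_nth mat_def)

text \<open>The gradient of \<open>f\<close> as a tangent vector in the ambient space.  Unlike its components it does not
  change under reparametrisation.\<close>

definition ambient_gradient :: "(real^'n \<Rightarrow> 'b::euclidean_space) \<Rightarrow> (real^'n \<Rightarrow> real) \<Rightarrow> real^'n \<Rightarrow> 'b" where
  "ambient_gradient G f x = (\<Sum>k\<in>UNIV. \<Sum>l\<in>UNIV. (inv_metric G x $ k $ l * partial k f x) *\<^sub>R partial l G x)"

lemma ambient_gradient_partial:
  assumes "det (metric G x) \<noteq> 0"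
  shows "ambient_gradient G f x \<bullet> partial a G x = partial a f x"
proof -
  have "ambient_gradient G f x \<bullet> partial a G x =
    (\<Sum>k\<in>UNIV. partial k f x * (\<Sum>l\<in>UNIV. inv_metric G x $ k $ l * (partial l G x \<bullet> partial a G x)))"
    by (simp add: ambient_gradient_def inner_sum_left sum_distrib_left mult_ac)
  then show ?thesis
    by (simp add: inv_metric_contract[OF assms] if_distrib sum.delta cong: if_cong)
qed

lemma metric_norm_gradient:
  assumes "det (metric G x) \<noteq> 0"
  shows "(metric_norm G x (metric_gradient G f x))\<^sup>2 = (\<Sum>k\<in>UNIV. \<Sum>l\<in>UNIV. inv_metric G x $ k $ l * (partial k f x * partial l f x))"
proof -
  let ?V = "metric_gradient G f x"
  have V: "ambient_gradient G f x = (\<Sum>l\<in>UNIV. ?V $ l *\<^sub>R partial l G x)"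
    unfolding ambient_gradient_def metric_gradient_def
    by (subst sum.swap) (simp add: scaleR_sum_left inv_metric_sym[OF assms] mult.commute)
  have "(\<Sum>i\<in>UNIV. \<Sum>j\<in>UNIV. metric G x $ i $ j * ?V $ i * ?V $ j) = ambient_gradient G f x \<bullet> ambient_gradient G f x"
    unfolding V inner_sum_left inner_sum_right by (simp add: metric_nth mult_ac inner_commute)
  then have "(metric_norm G x ?V)\<^sup>2 = ambient_gradient G f x \<bullet> ambient_gradient G f x"
    by (simp add: metric_norm_def)
  also have "\<dots> = (\<Sum>k\<in>UNIV. \<Sum>l\<in>UNIV. inv_metric G x $ k $ l * partial k f x * (ambient_gradient G f x \<bullet> partial l G x))"
    by (subst (2) ambient_gradient_def) (simp add: inner_sum_right)
  finally show ?thesis by (simp add: ambient_gradient_partial[OF assms] mult.assoc)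
qed

context
  fixes G :: "real^'n \<Rightarrow> 'b::euclidean_space"
  assumes G: "smooth_on G UNIV" and immersion: "\<And>y. det (metric G y) > 0"
begin

lemma immersion_nz: "det (metric G y) \<noteq> 0"
  using immersion[of y] by simp

lemma smooth_metric: "smooth_matrix (metric G) UNIV"
  unfolding smooth_matrix_def metric_nth
  by (intro allI smooth_on_inner smooth_on_partial[OF G])

lemma smooth_inv_metric: "smooth_matrix (inv_metric G) UNIV"
  unfolding inv_metric_def[abs_def] by (rule smooth_matrix_inv[OF smooth_metric immersion_nz])

lemma dd_metric: "dd UNIV (axis m 1) (\<lambda>y. metric G y $ i $ j) x =
    partial m (partial i G) x \<bullet> partial j G x + partial i G x \<bullet> partial m (partial j G) x"
  unfolding metric_nth
  by (subst dd_bilinear[OF thick_UNIV UNIV_I bounded_bilinear_inner smooth_on_partial[OF G] smooth_on_partial[OF G]])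
    (simp add: partial_eq_dd)

text \<open>Differentiate the square of the density by Jacobi's formula; the two halves of the derivative of
  the metric contribute equally.\<close>

lemma dd_sqrt_det_metric:
  "dd UNIV (axis m 1) (\<lambda>y. sqrt (det (metric G y))) x =
    sqrt (det (metric G x)) * (\<Sum>k\<in>UNIV. \<Sum>l\<in>UNIV. inv_metric G x $ k $ l * (partial m (partial k G) x \<bullet> partial l G x))"
proof -
  let ?h = "\<lambda>y. sqrt (det (metric G y))"
  have h: "smooth_on ?h UNIV" by (rule smooth_on_sqrt[OF smooth_on_det[OF smooth_metric] immersion])
  have "dd UNIV (axis m 1) (\<lambda>y. ?h y * ?h y) x = dd UNIV (axis m 1) (\<lambda>y. det (metric G y)) x"
    using immersion by (simp add: less_imp_le)
  then have "2 * (?h x * dd UNIV (axis m 1) ?h x) =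
     det (metric G x) * trace (inv_metric G x ** dd_matrix UNIV (axis m 1) (metric G) x)"
    unfolding dd_mult[OF thick_UNIV UNIV_I h h] dd_det[OF thick_UNIV UNIV_I smooth_metric immersion_nz] inv_metric_def
    by simp
  also have "trace (inv_metric G x ** dd_matrix UNIV (axis m 1) (metric G) x) =
    (\<Sum>k\<in>UNIV. \<Sum>l\<in>UNIV. inv_metric G x $ k $ l * (partial m (partial k G) x \<bullet> partial l G x)) +
    (\<Sum>k\<in>UNIV. \<Sum>l\<in>UNIV. inv_metric G x $ k $ l * (partial m (partial l G) x \<bullet> partial k G x))"
    by (simp add: trace_matrix_mult dd_metric distrib_left sum.distrib inner_commute)
  also have "(\<Sum>k\<in>UNIV. \<Sum>l\<in>UNIV. inv_metric G x $ k $ l * (partial m (partial l G) x \<bullet> partial k G x)) =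
    (\<Sum>k\<in>UNIV. \<Sum>l\<in>UNIV. inv_metric G x $ k $ l * (partial m (partial k G) x \<bullet> partial l G x))"
    by (subst sum.swap) (simp add: inv_metric_sym[OF immersion_nz])
  finally have "2 * (?h x * dd UNIV (axis m 1) ?h x) = 2 * (?h x * (?h x *
    (\<Sum>k\<in>UNIV. \<Sum>l\<in>UNIV. inv_metric G x $ k $ l * (partial m (partial k G) x \<bullet> partial l G x))))"
    using immersion[of x] by (simp add: mult.assoc[symmetric])
  moreover have "?h x > 0" using immersion[of x] by simp
  ultimately show ?thesis by simp
qed

lemma dd_inv_metric:
  "dd UNIV (axis m 1) (\<lambda>y. inv_metric G y $ i $ j) x = - (\<Sum>k\<in>UNIV. \<Sum>l\<in>UNIV.
     inv_metric G x $ i $ k * (partial m (partial k G) x \<bullet> partial l G x + partial k G x \<bullet> partial m (partial l G) x)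
       * inv_metric G x $ l $ j)"
proof -
  have "dd_matrix UNIV (axis m 1) (inv_metric G) x =
     - (inv_metric G x ** dd_matrix UNIV (axis m 1) (metric G) x ** inv_metric G x)"
    unfolding inv_metric_def[abs_def] by (rule dd_matrix_inv[OF thick_UNIV UNIV_I smooth_metric immersion_nz])
  then have "dd UNIV (axis m 1) (\<lambda>y. inv_metric G y $ i $ j) x =
     - (\<Sum>l\<in>UNIV. \<Sum>k\<in>UNIV. inv_metric G x $ i $ k * dd UNIV (axis m 1) (\<lambda>y. metric G y $ k $ l) x * inv_metric G x $ l $ j)"
    unfolding dd_matrix_nth[symmetric] by (simp add: matrix_matrix_mult_def sum_distrib_right)
  then show ?thesis by (subst (asm) sum.swap) (simp only: dd_metric)
qed

text \<open>When the divergence is expanded, the derivative of the density cancels one half of the derivative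
  of the inverse metric.  What remains is the trace of the tensor \<open>D\<^sup>2 f - \<langle>D\<^sup>2 G, \<nabla> f\<rangle>\<close>.\<close>

lemma laplace_beltrami_eq:
  assumes f: "smooth_on f UNIV"
  shows "laplace_beltrami G f x = (\<Sum>i\<in>UNIV. \<Sum>j\<in>UNIV. inv_metric G x $ i $ j *
    (partial i (partial j f) x - partial i (partial j G) x \<bullet> ambient_gradient G f x))"
proof -
  let ?h = "\<lambda>y. sqrt (det (metric G y))" and ?P = "\<lambda>i j. inv_metric G x $ i $ j"
  define B where "B i k l = partial i (partial k G) x \<bullet> partial l G x" for i k l
  define F where "F j = partial j f x" for j
  let ?tr = "\<lambda>i. \<Sum>k\<in>UNIV. \<Sum>l\<in>UNIV. ?P k l * B i k l"
  let ?dP = "\<lambda>i j. \<Sum>k\<in>UNIV. \<Sum>l\<in>UNIV. ?P i k * (B i k l + B i l k) * ?P l j"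
  let ?term = "\<lambda>i j. ?P i j * partial i (partial j f) x + ?tr i * ?P i j * F j - ?dP i j * F j"
  have h: "smooth_on ?h UNIV" by (rule smooth_on_sqrt[OF smooth_on_det[OF smooth_metric] immersion])
  have hx: "?h x > 0" using immersion by simp
  have Psym: "?P i j = ?P j i" for i j by (rule inv_metric_sym[OF immersion_nz])
  have Bsym: "B i k l = B k i l" for i k l
    unfolding B_def partial_eq_dd by (simp only: dd_commute_vector[OF thick_UNIV G UNIV_I])
  have hP: "smooth_on (\<lambda>y. ?h y * inv_metric G y $ i $ j) UNIV" for i j
    by (rule smooth_on_mult[OF h smooth_matrixD[OF smooth_inv_metric]])
  have "partial i (\<lambda>y. \<Sum>j\<in>UNIV. ?h y * inv_metric G y $ i $ j * partial j f y) x = ?h x * (\<Sum>j\<in>UNIV. ?term i j)" for i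
  proof -
    have "partial i (\<lambda>y. \<Sum>j\<in>UNIV. ?h y * inv_metric G y $ i $ j * partial j f y) x =
      (\<Sum>j\<in>UNIV. dd UNIV (axis i 1) (\<lambda>y. ?h y * inv_metric G y $ i $ j * partial j f y) x)"
      unfolding partial_eq_dd[of i]
      by (rule dd_sum[OF thick_UNIV UNIV_I smooth_on_mult[OF hP smooth_on_partial[OF f]]])
    also have "\<dots> = (\<Sum>j\<in>UNIV. ?h x * ?term i j)"
    proof (rule sum.cong[OF refl])
      fix j
      have "dd UNIV (axis i 1) (\<lambda>y. ?h y * inv_metric G y $ i $ j * partial j f y) x =
        ?h x * ?P i j * partial i (partial j f) x + (?h x * dd UNIV (axis i 1) (\<lambda>y. inv_metric G y $ i $ j) x +
          dd UNIV (axis i 1) ?h x * ?P i j) * F j"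
        unfolding dd_mult[OF thick_UNIV UNIV_I hP smooth_on_partial[OF f]]
          dd_mult[OF thick_UNIV UNIV_I h smooth_matrixD[OF smooth_inv_metric]]
        by (simp add: partial_eq_dd F_def)
      also have "\<dots> = ?h x * ?term i j"
        unfolding dd_sqrt_det_metric dd_inv_metric B_def[symmetric]
        by (simp only: inner_commute[of "partial _ G x" "partial _ (partial _ G) x"] B_def[symmetric])
          (simp add: algebra_simps)
      finally show "dd UNIV (axis i 1) (\<lambda>y. ?h y * inv_metric G y $ i $ j * partial j f y) x =
        ?h x * ?term i j" .
    qed
    also have "\<dots> = ?h x * (\<Sum>j\<in>UNIV. ?term i j)" by (simp only: sum_distrib_left)
    finally show ?thesis .
  qed
  then have "laplace_beltrami G f x = (\<Sum>i\<in>UNIV. \<Sum>j\<in>UNIV. ?term i j)"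
    unfolding laplace_beltrami_def using hx by (simp add: sum_distrib_left[symmetric])
  also have "\<dots> = (\<Sum>i\<in>UNIV. \<Sum>j\<in>UNIV. ?P i j * partial i (partial j f) x) +
      (\<Sum>i\<in>UNIV. \<Sum>j\<in>UNIV. \<Sum>k\<in>UNIV. \<Sum>l\<in>UNIV. ?P k l * B i k l * ?P i j * F j) -
      ((\<Sum>i\<in>UNIV. \<Sum>j\<in>UNIV. \<Sum>k\<in>UNIV. \<Sum>l\<in>UNIV. ?P i k * B i k l * ?P l j * F j) +
       (\<Sum>i\<in>UNIV. \<Sum>j\<in>UNIV. \<Sum>k\<in>UNIV. \<Sum>l\<in>UNIV. ?P i k * B i l k * ?P l j * F j))"
    by (simp add: sum.distrib sum_subtractf sum_distrib_right distrib_left distrib_right)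
  also have "(\<Sum>i\<in>UNIV. \<Sum>j\<in>UNIV. \<Sum>k\<in>UNIV. \<Sum>l\<in>UNIV. ?P i k * B i l k * ?P l j * F j) =
     (\<Sum>i\<in>UNIV. \<Sum>j\<in>UNIV. \<Sum>k\<in>UNIV. \<Sum>l\<in>UNIV. ?P k l * B i k l * ?P i j * F j)"
  proof -
    have "(\<Sum>i\<in>UNIV. \<Sum>j\<in>UNIV. \<Sum>k\<in>UNIV. \<Sum>l\<in>UNIV. ?P i k * B i l k * ?P l j * F j) =
      (\<Sum>j\<in>UNIV. \<Sum>i\<in>UNIV. \<Sum>k\<in>UNIV. \<Sum>l\<in>UNIV. ?P i k * B i l k * ?P l j * F j)"
      by (rule sum.swap)
    also have "\<dots> = (\<Sum>j\<in>UNIV. \<Sum>i\<in>UNIV. \<Sum>l\<in>UNIV. \<Sum>k\<in>UNIV. ?P i k * B i l k * ?P l j * F j)"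
      by (intro sum.cong refl sum.swap)
    also have "\<dots> = (\<Sum>j\<in>UNIV. \<Sum>l\<in>UNIV. \<Sum>i\<in>UNIV. \<Sum>k\<in>UNIV. ?P i k * B l i k * ?P l j * F j)"
      by (rule sum.cong[OF refl], subst sum.swap) (simp only: Bsym)
    also have "\<dots> = (\<Sum>l\<in>UNIV. \<Sum>j\<in>UNIV. \<Sum>i\<in>UNIV. \<Sum>k\<in>UNIV. ?P i k * B l i k * ?P l j * F j)"
      by (rule sum.swap)
    finally show ?thesis .
  qed
  also have "(\<Sum>i\<in>UNIV. \<Sum>j\<in>UNIV. \<Sum>k\<in>UNIV. \<Sum>l\<in>UNIV. ?P i k * B i k l * ?P l j * F j) =
     (\<Sum>i\<in>UNIV. \<Sum>k\<in>UNIV. ?P i k * (partial i (partial k G) x \<bullet> ambient_gradient G f x))"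
  proof -
    have "partial i (partial k G) x \<bullet> ambient_gradient G f x = (\<Sum>j\<in>UNIV. \<Sum>l\<in>UNIV. B i k l * ?P l j * F j)" for i k
      unfolding ambient_gradient_def inner_sum_right
      by (intro sum.cong refl) (simp add: B_def F_def Psym mult_ac)
    then have "(\<Sum>i\<in>UNIV. \<Sum>k\<in>UNIV. ?P i k * (partial i (partial k G) x \<bullet> ambient_gradient G f x)) =
      (\<Sum>i\<in>UNIV. \<Sum>k\<in>UNIV. \<Sum>j\<in>UNIV. \<Sum>l\<in>UNIV. ?P i k * B i k l * ?P l j * F j)"
      by (simp add: sum_distrib_left mult.assoc)
    also have "\<dots> = (\<Sum>i\<in>UNIV. \<Sum>j\<in>UNIV. \<Sum>k\<in>UNIV. \<Sum>l\<in>UNIV. ?P i k * B i k l * ?P l j * F j)"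
      by (intro sum.cong refl sum.swap)
    finally show ?thesis by simp
  qed
  finally show ?thesis by (simp add: right_diff_distrib sum_subtractf)
qed

end

subsection \<open>Reparametrisation\<close>

lemma congruence_sum:
  fixes J B :: "real^'n^'n"
  shows "(transpose J ** B ** J) $ i $ j = (\<Sum>a\<in>UNIV. \<Sum>b\<in>UNIV. J $ a $ i * J $ b $ j * B $ a $ b)"
  by (simp add: matrix_matrix_mult_def transpose_def sum_distrib_right, subst sum.swap, simp add: mult_ac)

definition jacobian :: "(real^'n \<Rightarrow> real^'n) \<Rightarrow> real^'n \<Rightarrow> real^'n^'n" where
  "jacobian \<phi> x = (\<chi> a i. partial i \<phi> x $ a)"

lemma jacobian_nth: "jacobian \<phi> x $ a $ i = partial i \<phi> x $ a"
  by (simp add: jacobian_def)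

context
  fixes \<phi> :: "real^'n \<Rightarrow> real^'n"
  assumes \<phi>: "smooth_on \<phi> UNIV"
begin

lemma smooth_on_compose_UNIV:
  fixes h :: "real^'n \<Rightarrow> 'b::real_normed_vector"
  shows "smooth_on h UNIV \<Longrightarrow> smooth_on (\<lambda>x. h (\<phi> x)) UNIV"
  using smooth_on_compose[OF _ \<phi>, of h UNIV] by simp

lemma partial_compose:
  fixes h :: "real^'n \<Rightarrow> 'b::real_normed_vector"
  assumes "smooth_on h UNIV"
  shows "partial i (\<lambda>x. h (\<phi> x)) x = (\<Sum>a\<in>UNIV. partial i \<phi> x $ a *\<^sub>R partial a h (\<phi> x))"
  unfolding partial_eq_dd[of i]
  by (subst dd_compose[OF thick_UNIV UNIV_I assms \<phi>]) (auto simp: dd_eq_sum_partial[OF assms])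

lemma partial_partial_compose:
  fixes h :: "real^'n \<Rightarrow> 'b::real_normed_vector"
  assumes h: "smooth_on h UNIV"
  shows "partial i (partial j (\<lambda>x. h (\<phi> x))) x =
    (\<Sum>a\<in>UNIV. \<Sum>b\<in>UNIV. (partial i \<phi> x $ a * partial j \<phi> x $ b) *\<^sub>R partial a (partial b h) (\<phi> x)) +
    (\<Sum>b\<in>UNIV. partial i (partial j \<phi>) x $ b *\<^sub>R partial b h (\<phi> x))"
proof -
  have s1: "smooth_on (\<lambda>x. partial j \<phi> x $ b) UNIV" for b
    by (rule smooth_on_linear[OF bounded_linear_vec_nth smooth_on_partial[OF \<phi>]])
  have s2: "smooth_on (\<lambda>x. partial b h (\<phi> x)) UNIV" for b
    by (rule smooth_on_compose_UNIV[OF smooth_on_partial[OF h]])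
  have "partial j (\<lambda>x. h (\<phi> x)) = (\<lambda>x. \<Sum>b\<in>UNIV. partial j \<phi> x $ b *\<^sub>R partial b h (\<phi> x))"
    by (rule ext) (rule partial_compose[OF h])
  then have "partial i (partial j (\<lambda>x. h (\<phi> x))) x =
    dd UNIV (axis i 1) (\<lambda>x. \<Sum>b\<in>UNIV. partial j \<phi> x $ b *\<^sub>R partial b h (\<phi> x)) x"
    unfolding partial_eq_dd[of i] by (simp only:)
  also have "\<dots> = (\<Sum>b\<in>UNIV. dd UNIV (axis i 1) (\<lambda>x. partial j \<phi> x $ b *\<^sub>R partial b h (\<phi> x)) x)"
    by (rule dd_sum[OF thick_UNIV UNIV_I smooth_on_scaleR[OF s1 s2]])
  also have "\<dots> = (\<Sum>b\<in>UNIV. partial j \<phi> x $ b *\<^sub>R partial i (\<lambda>x. partial b h (\<phi> x)) x +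
      partial i (partial j \<phi>) x $ b *\<^sub>R partial b h (\<phi> x))"
    unfolding dd_bilinear[OF thick_UNIV UNIV_I bounded_bilinear_scaleR s1 s2] partial_eq_dd[of i]
    by (simp only: dd_linear[OF thick_UNIV UNIV_I bounded_linear_vec_nth smooth_on_partial[OF \<phi>]])
  also have "\<dots> = (\<Sum>b\<in>UNIV. \<Sum>a\<in>UNIV. (partial i \<phi> x $ a * partial j \<phi> x $ b) *\<^sub>R partial a (partial b h) (\<phi> x)) +
    (\<Sum>b\<in>UNIV. partial i (partial j \<phi>) x $ b *\<^sub>R partial b h (\<phi> x))"
    by (simp add: partial_compose[OF smooth_on_partial[OF h]] sum.distrib scaleR_sum_right mult.commute)
  finally show ?thesis by (subst sum.swap)
qed

lemma metric_compose:
  fixes G :: "real^'n \<Rightarrow> 'b::euclidean_space"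
  assumes "smooth_on G UNIV"
  shows "metric (\<lambda>x. G (\<phi> x)) x = transpose (jacobian \<phi> x) ** metric G (\<phi> x) ** jacobian \<phi> x"
  unfolding vec_eq_iff congruence_sum
  by (simp add: metric_nth partial_compose[OF assms] jacobian_nth inner_sum_left)
    (simp add: inner_sum_right sum_distrib_left mult.assoc)

context
  fixes G :: "real^'n \<Rightarrow> 'b::euclidean_space" and Q :: "real^'n \<Rightarrow> real"
  assumes G: "smooth_on G UNIV" and immersion: "\<And>y. det (metric G y) > 0" and Q: "smooth_on Q UNIV"
    and jac: "\<And>x. det (jacobian \<phi> x) \<noteq> 0"
begin

lemma immersion_compose: "det (metric (\<lambda>x. G (\<phi> x)) x) > 0"
proof -
  have "det (jacobian \<phi> x) * det (jacobian \<phi> x) > 0" using jac[of x] by (simp add: zero_less_mult_iff) linarith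
  then have "(det (jacobian \<phi> x) * det (jacobian \<phi> x)) * det (metric G (\<phi> x)) > 0"
    by (rule mult_pos_pos[OF _ immersion])
  then show ?thesis by (simp add: metric_compose[OF G] det_mul mult_ac)
qed

lemma inv_metric_compose_contraction:
  assumes "\<And>i j. b i j = (\<Sum>a\<in>UNIV. \<Sum>c\<in>UNIV. partial i \<phi> x $ a * partial j \<phi> x $ c * b' a c)"
  shows "(\<Sum>i\<in>UNIV. \<Sum>j\<in>UNIV. inv_metric (\<lambda>x. G (\<phi> x)) x $ i $ j * b i j) =
    (\<Sum>i\<in>UNIV. \<Sum>j\<in>UNIV. inv_metric G (\<phi> x) $ i $ j * b' i j)"
proof -
  have "(\<chi> i j. b i j) = transpose (jacobian \<phi> x) ** (\<chi> a c. b' a c) ** jacobian \<phi> x"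
    by (simp add: vec_eq_iff congruence_sum jacobian_nth assms)
  moreover have "det (metric G (\<phi> x)) \<noteq> 0" using immersion[of "\<phi> x"] by simp
  ultimately have "(\<Sum>i\<in>UNIV. \<Sum>j\<in>UNIV. inv_metric (\<lambda>x. G (\<phi> x)) x $ i $ j * (\<chi> i j. b i j) $ i $ j) =
    (\<Sum>i\<in>UNIV. \<Sum>j\<in>UNIV. inv_metric G (\<phi> x) $ i $ j * (\<chi> a c. b' a c) $ i $ j)"
    unfolding inv_metric_def by (intro inverse_contraction_congruence[OF metric_compose[OF G] _ jac])
  then show ?thesis by (simp only: vec_lambda_beta)
qed

lemma ambient_gradient_compose:
  "ambient_gradient (\<lambda>x. G (\<phi> x)) (\<lambda>x. Q (\<phi> x)) x = ambient_gradient G Q (\<phi> x)"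
proof (rule euclidean_eqI)
  fix Y :: 'b
  have "(\<Sum>i\<in>UNIV. \<Sum>j\<in>UNIV. inv_metric (\<lambda>x. G (\<phi> x)) x $ i $ j *
      (partial i (\<lambda>x. Q (\<phi> x)) x * (partial j (\<lambda>x. G (\<phi> x)) x \<bullet> Y))) =
    (\<Sum>i\<in>UNIV. \<Sum>j\<in>UNIV. inv_metric G (\<phi> x) $ i $ j * (partial i Q (\<phi> x) * (partial j G (\<phi> x) \<bullet> Y)))"
    by (rule inv_metric_compose_contraction)
      (simp add: partial_compose[OF G] partial_compose[OF Q] inner_sum_left sum_product mult_ac)
  then show "ambient_gradient (\<lambda>x. G (\<phi> x)) (\<lambda>x. Q (\<phi> x)) x \<bullet> Y = ambient_gradient G Q (\<phi> x) \<bullet> Y"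
    by (simp add: ambient_gradient_def inner_sum_left mult.assoc)
qed

text \<open>The second derivatives of \<open>\<phi>\<close> are multiplied by \<open>\<partial>\<^sub>bQ - \<langle>\<partial>\<^sub>bG, \<nabla>Q\<rangle> = 0\<close>, so
  \<open>D\<^sup>2 f - \<langle>D\<^sup>2 G, \<nabla> f\<rangle>\<close> transforms as a tensor.\<close>

lemma laplace_beltrami_compose:
  "laplace_beltrami (\<lambda>x. G (\<phi> x)) (\<lambda>x. Q (\<phi> x)) x =
    (\<Sum>i\<in>UNIV. \<Sum>j\<in>UNIV. inv_metric G (\<phi> x) $ i $ j *
      (partial i (partial j Q) (\<phi> x) - partial i (partial j G) (\<phi> x) \<bullet> ambient_gradient G Q (\<phi> x)))"
  unfolding laplace_beltrami_eq[OF smooth_on_compose_UNIV[OF G] immersion_compose smooth_on_compose_UNIV[OF Q]]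
proof (rule inv_metric_compose_contraction)
  fix i j
  have "partial b G (\<phi> x) \<bullet> ambient_gradient G Q (\<phi> x) = partial b Q (\<phi> x)" for b
    using ambient_gradient_partial[of G "\<phi> x" Q b] immersion[of "\<phi> x"] by (simp add: inner_commute)
  then show "partial i (partial j (\<lambda>x. Q (\<phi> x))) x -
      partial i (partial j (\<lambda>x. G (\<phi> x))) x \<bullet> ambient_gradient (\<lambda>x. G (\<phi> x)) (\<lambda>x. Q (\<phi> x)) x =
    (\<Sum>a\<in>UNIV. \<Sum>c\<in>UNIV. partial i \<phi> x $ a * partial j \<phi> x $ c *
      (partial a (partial c Q) (\<phi> x) - partial a (partial c G) (\<phi> x) \<bullet> ambient_gradient G Q (\<phi> x)))"
    by (simp add: partial_partial_compose[OF G] partial_partial_compose[OF Q] ambient_gradient_compose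
        inner_add_left inner_sum_left right_diff_distrib sum_subtractf)
qed

lemma metric_norm_gradient_compose:
  "(metric_norm (\<lambda>x. G (\<phi> x)) x (metric_gradient (\<lambda>x. G (\<phi> x)) (\<lambda>x. Q (\<phi> x)) x))\<^sup>2 =
    (\<Sum>k\<in>UNIV. \<Sum>l\<in>UNIV. inv_metric G (\<phi> x) $ k $ l * (partial k Q (\<phi> x) * partial l Q (\<phi> x)))"
proof -
  have "det (metric (\<lambda>x. G (\<phi> x)) x) \<noteq> 0" using immersion_compose[of x] by simp
  from metric_norm_gradient[OF this] show ?thesis
    by (rule trans) (rule inv_metric_compose_contraction, simp add: partial_compose[OF Q] sum_product mult_ac)
qed

end

end

text \<open>By the chain rule, the Jacobian of the inverse map is a left inverse.\<close>

lemma det_jacobian_diffeomorphism: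
  assumes "diffeomorphism \<phi>"
  shows "det (jacobian \<phi> x) \<noteq> 0"
proof -
  let ?\<psi> = "inv \<phi>"
  have \<phi>: "smooth_on \<phi> UNIV" and \<psi>: "smooth_on ?\<psi> UNIV" and inv: "?\<psi> (\<phi> y) = y" for y
    using assms by (auto simp: diffeomorphism_def bij_def)
  have "jacobian ?\<psi> (\<phi> x) ** jacobian \<phi> x = mat 1"
  proof -
    have "axis i 1 $ c = (\<Sum>a\<in>UNIV. partial i \<phi> x $ a * partial a ?\<psi> (\<phi> x) $ c)" for i c
    proof -
      have "partial i (\<lambda>x. ?\<psi> (\<phi> x)) x = (\<Sum>a\<in>UNIV. partial i \<phi> x $ a *\<^sub>R partial a ?\<psi> (\<phi> x))"
        by (rule partial_compose[OF \<phi> \<psi>])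
      moreover have "partial i (\<lambda>x. x) x = axis i 1"
        unfolding partial_eq_dd by (rule dd_eq[OF thick_UNIV UNIV_I has_derivative_ident])
      ultimately show ?thesis by (simp add: inv)
    qed
    then show ?thesis
      by (simp add: vec_eq_iff matrix_matrix_mult_def jacobian_nth mat_def axis_def mult.commute)
  qed
  then have "det (jacobian ?\<psi> (\<phi> x)) * det (jacobian \<phi> x) = 1" by (metis det_I det_mul)
  then show ?thesis by auto
qed

section \<open>Gradient graphs\<close>

lemma smooth_on_vec:
  fixes f :: "'a::euclidean_space \<Rightarrow> real^'n"
  assumes "\<And>i. smooth_on (\<lambda>x. f x $ i) S"
  shows "smooth_on f S"
proof -
  have eq: "f x = (\<Sum>i\<in>UNIV. f x $ i *\<^sub>R (axis i 1 :: real^'n))" for x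
    by (simp add: vec_eq_iff axis_def if_distrib sum.delta cong: if_cong)
  have "smooth_on f S \<longleftrightarrow> smooth_on (\<lambda>x. \<Sum>i\<in>UNIV. f x $ i *\<^sub>R (axis i 1 :: real^'n)) S"
    by (rule smooth_on_cong) (rule eq)
  moreover have "smooth_on (\<lambda>x. \<Sum>i\<in>UNIV. f x $ i *\<^sub>R (axis i 1 :: real^'n)) S"
    by (intro smooth_on_sum smooth_on_scaleR smooth_on_const assms)
  ultimately show ?thesis by simp
qed

lemma smooth_on_Pair:
  assumes "smooth_on f S" "smooth_on g S"
  shows "smooth_on (\<lambda>x. (f x, g x)) S"
proof -
  have "smooth_on (\<lambda>x. (f x, 0) + (0, g x)) S"
    by (rule smooth_on_add[OF smooth_on_linear[OF bounded_linear_Pair[OF bounded_linear_ident bounded_linear_zero] assms(1)]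
          smooth_on_linear[OF bounded_linear_Pair[OF bounded_linear_zero bounded_linear_ident] assms(2)]])
  then show ?thesis by simp
qed

context
  fixes v :: "real^'n \<Rightarrow> real"
  assumes v: "smooth_on v UNIV"
begin

lemma inner_gradient: "gradient v y \<bullet> w = dd UNIV w v y"
  by (simp add: gradient_def inner_vec_def dd_eq_sum_partial[OF v] mult.commute)

lemma transpose_hessian: "transpose (hessian v y) = hessian v y"
  by (simp add: transpose_def hessian_def vec_eq_iff partial_eq_dd dd_commute[OF thick_UNIV v])

lemma dd_dd_eq_hessian: "dd UNIV w (dd UNIV w' v) y = w \<bullet> (hessian v y *v w')"
  by (simp add: dd2_eq_sum_partial[OF v] inner_vec_def matrix_vector_mult_def hessian_def sum_distrib_left mult_ac)

context
  fixes G :: "real^'n \<Rightarrow> (real^'n) \<times> (real^'n)"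
  assumes G_def: "G = gradient_graph v"
begin

lemma smooth_gradient_graph: "smooth_on G UNIV"
proof -
  have "smooth_on (gradient v) UNIV"
    by (rule smooth_on_vec) (simp add: gradient_def smooth_on_partial[OF v])
  then show ?thesis unfolding G_def gradient_graph_def[abs_def] by (rule smooth_on_Pair[OF smooth_on_id])
qed

lemma fst_dd_G: "fst (dd UNIV w G y) = w"
proof -
  have "fst (dd UNIV w G y) = dd UNIV w (\<lambda>y. fst (G y)) y"
    by (rule dd_linear[OF thick_UNIV UNIV_I bounded_linear_fst smooth_gradient_graph, symmetric])
  also have "\<dots> = w"
    by (rule dd_eq[OF thick_UNIV UNIV_I]) (simp add: G_def gradient_graph_def)
  finally show ?thesis .
qed

lemma snd_dd_G: "snd (dd UNIV w G y) \<bullet> w' = dd UNIV w (dd UNIV w' v) y"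
proof -
  have bl: "bounded_linear (\<lambda>X::(real^'n) \<times> (real^'n). snd X \<bullet> w')"
    by (rule bounded_linear_compose[OF bounded_linear_inner_left bounded_linear_snd])
  have "snd (dd UNIV w G y) \<bullet> w' = dd UNIV w (\<lambda>y. snd (G y) \<bullet> w') y"
    by (rule dd_linear[OF thick_UNIV UNIV_I bl smooth_gradient_graph, symmetric])
  then show ?thesis by (simp add: G_def gradient_graph_def inner_gradient)
qed

lemma dd_G: "dd UNIV w G y = (w, hessian v y *v w)"
proof -
  have "snd (dd UNIV w G y) \<bullet> w' = (hessian v y *v w) \<bullet> w'" for w'
    unfolding snd_dd_G dd_dd_eq_hessian
    by (metis dot_lmul_matrix transpose_hessian transpose_matrix_vector)
  then have "snd (dd UNIV w G y) = hessian v y *v w" by (metis vector_eq_rdot)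
  then show ?thesis using fst_dd_G by (metis prod.collapse)
qed

lemma has_derivative_G: "(G has_derivative (\<lambda>w. (w, hessian v y *v w))) (at y)"
  using smooth_on_has_derivative[OF smooth_gradient_graph UNIV_I, of y] by (simp add: dd_G)

lemma dd_dd_G: "fst (dd UNIV w (dd UNIV w' G) y) = 0"
  "snd (dd UNIV w (dd UNIV w' G) y) \<bullet> w'' = dd UNIV w (dd UNIV w' (dd UNIV w'' v)) y"
proof -
  note s = smooth_on_dd[OF thick_UNIV smooth_gradient_graph]
  have "fst (dd UNIV w (dd UNIV w' G) y) = dd UNIV w (\<lambda>y. fst (dd UNIV w' G y)) y"
    by (rule dd_linear[OF thick_UNIV UNIV_I bounded_linear_fst s, symmetric])
  then show "fst (dd UNIV w (dd UNIV w' G) y) = 0"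
    by (simp add: fst_dd_G dd_const[OF thick_UNIV UNIV_I])
  have bl: "bounded_linear (\<lambda>X::(real^'n) \<times> (real^'n). snd X \<bullet> w'')"
    by (rule bounded_linear_compose[OF bounded_linear_inner_left bounded_linear_snd])
  have "snd (dd UNIV w (dd UNIV w' G) y) \<bullet> w'' = dd UNIV w (\<lambda>y. snd (dd UNIV w' G y) \<bullet> w'') y"
    by (rule dd_linear[OF thick_UNIV UNIV_I bl s, symmetric])
  then show "snd (dd UNIV w (dd UNIV w' G) y) \<bullet> w'' = dd UNIV w (dd UNIV w' (dd UNIV w'' v)) y"
    by (simp add: snd_dd_G)
qed

lemma metric_G: "metric G y = mat 1 + hessian v y ** hessian v y"
proof -
  have "metric G y $ i $ j = (mat 1 + hessian v y ** hessian v y) $ i $ j" for i j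
  proof -
    have "metric G y $ i $ j = (axis i 1 :: real^'n) \<bullet> axis j 1 + (\<Sum>k\<in>UNIV. hessian v y $ k $ i * hessian v y $ k $ j)"
    proof -
      have "column i (hessian v y) \<bullet> column j (hessian v y) = (\<Sum>k\<in>UNIV. hessian v y $ k $ i * hessian v y $ k $ j)"
        by (simp add: inner_vec_def column_def)
      then show ?thesis by (simp add: metric_nth partial_eq_dd dd_G matrix_vector_mult_basis)
    qed
    also have "(\<Sum>k\<in>UNIV. hessian v y $ k $ i * hessian v y $ k $ j) = (\<Sum>k\<in>UNIV. hessian v y $ i $ k * hessian v y $ k $ j)"
      using transpose_hessian[of y] by (simp add: transpose_def vec_eq_iff)
    finally show ?thesis by (simp add: mat_def matrix_matrix_mult_def inner_axis_axis)
  qed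
  then show ?thesis by (simp add: vec_eq_iff)
qed

lemma immersion_G: "det (metric G y) > 0"
  unfolding metric_G by (rule det_one_plus_square[OF transpose_hessian])

lemma immersion_G_nz: "det (metric G y) \<noteq> 0"
  using immersion_G[of y] by simp

text \<open>In an eigenbasis of the Hessian the metric is diagonal with entries \<open>1 + (l a)\<^sup>2\<close>.\<close>

lemma inv_metric_contraction_eigenbasis:
  assumes r: "eigenbasis (hessian v y) r l"
  shows "(\<Sum>i\<in>UNIV. \<Sum>j\<in>UNIV. inv_metric G y $ i $ j * b i j) =
    (\<Sum>a\<in>UNIV. (\<Sum>i\<in>UNIV. \<Sum>j\<in>UNIV. r a $ i * r a $ j * b i j) / (1 + (l a)\<^sup>2))"
proof -
  let ?R = "column_matrix r" and ?b = "\<chi> i j. b i j"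
  let ?g = "transpose ?R ** metric G y ** ?R" and ?b' = "transpose ?R ** ?b ** ?R"
  have ort: "r a \<bullet> r b = (if a = b then 1 else 0)" for a b using r by (simp add: eigenbasis_def)
  note R = orthonormal_column_matrix[of r, OF ort]
  have undo: "X = transpose (transpose ?R) ** (transpose ?R ** X ** ?R) ** transpose ?R" for X
  proof -
    have "transpose (transpose ?R) ** (transpose ?R ** X ** ?R) ** transpose ?R =
      (?R ** transpose ?R) ** X ** (?R ** transpose ?R)" by (simp only: transpose_transpose matrix_mul_assoc)
    then show ?thesis by (simp only: R matrix_mul_lid matrix_mul_rid)
  qed
  have g: "?g $ a $ b = (if a = b then 1 + (l a)\<^sup>2 else 0)" for a b
    unfolding congruence_nth metric_G using r
    by (simp add: matrix_vector_mult_add_rdistrib matrix_vector_mul_assoc[symmetric] eigenbasis_def inner_add_right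
        linear_cmul[OF matrix_vector_mul_linear] power2_eq_square)
  have nz: "1 + (l a)\<^sup>2 \<noteq> 0" for a by (simp add: add_nonneg_eq_0_iff)
  have dR: "det (transpose ?R) * det ?R = 1" using R(1) by (metis det_I det_mul)
  have "det ?g \<noteq> 0" using immersion_G_nz[of y] dR by (auto simp: det_mul)
  moreover have "det (transpose ?R) \<noteq> 0" using dR by auto
  ultimately have "(\<Sum>i\<in>UNIV. \<Sum>j\<in>UNIV. matrix_inv (metric G y) $ i $ j * ?b $ i $ j) =
     (\<Sum>i\<in>UNIV. \<Sum>j\<in>UNIV. matrix_inv ?g $ i $ j * ?b' $ i $ j)"
    by (intro inverse_contraction_congruence[OF undo undo])
  also have "\<dots> = (\<Sum>a\<in>UNIV. ?b' $ a $ a / (1 + (l a)\<^sup>2))"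
    unfolding matrix_inv_diagonal[OF g nz] by (simp add: if_distrib if_distribR cong: if_cong)
  also have "\<dots> = (\<Sum>a\<in>UNIV. (\<Sum>i\<in>UNIV. \<Sum>j\<in>UNIV. r a $ i * r a $ j * b i j) / (1 + (l a)\<^sup>2))"
    by (simp add: congruence_sum column_matrix_def)
  finally show ?thesis by (simp add: inv_metric_def)
qed

lemma linear_normal_part: "linear (normal_part G y)"
  by (rule linearI) (simp_all add: normal_part_def inner_add_left algebra_simps sum.distrib
      scaleR_add_left scaleR_sum_right)

lemma normal_part_partial: "normal_part G y V \<bullet> partial k G y = 0"
proof -
  have "(\<Sum>i\<in>UNIV. \<Sum>j\<in>UNIV. inv_metric G y $ i $ j * (V \<bullet> partial i G y) * (partial j G y \<bullet> partial k G y)) =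
     (\<Sum>i\<in>UNIV. (V \<bullet> partial i G y) * (\<Sum>j\<in>UNIV. inv_metric G y $ i $ j * (partial j G y \<bullet> partial k G y)))"
    by (simp add: sum_distrib_left mult_ac)
  also have "\<dots> = V \<bullet> partial k G y"
    by (simp add: inv_metric_contract[OF immersion_G_nz] if_distrib sum.delta cong: if_cong)
  finally show ?thesis by (simp add: normal_part_def inner_diff_left inner_sum_left)
qed

lemma inner_normal_part:
  "normal_part G y V \<bullet> normal_part G y V =
    V \<bullet> V - (\<Sum>i\<in>UNIV. \<Sum>j\<in>UNIV. inv_metric G y $ i $ j * ((V \<bullet> partial i G y) * (V \<bullet> partial j G y)))"
proof -
  have "normal_part G y V \<bullet> normal_part G y V = normal_part G y V \<bullet> V"
    by (subst (2) normal_part_def) (simp add: inner_diff_right inner_sum_right normal_part_partial)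
  then show ?thesis
    by (simp add: normal_part_def inner_diff_left inner_sum_left inner_commute[of "partial _ G y" V] mult.assoc)
qed

text \<open>Second derivatives of \<open>G\<close> are vertical, so only the tangential projection contributes to the
  horizontal part of the mean curvature vector, and pairing it with \<open>DQ\<close> produces the gradient of
  \<open>Q\<close>.  The right-hand side is the first-order part of the Laplace-Beltrami operator.\<close>

lemma dd_fst_mean_curvature:
  assumes Q: "smooth_on Q UNIV"
  shows "dd UNIV (fst (mean_curvature_vector G y)) Q y =
    - (\<Sum>i\<in>UNIV. \<Sum>j\<in>UNIV. inv_metric G y $ i $ j * (partial i (partial j G) y \<bullet> ambient_gradient G Q y))"
proof -
  note lin = dd_linear_direction[OF Q UNIV_I, of y]
  have N: "dd UNIV (fst (normal_part G y V)) Q y = - (V \<bullet> ambient_gradient G Q y)" if "fst V = 0" for V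
  proof -
    have "fst (normal_part G y V) = - (\<Sum>i\<in>UNIV. \<Sum>j\<in>UNIV. (inv_metric G y $ i $ j * (V \<bullet> partial i G y)) *\<^sub>R axis j 1)"
      by (simp add: normal_part_def fst_sum that partial_eq_dd fst_dd_G)
    then have "dd UNIV (fst (normal_part G y V)) Q y =
      - (\<Sum>i\<in>UNIV. \<Sum>j\<in>UNIV. (inv_metric G y $ i $ j * (V \<bullet> partial i G y)) * partial j Q y)"
      by (simp add: linear_neg[OF lin] linear_sum[OF lin] linear_cmul[OF lin] partial_eq_dd)
    also have "(\<Sum>i\<in>UNIV. \<Sum>j\<in>UNIV. (inv_metric G y $ i $ j * (V \<bullet> partial i G y)) * partial j Q y) =
      (\<Sum>j\<in>UNIV. \<Sum>i\<in>UNIV. inv_metric G y $ j $ i * partial j Q y * (V \<bullet> partial i G y))"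
      by (subst sum.swap) (simp add: inv_metric_sym[OF immersion_G_nz, of y] mult_ac)
    also have "\<dots> = V \<bullet> ambient_gradient G Q y"
      by (simp add: ambient_gradient_def inner_sum_right)
    finally show ?thesis .
  qed
  have "fst (mean_curvature_vector G y) = (\<Sum>i\<in>UNIV. \<Sum>j\<in>UNIV. inv_metric G y $ i $ j *\<^sub>R
     fst (normal_part G y (partial i (partial j G) y)))"
    by (simp add: mean_curvature_vector_def second_fundamental_form_def fst_sum)
  then have "dd UNIV (fst (mean_curvature_vector G y)) Q y = (\<Sum>i\<in>UNIV. \<Sum>j\<in>UNIV. inv_metric G y $ i $ j *
     dd UNIV (fst (normal_part G y (partial i (partial j G) y))) Q y)"
    by (simp add: linear_sum[OF lin] linear_cmul[OF lin])
  also have "\<dots> = (\<Sum>i\<in>UNIV. \<Sum>j\<in>UNIV. inv_metric G y $ i $ j * - (partial i (partial j G) y \<bullet> ambient_gradient G Q y))"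
    by (intro sum.cong refl, subst N) (simp_all add: partial_eq_dd dd_dd_G(1))
  finally show ?thesis by (simp add: sum_negf)
qed

text \<open>The normal part of a vertical vector \<open>(0, Y)\<close> has squared length
  \<open>\<Sum>c. (Y \<bullet> r c)\<^sup>2 / (1 + (l c)\<^sup>2)\<close>: the tangential part takes the fraction
  \<open>(l c)\<^sup>2 / (1 + (l c)\<^sup>2)\<close> of each component.\<close>

lemma sff_norm_squared_eigenbasis:
  assumes r: "eigenbasis (hessian v y) r l"
  shows "sff_norm_squared G y = (\<Sum>a\<in>UNIV. \<Sum>b\<in>UNIV. \<Sum>c\<in>UNIV.
    (dd UNIV (r a) (dd UNIV (r b) (dd UNIV (r c) v)) y)\<^sup>2 / ((1 + (l a)\<^sup>2) * (1 + (l b)\<^sup>2) * (1 + (l c)\<^sup>2)))"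
proof -
  let ?P = "\<lambda>i j. inv_metric G y $ i $ j" and ?q = "\<lambda>a. 1 + (l a)\<^sup>2"
  let ?II = "second_fundamental_form G y"
  let ?C = "\<lambda>a b j k. \<Sum>i\<in>UNIV. \<Sum>m\<in>UNIV. r b $ j * r b $ k * (r a $ i * r a $ m * (?II i j \<bullet> ?II m k))"
  have q: "?q a > 0" for a by (simp add: add_pos_nonneg)
  have ort: "r a \<bullet> r b = (if a = b then 1 else 0)" for a b using r by (simp add: eigenbasis_def)
  have norm: "normal_part G y (dd UNIV (r a) (dd UNIV (r b) G) y) \<bullet> normal_part G y (dd UNIV (r a) (dd UNIV (r b) G) y) =
    (\<Sum>c\<in>UNIV. (dd UNIV (r a) (dd UNIV (r b) (dd UNIV (r c) v)) y)\<^sup>2 / ?q c)" for a b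
  proof -
    define V where "V = dd UNIV (r a) (dd UNIV (r b) G) y"
    define Y where "Y = snd V"
    have V: "V = (0, Y)" by (simp add: prod_eq_iff V_def Y_def dd_dd_G(1))
    have Yr: "Y \<bullet> r c = dd UNIV (r a) (dd UNIV (r b) (dd UNIV (r c) v)) y" for c
      unfolding Y_def V_def by (rule dd_dd_G(2))
    have "(\<Sum>i\<in>UNIV. \<Sum>j\<in>UNIV. r c $ i * r c $ j * ((V \<bullet> partial i G y) * (V \<bullet> partial j G y))) = (l c)\<^sup>2 * (Y \<bullet> r c)\<^sup>2" for c
    proof -
      have "(\<Sum>i\<in>UNIV. r c $ i * (V \<bullet> partial i G y)) = V \<bullet> dd UNIV (r c) G y"
        by (simp add: dd_eq_sum_partial[OF smooth_gradient_graph] inner_sum_right)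
      also have "\<dots> = l c * (Y \<bullet> r c)" using r by (simp add: dd_G V eigenbasis_def)
      finally have "(\<Sum>i\<in>UNIV. r c $ i * (V \<bullet> partial i G y)) * (\<Sum>j\<in>UNIV. r c $ j * (V \<bullet> partial j G y)) = (l c)\<^sup>2 * (Y \<bullet> r c)\<^sup>2"
        by (simp add: power2_eq_square)
      then show ?thesis by (simp add: sum_product mult_ac)
    qed
    then have "normal_part G y V \<bullet> normal_part G y V = Y \<bullet> Y - (\<Sum>c\<in>UNIV. (l c)\<^sup>2 * (Y \<bullet> r c)\<^sup>2 / ?q c)"
      unfolding inner_normal_part inv_metric_contraction_eigenbasis[OF r] by (simp add: V)
    also have "Y \<bullet> Y = (\<Sum>c\<in>UNIV. (Y \<bullet> r c)\<^sup>2)"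
    proof -
      note R = orthonormal_column_matrix[of r, OF ort]
      have "Y \<bullet> Y = Y \<bullet> (column_matrix r *v (transpose (column_matrix r) *v Y))"
        by (simp only: matrix_vector_mul_assoc R matrix_vector_mul_lid)
      also have "\<dots> = (transpose (column_matrix r) *v Y) \<bullet> (transpose (column_matrix r) *v Y)"
        by (simp add: dot_lmul_matrix)
      also have "\<dots> = (\<Sum>c\<in>UNIV. (Y \<bullet> r c)\<^sup>2)"
        by (simp only: inner_vec_def[of "_ *v _"])
          (simp add: matrix_vector_mult_def transpose_def column_matrix_def inner_vec_def power2_eq_square mult.commute del: transpose_matrix_vector)
      finally show ?thesis .
    qed
    also have "(\<Sum>c\<in>UNIV. (Y \<bullet> r c)\<^sup>2) - (\<Sum>c\<in>UNIV. (l c)\<^sup>2 * (Y \<bullet> r c)\<^sup>2 / ?q c) = (\<Sum>c\<in>UNIV. (Y \<bullet> r c)\<^sup>2 / ?q c)"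
    proof -
      have "x - (l c)\<^sup>2 * x / ?q c = x / ?q c" for x c
        using q[of c] by (simp add: field_simps)
      then show ?thesis by (simp only: sum_subtractf[symmetric])
    qed
    finally show ?thesis by (simp only: V_def Yr)
  qed
  have "sff_norm_squared G y = (\<Sum>j\<in>UNIV. \<Sum>k\<in>UNIV. ?P j k * (\<Sum>i\<in>UNIV. \<Sum>m\<in>UNIV. ?P i m * (?II i j \<bullet> ?II m k)))"
  proof -
    have "sff_norm_squared G y = (\<Sum>i\<in>UNIV. \<Sum>j\<in>UNIV. \<Sum>k\<in>UNIV. \<Sum>m\<in>UNIV. ?P j k * (?P i m * (?II i j \<bullet> ?II m k)))"
      unfolding sff_norm_squared_def
      by (rule sum.cong[OF refl], rule sum.cong[OF refl], subst sum.swap) (simp add: mult_ac)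
    also have "\<dots> = (\<Sum>j\<in>UNIV. \<Sum>i\<in>UNIV. \<Sum>k\<in>UNIV. \<Sum>m\<in>UNIV. ?P j k * (?P i m * (?II i j \<bullet> ?II m k)))"
      by (rule sum.swap)
    also have "\<dots> = (\<Sum>j\<in>UNIV. \<Sum>k\<in>UNIV. \<Sum>i\<in>UNIV. \<Sum>m\<in>UNIV. ?P j k * (?P i m * (?II i j \<bullet> ?II m k)))"
      by (intro sum.cong refl sum.swap)
    finally show ?thesis by (simp only: sum_distrib_left)
  qed
  also have "\<dots> = (\<Sum>b\<in>UNIV. (\<Sum>j\<in>UNIV. \<Sum>k\<in>UNIV. r b $ j * r b $ k *
      (\<Sum>a\<in>UNIV. (\<Sum>i\<in>UNIV. \<Sum>m\<in>UNIV. r a $ i * r a $ m * (?II i j \<bullet> ?II m k)) / ?q a)) / ?q b)"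
    unfolding inv_metric_contraction_eigenbasis[OF r] ..
  also have "\<dots> = (\<Sum>b\<in>UNIV. \<Sum>a\<in>UNIV. (\<Sum>j\<in>UNIV. \<Sum>k\<in>UNIV. ?C a b j k)
      / (?q a * ?q b))"
  proof (rule sum.cong[OF refl])
    fix b
    let ?lhs = "(\<Sum>j\<in>UNIV. \<Sum>k\<in>UNIV. r b $ j * r b $ k *
      (\<Sum>a\<in>UNIV. (\<Sum>i\<in>UNIV. \<Sum>m\<in>UNIV. r a $ i * r a $ m * (?II i j \<bullet> ?II m k)) / ?q a)) / ?q b"
    have "?lhs =
      (\<Sum>j\<in>UNIV. \<Sum>k\<in>UNIV. \<Sum>a\<in>UNIV. ?C a b j k / (?q a * ?q b))"
      by (simp add: sum_distrib_left sum_divide_distrib)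
    also have "\<dots> = (\<Sum>j\<in>UNIV. \<Sum>a\<in>UNIV. \<Sum>k\<in>UNIV. ?C a b j k / (?q a * ?q b))"
      by (intro sum.cong refl sum.swap)
    also have "\<dots> = (\<Sum>a\<in>UNIV. \<Sum>j\<in>UNIV. \<Sum>k\<in>UNIV. ?C a b j k / (?q a * ?q b))"
      by (rule sum.swap)
    finally show "?lhs =
      (\<Sum>a\<in>UNIV. (\<Sum>j\<in>UNIV. \<Sum>k\<in>UNIV. ?C a b j k)
      / (?q a * ?q b))" by (simp only: sum_divide_distrib)
  qed
  also have "\<dots> = (\<Sum>b\<in>UNIV. \<Sum>a\<in>UNIV. (\<Sum>c\<in>UNIV. (dd UNIV (r a) (dd UNIV (r b) (dd UNIV (r c) v)) y)\<^sup>2 / ?q c) / (?q a * ?q b))"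
  proof -
    have "(\<Sum>j\<in>UNIV. \<Sum>k\<in>UNIV. ?C a b j k) =
      (\<Sum>c\<in>UNIV. (dd UNIV (r a) (dd UNIV (r b) (dd UNIV (r c) v)) y)\<^sup>2 / ?q c)" for a b
    proof -
      have N: "normal_part G y (dd UNIV (r a) (dd UNIV (r b) G) y) = (\<Sum>j\<in>UNIV. \<Sum>i\<in>UNIV. (r a $ i * r b $ j) *\<^sub>R ?II i j)"
        unfolding dd2_eq_sum_partial[OF smooth_gradient_graph] linear_sum[OF linear_normal_part] linear_cmul[OF linear_normal_part]
          second_fundamental_form_def by (rule sum.swap)
      have "(\<Sum>j\<in>UNIV. \<Sum>k\<in>UNIV. ?C a b j k) =
        (\<Sum>j\<in>UNIV. \<Sum>i\<in>UNIV. \<Sum>k\<in>UNIV. \<Sum>m\<in>UNIV. (r a $ i * r b $ j) * ((r a $ m * r b $ k) * (?II i j \<bullet> ?II m k)))"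
        by (rule sum.cong[OF refl], subst sum.swap) (simp add: mult_ac)
      also have "\<dots> = normal_part G y (dd UNIV (r a) (dd UNIV (r b) G) y) \<bullet> normal_part G y (dd UNIV (r a) (dd UNIV (r b) G) y)"
        unfolding N by (simp only: inner_sum_left inner_sum_right inner_scaleR_left inner_scaleR_right)
          (simp add: sum_distrib_left mult_ac inner_commute)
      finally show ?thesis by (simp only: norm)
    qed
    then show ?thesis by (simp only:)
  qed
  also have "\<dots> = (\<Sum>a\<in>UNIV. \<Sum>b\<in>UNIV. (\<Sum>c\<in>UNIV. (dd UNIV (r a) (dd UNIV (r b) (dd UNIV (r c) v)) y)\<^sup>2 / ?q c) / (?q a * ?q b))"
    by (rule sum.swap)
  finally show ?thesis by (simp add: sum_divide_distrib mult_ac)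
qed

end

end

section \<open>Time slices\<close>

lemma smooth_on_slice:
  fixes h :: "'a::euclidean_space \<times> real \<Rightarrow> 'b::real_normed_vector"
  assumes "smooth_on h (UNIV \<times> I)" "t \<in> I"
  shows "smooth_on (\<lambda>y. h (y, t)) UNIV"
  by (rule smooth_on_compose[OF assms(1) smooth_on_Pair[OF smooth_on_id smooth_on_const]]) (use assms(2) in auto)

lemma dd_slice:
  fixes h :: "'a::euclidean_space \<times> real \<Rightarrow> 'b::real_normed_vector"
  assumes "smooth_on h (UNIV \<times> I)" "t \<in> I"
  shows "dd UNIV w (\<lambda>y. h (y, t)) y = dd (UNIV \<times> I) (w, 0) h (y, t)"
proof -
  have "dd UNIV w (\<lambda>y. (y, t)) y = (w, 0)"
    by (rule dd_eq[OF thick_UNIV UNIV_I has_derivative_Pair[OF has_derivative_ident has_derivative_const]])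
  moreover have "dd UNIV w (\<lambda>y. h (y, t)) y = dd (UNIV \<times> I) (dd UNIV w (\<lambda>y. (y, t)) y) h (y, t)"
    by (rule dd_compose[OF thick_UNIV UNIV_I assms(1) smooth_on_Pair[OF smooth_on_id smooth_on_const]])
      (use assms(2) in auto)
  ultimately show ?thesis by simp
qed

lemma dd_dd_slice:
  fixes h :: "'a::euclidean_space \<times> real \<Rightarrow> 'b::real_normed_vector"
  assumes S: "thick ((UNIV :: 'a set) \<times> I)" and h: "smooth_on h (UNIV \<times> I)" and t: "t \<in> I"
  shows "dd UNIV w (dd UNIV w' (\<lambda>y. h (y, t))) y = dd (UNIV \<times> I) (w, 0) (dd (UNIV \<times> I) (w', 0) h) (y, t)"
proof -
  have "dd UNIV w' (\<lambda>y. h (y, t)) = (\<lambda>y. dd (UNIV \<times> I) (w', 0) h (y, t))"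
    by (rule ext) (rule dd_slice[OF h t])
  then show ?thesis using dd_slice[OF smooth_on_dd[OF S h] t] by simp
qed

lemma time_interval_nontrivial:
  fixes t :: real
  assumes "thick ((UNIV :: 'a::euclidean_space set) \<times> I)" "t \<in> I"
  shows "at t within I \<noteq> bot"
proof -
  have "\<exists>s\<in>I. s \<noteq> t \<and> dist s t < e" if e: "e > 0" for e
  proof -
    have "(0, 1) \<in> (Basis :: ('a \<times> real) set)" by (simp add: Basis_prod_def)
    then obtain d where "0 < \<bar>d\<bar>" "\<bar>d\<bar> < e" "(0, t) + d *\<^sub>R (0, 1) \<in> (UNIV :: 'a set) \<times> I"
      using assms e unfolding thick_def by (metis SigmaI UNIV_I)
    then show ?thesis by (intro bexI[of _ "t + d"]) (auto simp: dist_real_def)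
  qed
  then have "t islimpt I" by (simp add: islimpt_approachable)
  then show ?thesis by (simp add: trivial_limit_within)
qed

lemma has_vector_derivative_along_curve:
  fixes h :: "'a::euclidean_space \<times> real \<Rightarrow> real"
  assumes S: "thick ((UNIV :: 'a set) \<times> I)" and h: "smooth_on h (UNIV \<times> I)" and t: "t \<in> I"
    and c: "(c has_vector_derivative V) (at t within I)"
  shows "((\<lambda>s. h (c s, s)) has_vector_derivative
    dd (UNIV \<times> I) (V, 0) h (c t, t) + dd (UNIV \<times> I) (0, 1) h (c t, t)) (at t within I)"
proof -
  let ?S = "(UNIV :: 'a set) \<times> I"
  have z: "(c t, t) \<in> ?S" using t by simp
  have "((\<lambda>s. (c s, s)) has_derivative (\<lambda>k. (k *\<^sub>R V, k))) (at t within I)"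
    by (rule has_derivative_Pair[OF c[unfolded has_vector_derivative_def] has_derivative_ident])
  moreover have "(h has_derivative (\<lambda>v. dd ?S v h (c t, t))) (at (c t, t) within (\<lambda>s. (c s, s)) ` I)"
    by (rule has_derivative_subset[OF smooth_on_has_derivative[OF h z]]) auto
  ultimately have D: "((\<lambda>s. h (c s, s)) has_derivative (\<lambda>k. dd ?S (k *\<^sub>R V, k) h (c t, t))) (at t within I)"
    by (rule has_derivative_in_compose)
  note lin = dd_linear_direction[OF h z]
  have "dd ?S (k *\<^sub>R V, k) h (c t, t) = k *\<^sub>R (dd ?S (V, 0) h (c t, t) + dd ?S (0, 1) h (c t, t))" for k
  proof -
    have "(k *\<^sub>R V, k) = k *\<^sub>R ((V, 0) + (0, 1))" by simp
    then show ?thesis by (simp only: linear_cmul[OF lin] linear_add[OF lin])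
  qed
  then show ?thesis using D by (simp add: has_vector_derivative_def)
qed

section \<open>The differential inequality\<close>

theorem proposition4p2:
  fixes u :: "real^'n::{finite,linorder} \<Rightarrow> real \<Rightarrow> real"
    and T :: ereal
    and \<phi> :: "real \<Rightarrow> real^'n::{finite,linorder} \<Rightarrow> real^'n::{finite,linorder}"
    and F :: "real^'n::{finite,linorder} \<Rightarrow> real
        \<Rightarrow> (real^'n::{finite,linorder}) \<times> (real^'n::{finite,linorder})"
    and f :: "real^'n::{finite,linorder} \<Rightarrow> real \<Rightarrow> real"
    and A2 :: "real^'n::{finite,linorder} \<Rightarrow> real \<Rightarrow> real"
  assumes n_ge_2: "CARD('n) \<ge> 2"
    and T_pos: "0 < T"
    and u_smooth: "smooth_on (\<lambda>(x, t). u x t) (UNIV \<times> time_interval T)"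
    and u_solution: "\<And>x t. t \<in> time_interval T \<Longrightarrow>
      ((\<lambda>s. complex_of_real (u x s)) has_vector_derivative
         1 / \<i> * log_unit_det (hessian (\<lambda>y. u y t) x)) (at t within time_interval T)"
    and u_convex: "\<And>t. t \<in> time_interval T \<Longrightarrow> strictly_2_convex (\<lambda>y. u y t)"
    and phi_smooth: "smooth_on (\<lambda>(x, t). \<phi> t x) (UNIV \<times> time_interval T)"
    and phi_diffeo: "\<And>t. t \<in> time_interval T \<Longrightarrow> diffeomorphism (\<phi> t)"
    and F_eq: "\<And>x t. F x t = gradient_graph (\<lambda>y. u y t) (\<phi> t x)"
    and mcf: "\<And>x t. t \<in> time_interval T \<Longrightarrow>
      ((\<lambda>s. F x s) has_vector_derivative
         mean_curvature_vector (gradient_graph (\<lambda>y. u y t)) (\<phi> t x))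
        (at t within time_interval T)"
    and f_eq: "\<And>x t. f x t = ln (det_S2 (\<lambda>y. u y t) (\<phi> t x))"
    and A2_eq: "\<And>x t. A2 x t = sff_norm_squared (gradient_graph (\<lambda>y. u y t)) (\<phi> t x)"
    and t: "t \<in> time_interval T"
  shows "vector_derivative (\<lambda>s. f x s) (at t within time_interval T)
           - laplace_beltrami (\<lambda>y. F y t) (\<lambda>y. f y t) x
         \<ge> 2 * A2 x t
           + 1 / (real CARD('n) * (real CARD('n) - 1)) *
             (metric_norm (\<lambda>y. F y t) x (metric_gradient (\<lambda>y. F y t) (\<lambda>y. f y t) x))\<^sup>2"
proof -
  define I where "I = time_interval T"
  define S where "S = (UNIV :: (real^'n::{finite,linorder}) set) \<times> I"
  define U where "U = (\<lambda>(x, t). u x t)"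
  have S: "thick S" unfolding S_def I_def by (rule thick_space_time[OF T_pos])
  have U: "smooth_on U S" using u_smooth by (simp add: U_def S_def I_def)
  have tI: "t \<in> I" using t by (simp add: I_def)
  note S' = S[unfolded S_def] and U' = U[unfolded S_def]
  have slice: "(\<lambda>y. u y s) = (\<lambda>y. U (y, s))" for s by (simp add: U_def)
  have v: "smooth_on (\<lambda>y. u y s) UNIV" if "s \<in> I" for s
    unfolding slice by (rule smooth_on_slice[OF U' that])

  define y where "y = \<phi> t x"
  define G where "G = gradient_graph (\<lambda>y. u y t)"
  define z where "z = (y, t)"
  have z: "z \<in> S" using tI by (simp add: z_def S_def)
  obtain r l where r: "eigenbasis (hessian (\<lambda>y. u y t) y) r l"
    using symmetric_eigenbasis[OF transpose_hessian[OF v[OF tI]]] .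
  have ort: "r a \<bullet> r b = (if a = b then 1 else 0)" for a b using r by (simp add: eigenbasis_def)
  note R = orthonormal_column_matrix[of r, OF ort]
  define d where "d a = (r a, 0 :: real)" for a
  define M where "M = (\<lambda>w. \<chi> a b. dd S (d a) (dd S (d b) U) w)"
  define A where "A = (\<lambda>w. S_matrix (M w))"
  define h where "h = (\<lambda>w. ln (det_on increasing_pairs (second_power (\<lambda>i j. A w $ i $ j))))"
  define q where "q = (\<lambda>i. 1 + (l i)\<^sup>2)"
  define D3 where "D3 = (\<lambda>c i j. dd S (d c) (dd S (d i) (dd S (d j) U)) z)"

  have M_eq: "M (y, s) = transpose (column_matrix r) ** hessian (\<lambda>y. u y s) y ** column_matrix r"
    if "s \<in> I" for y s
    unfolding M_def vec_eq_iff congruence_nth vec_lambda_beta dd_dd_eq_hessian[OF v[OF that], symmetric]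
    unfolding slice S_def d_def by (simp add: dd_dd_slice[OF S' U' that])
  \<comment> \<open>the equation, read as \<open>u\<^sub>t = \<Theta>\<close>\<close>
  have angle: "\<exists>k. eigenvalues (M w) k \<and> (\<forall>i j. i \<noteq> j \<longrightarrow> k i + k j > 0 \<and> 1 + k i * k j > 0) \<and>
      dd S (0, 1) U w = (\<Sum>i\<in>UNIV. arctan (k i))" if "w \<in> S" for w
  proof -
    obtain y s where w: "w = (y, s)" "s \<in> I" using \<open>w \<in> S\<close> by (auto simp: S_def)
    obtain k where k: "eigenvalues (hessian (\<lambda>y. u y s) y) k"
      "\<forall>i j. i \<noteq> j \<longrightarrow> k i + k j > 0 \<and> 1 + k i * k j > 0"
      using u_convex[of s] w(2) unfolding strictly_2_convex_def I_def by blast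
    have "((\<lambda>s. complex_of_real (u y s)) has_vector_derivative complex_of_real (\<Sum>i\<in>UNIV. arctan (k i))) (at s within I)"
      using u_solution[of s y] w(2) by (simp add: log_unit_det_eq[OF k(1)] I_def)
    then have "((\<lambda>s. Re (complex_of_real (u y s))) has_vector_derivative Re (complex_of_real (\<Sum>i\<in>UNIV. arctan (k i)))) (at s within I)"
      by (rule bounded_linear.has_vector_derivative[OF bounded_linear_Re])
    then have "((\<lambda>s. u y s) has_vector_derivative (\<Sum>i\<in>UNIV. arctan (k i))) (at s within I)" by simp
    moreover have "((\<lambda>s. u y s) has_vector_derivative dd S (0, 1) U w) (at s within I)"
    proof -
      have "((\<lambda>s. U (y, s)) has_vector_derivative
        dd (UNIV \<times> I) (0, 0) U (y, s) + dd (UNIV \<times> I) (0, 1) U (y, s)) (at s within I)"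
        by (rule has_vector_derivative_along_curve[OF S' U' w(2) has_vector_derivative_const])
      moreover have "dd (UNIV \<times> I) (0, 0) U (y, s) = 0"
        using linear_0[OF dd_linear_direction[OF U', of "(y, s)"]] w(2) by (simp add: zero_prod_def)
      ultimately show ?thesis by (simp add: U_def S_def w(1))
    qed
    ultimately have "dd S (0, 1) U w = (\<Sum>i\<in>UNIV. arctan (k i))"
      using vector_derivative_unique_within[OF time_interval_nontrivial[OF S' w(2)]] by blast
    moreover have "eigenvalues (M w) k"
      unfolding w(1) M_eq[OF w(2)] eigenvalues_similar[OF R] by (rule k(1))
    ultimately show ?thesis using k(2) by blast
  qed
  have diag: "M z $ i $ j = (if i = j then l i else 0)" for i j
    unfolding z_def M_eq[OF tI] congruence_nth using r by (simp add: eigenbasis_def)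
  note core = S z U n_ge_2 M_def A_def h_def q_def D3_def angle diag
  have h: "smooth_on h S" by (rule smooth_f[OF core])
  note h' = h[unfolded S_def]

  have h_eq: "h (y, s) = ln (det_S2 (\<lambda>y. u y s) y)" if "s \<in> I" for y s
  proof -
    note sym = transpose_hessian[OF v[OF that], of y]
    have "det (mat 1 + hessian (\<lambda>y. u y s) y ** hessian (\<lambda>y. u y s) y) \<noteq> 0"
      using det_one_plus_square[OF sym] by simp
    from det_second_power_S_matrix_similar[OF R this] show ?thesis
      using det_S2_eq[OF has_derivative_G[OF v[OF that] refl] sym] by (simp add: h_def A_def M_eq[OF that])
  qed
  define Q where "Q y = h (y, t)" for y
  have Q: "smooth_on Q UNIV" unfolding Q_def[abs_def] by (rule smooth_on_slice[OF h' tI])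
  have dQ: "dd UNIV w Q y = dd S (w, 0) h z" for w
    unfolding Q_def[abs_def] S_def z_def by (rule dd_slice[OF h' tI])
  have ddQ: "dd UNIV w (dd UNIV w' Q) y = dd S (w, 0) (dd S (w', 0) h) z" for w w'
    unfolding Q_def[abs_def] S_def z_def by (rule dd_dd_slice[OF S' h' tI])
  have ft: "(\<lambda>y. f y t) = (\<lambda>x. Q (\<phi> t x))" by (simp add: f_eq Q_def h_eq[OF tI])
  have Ft: "(\<lambda>y. F y t) = (\<lambda>x. G (\<phi> t x))" by (simp add: F_eq G_def)

  note G_smooth = smooth_gradient_graph[OF v[OF tI] G_def]
    and G_immersion = immersion_G[OF v[OF tI] G_def]
    and contraction = inv_metric_contraction_eigenbasis[OF v[OF tI] G_def r]
  have \<phi>: "smooth_on (\<phi> t) UNIV" and jac: "det (jacobian (\<phi> t) x) \<noteq> 0" for x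
    using phi_diffeo[OF t] det_jacobian_diffeomorphism by (auto simp: diffeomorphism_def)

  \<comment> \<open>the velocity of \<open>\<phi>\<^sub>t\<close>; its contributions to \<open>time\<close> and \<open>laplace\<close> cancel in the difference\<close>
  let ?V = "fst (mean_curvature_vector G y)"
  have time: "vector_derivative (\<lambda>s. f x s) (at t within time_interval T) = dd S (?V, 0) h z + dd S (0, 1) h z"
  proof -
    have "((\<lambda>s. fst (F x s)) has_vector_derivative ?V) (at t within I)"
      unfolding y_def G_def I_def by (rule bounded_linear.has_vector_derivative[OF bounded_linear_fst mcf[OF t]])
    then have "((\<lambda>s. \<phi> s x) has_vector_derivative ?V) (at t within I)"
      by (simp add: F_eq gradient_graph_def)
    from has_vector_derivative_along_curve[OF S' h' tI this]
    have "((\<lambda>s. h (\<phi> s x, s)) has_vector_derivative dd S (?V, 0) h z + dd S (0, 1) h z) (at t within I)"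
      by (simp add: S_def z_def y_def)
    then have "((\<lambda>s. f x s) has_vector_derivative dd S (?V, 0) h z + dd S (0, 1) h z) (at t within I)"
      by (rule has_vector_derivative_transform[OF tI, rotated]) (simp add: f_eq h_eq)
    then show ?thesis
      unfolding I_def[symmetric] by (rule vector_derivative_within[OF time_interval_nontrivial[OF S' tI]])
  qed
  have laplace: "laplace_beltrami (\<lambda>y. F y t) (\<lambda>y. f y t) x = (\<Sum>a\<in>UNIV. dd S (d a) (dd S (d a) h) z / q a) + dd S (?V, 0) h z"
  proof -
    have "laplace_beltrami (\<lambda>y. F y t) (\<lambda>y. f y t) x =
      (\<Sum>i\<in>UNIV. \<Sum>j\<in>UNIV. inv_metric G y $ i $ j * partial i (partial j Q) y) -
      (\<Sum>i\<in>UNIV. \<Sum>j\<in>UNIV. inv_metric G y $ i $ j * (partial i (partial j G) y \<bullet> ambient_gradient G Q y))"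
      unfolding Ft ft laplace_beltrami_compose[OF \<phi> G_smooth G_immersion Q jac] y_def[symmetric]
      by (simp add: right_diff_distrib sum_subtractf)
    also have "\<dots> = (\<Sum>i\<in>UNIV. \<Sum>j\<in>UNIV. inv_metric G y $ i $ j * partial i (partial j Q) y) + dd S (?V, 0) h z"
      using dd_fst_mean_curvature[OF v[OF tI] G_def Q, of y] by (simp add: dQ)
    also have "(\<Sum>i\<in>UNIV. \<Sum>j\<in>UNIV. inv_metric G y $ i $ j * partial i (partial j Q) y) =
      (\<Sum>a\<in>UNIV. dd UNIV (r a) (dd UNIV (r a) Q) y / q a)"
      unfolding contraction by (simp add: dd2_eq_sum_partial[OF Q] q_def)
    finally show ?thesis by (simp add: ddQ d_def)
  qed
  have gradient: "(metric_norm (\<lambda>y. F y t) x (metric_gradient (\<lambda>y. F y t) (\<lambda>y. f y t) x))\<^sup>2 =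
      (\<Sum>c\<in>UNIV. (dd S (d c) h z)\<^sup>2 / q c)"
  proof -
    have "(\<Sum>i\<in>UNIV. \<Sum>j\<in>UNIV. r a $ i * r a $ j * (partial i Q y * partial j Q y)) = (dd UNIV (r a) Q y)\<^sup>2" for a
      by (simp add: dd_eq_sum_partial[OF Q] power2_eq_square sum_product mult_ac)
    then show ?thesis
      unfolding Ft ft metric_norm_gradient_compose[OF \<phi> G_smooth G_immersion Q jac] y_def[symmetric] contraction
      by (simp add: dQ d_def q_def)
  qed
  have second_form: "A2 x t = (\<Sum>c\<in>UNIV. \<Sum>i\<in>UNIV. \<Sum>j\<in>UNIV. (D3 c i j)\<^sup>2 / (q c * q i * q j))"
  proof -
    have "dd UNIV (r a) (dd UNIV (r b) (dd UNIV (r c) (\<lambda>y. u y t))) y = D3 a b c" for a b c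
    proof -
      have "dd UNIV (r c) (\<lambda>y. u y t) = (\<lambda>y. dd S (r c, 0) U (y, t))"
        unfolding slice S_def by (rule ext) (rule dd_slice[OF U' tI])
      then show ?thesis
        using dd_dd_slice[OF S' smooth_on_dd[OF S U, unfolded S_def] tI] by (simp add: D3_def d_def S_def z_def)
    qed
    then show ?thesis
      unfolding A2_eq y_def[symmetric] sff_norm_squared_eigenbasis[OF v[OF tI] refl r] by (simp add: q_def)
  qed
  have "parabolic S (0, 1) d q z h \<ge> 2 * A2 x t + 1 / (real CARD('n) * (real CARD('n) - 1)) *
      (metric_norm (\<lambda>y. F y t) x (metric_gradient (\<lambda>y. F y t) (\<lambda>y. f y t) x))\<^sup>2"
    unfolding second_form gradient by (rule parabolic_log_det_ge[OF core])
  then show ?thesis by (simp add: time laplace parabolic_def)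
qed

end
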